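(* Let $g:(\pi,\sigma)\mapsto g(\pi,\sigma)$ be a multiplicative function. For $p\ge1$ let $$H_p(X_1,\dots,X_p)=\delta_{p,1}+\sum_{k_1,\dots,k_p\ge1}\tilde\alpha_{k_1,\dots,k_p}X_1^{k_1}\cdots X_p^{k_p},\qquad \tilde\alpha_{k_1,\dots,k_p}=g(1_{k_1+\cdots+k_p},\gamma_{k_1,\dots,k_p}).$$ For $p\ge1$ and $\lambda_1,\dots,\lambda_p\ge1$, with $n=\sum_i\lambda_i$ and $\gamma_\lambda=\gamma_{\lambda_1,\dots,\lambda_p}$, let $$\beta_{\lambda_1,\dots,\lambda_p}=\sum_{\tau\in\mathrm{NC}(\lambda_1)\times\cdots\times\mathrm{NC}(\lambda_p)}\ \sum_{\substack{\pi'\in\mathcal P(n),\ \pi'\ge\Pi(\tau)\\ \pi'\vee\Pi(\gamma_\lambda)=1_n\\ L[\pi',\,\Pi(\gamma_\lambda)\vee\Pi(\tau)\,;\,\Pi(\tau)]=0}}g(\pi',\tau),$$ and $B_p(X_1,\dots,X_p)=\delta_{p,1}+\sum_{\lambda_1,\dots,\lambda_p\ge1}\beta_{\lambda_1,\dots,\lambda_p}X_1^{\lambda_1}\cdots X_p^{\lambda_p}$. Then $$B_p(X_1,\dots,X_p)=\sum_{T\in\mathcal G_p}\Bigl(\prod_{i=1}^pX_i^{d_T(i)-1}\frac{\mathrm d^{\,d_T(i)-1}}{\mathrm dX_i^{\,d_T(i)-1}}\Bigr)\Biggl\{\prod_{i=1}^p\frac{\mathrm dY_i}{\mathrm dX_i}\prod_{I\in\mathcal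 I(T)}\frac{H_{|I|}(Y_I)}{\prod_{i\in I}B_1(X_i)}\Biggr\},$$ where $d_T(i)$ is the valency of the white vertex $i$ in $T$, $Y_I=\{Y_i\}_{i\in I}$, and $Y_i=X_iB_1(X_i)$ (for $p=1$, with the convention $\frac{\mathrm d^{-1}}{\mathrm dX_1^{-1}}\frac{\mathrm dY_1}{\mathrm dX_1}=Y_1$).
   Context: $\mathcal P(n)$ is the set of partitions of $\{1,\dots,n\}$, ordered by refinement $\le$, with join $\vee$; $\#(\pi)$ is the number of blocks, $1_n$ the one-block partition. For $\sigma\in S_n$, $\#(\sigma)$ is its number of cycles, $\Pi(\sigma)$ the partition into cycles, $\sigma_{|G}$ its restriction to a union $G$ of cycles. $\gamma_{\lambda_1,\dots,\lambda_p}=(1\cdots\lambda_1)(\lambda_1+1\cdots\lambda_1+\lambda_2)\cdots$. The genus $g(\sigma_1,\sigma_2)$ of a pair of permutations of $m$ elements (not to be confused with the function $g(\pi,\sigma)$) is defined by $\#(\sigma_1)+\#(\sigma_2)+\#(\sigma_1\sigma_2)-m=2\#(\Pi(\sigma_1)\vee\Pi(\sigma_2))-2g(\sigma_1,\sigma_2)$. For $\pi_1,\pi_2\ge\rho$ in $\mathcal P(n)$: $L[\pi_1,\pi_2;\rho]=\#(\rho)-\#(\pi_1)-\#(\pi_2)+\#(\pi_1\vee\pi_2)$. A (complex-valued) function $f$ of pairs $(\pi,\sigma)$, $\pi\in\mathcal P(n)$, $\sigma\in S_n$, $\pi\ge\Pi(\sigma)$, $n\ge1$, is multiplicative if $f(\pi,\sigma)=\prod_{G\in\pi}f(1_{|G|},\sigma_{|G})$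 and $f(1_n,\sigma)$ depends only on the multiset of cycle lengths of $\sigma$. $\mathrm{NC}(\lambda_1)\times\cdots\times\mathrm{NC}(\lambda_p)$ is the set of $\tau\in S_n$ with $\Pi(\tau)\le\Pi(\gamma_\lambda)$ such that, for each $i$, the restrictions $\tau_i,\gamma_i$ of $\tau,\gamma_\lambda$ to the support $\{\sum_{j<i}\lambda_j+1,\dots,\sum_{j\le i}\lambda_j\}$ of the $i$-th cycle of $\gamma_\lambda$ satisfy $g(\tau_i,\gamma_i^{-1})=0$. $\mathcal G_p$ is the set of bipartite trees with white vertices labeled $1,\dots,p$ and all black vertices of valency at least 2. Such a tree $T$ is encoded by the set $\mathcal I(T)$ of subsets $I\subset\{1,\dots,p\}$, $|I|\ge2$, one per black vertex, $I$ being the set of its white neighbours; these are exactly the sets of subsets whose associated bipartite graph is connected and with $\sum_I(|I|-1)=p-1$. $d_T(i)=|\{I\in\mathcal I(T):i\in I\}|$. $\mathcal G_1$ has a single element, with $\mathcal I(T)=\emptyset$. All series are formal power series. *)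

theory Defs
  imports
    Complex_Main
    "HOL-Library.Multiset"
    "HOL-Library.Disjoint_Sets"
    "HOL-Library.Groups_Big_Fun"
    "HOL-Combinatorics.Combinatorics"
begin

section \<open>Formal power series in several variables\<close>

text \<open>Monomials are finite multisets of variables: the monomial \<open>m\<close> contains the variable \<open>i\<close>
  with exponent \<open>count m i\<close>, and its total degree is \<open>size m\<close>.\<close>

typedef ('v, 'a) mfps = "UNIV :: ('v multiset \<Rightarrow> 'a) set"
  morphisms mfps_coeff Abs_mfps
  by simp

lemma mfps_coeff_Abs [simp]: "mfps_coeff (Abs_mfps f) = f"
  by (simp add: Abs_mfps_inverse)

lemma mfps_eqI: "(\<And>m. mfps_coeff f m = mfps_coeff g m) \<Longrightarrow> f = g"
  by (metis ext mfps_coeff_inject)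

lemma finite_submultisets: "finite {a. a \<subseteq># m}"
proof -
  obtain xs where xs: "m = mset xs"
    by (metis ex_mset)
  have "{a. a \<subseteq># m} \<subseteq> mset ` {ys. set ys \<subseteq> set xs \<and> length ys \<le> length xs}"
  proof
    fix a assume "a \<in> {a. a \<subseteq># m}"
    then have a: "a \<subseteq># m" by simp
    obtain ys where ys: "a = mset ys"
      by (metis ex_mset)
    have "set ys \<subseteq> set xs"
      using set_mset_mono[OF a] xs ys by simp
    moreover have "length ys \<le> length xs"
      using size_mset_mono[OF a] xs ys by simp
    ultimately show "a \<in> mset ` {ys. set ys \<subseteq> set xs \<and> length ys \<le> length xs}"
      using ys by blast
  qed
  then show ?thesis
    by (rule finite_subset) (simp add: finite_lists_length_le)
qed

instantiation mfps :: (type, comm_ring_1) comm_ring_1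
begin

definition "0 = Abs_mfps (\<lambda>_. 0)"
definition "1 = Abs_mfps (\<lambda>m. if m = {#} then 1 else 0)"
definition "f + g = Abs_mfps (\<lambda>m. mfps_coeff f m + mfps_coeff g m)"
definition "- f = Abs_mfps (\<lambda>m. - mfps_coeff f m)"
definition "f - g = Abs_mfps (\<lambda>m. mfps_coeff f m - mfps_coeff g m)"
definition "f * g = Abs_mfps (\<lambda>m. \<Sum>a | a \<subseteq># m. mfps_coeff f a * mfps_coeff g (m - a))"

instance
proof
  fix f g h :: "('a, 'b) mfps"
  show "f * g * h = f * (g * h)"
  proof (rule mfps_eqI)
    fix m :: "'a multiset"
    let ?S = "SIGMA a:{a. a \<subseteq># m}. {b. b \<subseteq># a}"
    let ?T = "SIGMA b:{b. b \<subseteq># m}. {c. c \<subseteq># m - b}"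
    have "mfps_coeff (f * g * h) m =
        (\<Sum>(a, b)\<in>?S. mfps_coeff f b * mfps_coeff g (a - b) * mfps_coeff h (m - a))"
      by (simp add: times_mfps_def sum_distrib_right sum.Sigma finite_submultisets)
    also have "\<dots> =
        (\<Sum>(b, c)\<in>?T. mfps_coeff f b * (mfps_coeff g c * mfps_coeff h (m - b - c)))"
    proof (rule sum.reindex_bij_witness[of _ "\<lambda>(b, c). (b + c, b)" "\<lambda>(a, b). (b, a - b)"],
        goal_cases)
      case (1 x) then show ?case by (auto simp: subset_mset.add_diff_inverse)
    next
      case (2 x) then show ?case
        by (auto simp: subseteq_mset_def diff_le_mono intro: le_trans)
    next
      case (3 x) then show ?case by auto
    next
      case (4 x) then show ?case
        by (auto simp: subset_mset.le_diff_conv2 add.commute)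
    next
      case (5 x)
      then show ?case
        by (clarsimp simp: mult.assoc)
    qed
    also have "\<dots> = mfps_coeff (f * (g * h)) m"
      by (simp add: times_mfps_def sum_distrib_left sum.Sigma finite_submultisets)
    finally show "mfps_coeff (f * g * h) m = mfps_coeff (f * (g * h)) m" .
  qed
  show "f * g = g * f"
  proof (rule mfps_eqI)
    fix m :: "'a multiset"
    have [simp]: "m - (m - a) = a" if "a \<subseteq># m" for a
      using that by (intro multiset_eqI) (simp add: subseteq_mset_def)
    show "mfps_coeff (f * g) m = mfps_coeff (g * f) m"
      unfolding times_mfps_def mfps_coeff_Abs
      by (rule sum.reindex_bij_witness[of _ "\<lambda>a. m - a" "\<lambda>a. m - a"])
        (auto simp: mult.commute)
  qed
  show "1 * f = f"
  proof (rule mfps_eqI)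
    fix m
    have "mfps_coeff (1 * f) m = (\<Sum>a | a \<subseteq># m. if a = {#} then mfps_coeff f (m - a) else 0)"
      by (auto simp: times_mfps_def one_mfps_def intro!: sum.cong)
    then show "mfps_coeff (1 * f) m = mfps_coeff f m"
      by (simp add: finite_submultisets)
  qed
  have "mfps_coeff (0 :: ('a, 'b) mfps) {#} \<noteq> mfps_coeff 1 {#}"
    by (simp add: one_mfps_def zero_mfps_def)
  then show "(0 :: ('a, 'b) mfps) \<noteq> 1"
    by auto
qed (auto intro!: mfps_eqI simp: zero_mfps_def plus_mfps_def minus_mfps_def uminus_mfps_def
      times_mfps_def algebra_simps sum.distrib)

end

function mfps_inverse_coeff :: "('v multiset \<Rightarrow> 'a::field) \<Rightarrow> 'v multiset \<Rightarrow> 'a" where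
  "mfps_inverse_coeff f m =
     (if m = {#} then inverse (f {#})
      else - inverse (f {#}) *
        (\<Sum>a | a \<subseteq># m \<and> a \<noteq> {#}. f a * mfps_inverse_coeff f (m - a)))"
  by auto
termination
proof (relation "measure (\<lambda>(f, m). size m)", goal_cases)
  case (2 f m a)
  then show ?case
    by (auto simp: size_Diff_submset nonempty_has_size dest!: size_mset_mono)
qed simp

declare mfps_inverse_coeff.simps [simp del]

instantiation mfps :: (type, field) inverse
begin

definition "inverse f = Abs_mfps (mfps_inverse_coeff (mfps_coeff f))"
definition divide_mfps_def: "f div g = f * inverse (g :: ('a, 'b) mfps)"

instance ..

end

lemma mfps_right_inverse:
  fixes f :: "('v, 'a::field) mfps"
  assumes "mfps_coeff f {#} \<noteq> 0"
  shows "f * inverse f = 1"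
proof (rule mfps_eqI)
  fix m :: "'v multiset"
  let ?c = "mfps_coeff f" and ?d = "mfps_inverse_coeff (mfps_coeff f)"
  have split: "{a. a \<subseteq># m} = insert {#} {a. a \<subseteq># m \<and> a \<noteq> {#}}"
    by auto
  have "mfps_coeff (f * inverse f) m =
      ?c {#} * ?d m + (\<Sum>a | a \<subseteq># m \<and> a \<noteq> {#}. ?c a * ?d (m - a))"
    unfolding times_mfps_def inverse_mfps_def mfps_coeff_Abs split
    by (subst sum.insert) (auto intro: finite_subset[OF _ finite_submultisets[of m]])
  also have "\<dots> = mfps_coeff 1 m"
  proof (cases "m = {#}")
    case True
    then have "{a. a \<subseteq># m \<and> a \<noteq> {#}} = {}" by auto
    then show ?thesis
      using True assms by (simp add: mfps_inverse_coeff.simps one_mfps_def)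
  next
    case False
    then show ?thesis
      using assms by (simp add: mfps_inverse_coeff.simps[of _ m] one_mfps_def)
  qed
  finally show "mfps_coeff (f * inverse f) m = mfps_coeff 1 m" .
qed

definition mfps_X :: "'v \<Rightarrow> ('v, 'a::comm_ring_1) mfps" where
  "mfps_X i = Abs_mfps (\<lambda>m. if m = {#i#} then 1 else 0)"

definition mfps_deriv :: "'v \<Rightarrow> ('v, 'a::comm_ring_1) mfps \<Rightarrow> ('v, 'a) mfps" where
  "mfps_deriv i f = Abs_mfps (\<lambda>m. of_nat (count m i + 1) * mfps_coeff f (add_mset i m))"

text \<open>The antiderivative in the variable \<open>i\<close> that has no term free of \<open>i\<close>.\<close>

definition mfps_integral :: "'v \<Rightarrow> ('v, 'a::field) mfps \<Rightarrow> ('v, 'a) mfps" where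
  "mfps_integral i f = Abs_mfps (\<lambda>m. if i \<in># m
      then mfps_coeff f (m - {#i#}) / of_nat (count m i) else 0)"

text \<open>Division by the variable \<open>i\<close>, for series all of whose terms contain \<open>i\<close>.\<close>

definition mfps_shift :: "'v \<Rightarrow> ('v, 'a) mfps \<Rightarrow> ('v, 'a) mfps" where
  "mfps_shift i f = Abs_mfps (\<lambda>m. mfps_coeff f (add_mset i m))"

text \<open>Simultaneous substitution of \<open>Y i\<close> for every variable \<open>i\<close>. The sum defining a coefficient
  of the result is finite whenever \<open>f\<close> involves finitely many variables and the series
  substituted for them have no constant term (see \<open>mfps_subst_finite\<close>); an infinite
  sum would silently be \<open>0\<close>.\<close>

definition mfps_subst :: "('v \<Rightarrow> ('w, 'a::comm_ring_1) mfps) \<Rightarrow> ('v, 'a) mfps \<Rightarrow> ('w, 'a) mfps" where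
  "mfps_subst Y f = Abs_mfps (\<lambda>m.
     Sum_any (\<lambda>k. mfps_coeff f k * mfps_coeff (\<Prod>\<^sub># (image_mset Y k)) m))"

lemma mfps_coeff_prod_eq_0:
  fixes Y :: "'v \<Rightarrow> ('w, 'a::comm_ring_1) mfps"
  assumes "\<And>i. i \<in># k \<Longrightarrow> mfps_coeff (Y i) {#} = 0" and "size m < size k"
  shows "mfps_coeff (\<Prod>\<^sub># (image_mset Y k)) m = 0"
  using assms
proof (induction k arbitrary: m)
  case (add i k)
  have "mfps_coeff (Y i) a * mfps_coeff (\<Prod>\<^sub># (image_mset Y k)) (m - a) = 0" if "a \<subseteq># m" for a
  proof (cases "a = {#}")
    case False
    then have "size (m - a) < size k"
      using that add.prems(2) size_mset_mono[OF that]
      by (auto simp: size_Diff_submset nonempty_has_size)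
    then show ?thesis
      using add by simp
  qed (use add.prems in simp)
  then show ?case
    by (simp add: times_mfps_def)
qed simp

lemma mfps_subst_finite:
  fixes Y :: "'v \<Rightarrow> ('w, 'a::comm_ring_1) mfps"
  assumes "finite V" and "\<And>k. mfps_coeff f k \<noteq> 0 \<Longrightarrow> set_mset k \<subseteq> V"
    and "\<And>i. i \<in> V \<Longrightarrow> mfps_coeff (Y i) {#} = 0"
  shows "finite {k. mfps_coeff f k * mfps_coeff (\<Prod>\<^sub># (image_mset Y k)) m \<noteq> 0}"
proof (rule finite_subset)
  show "{k. mfps_coeff f k * mfps_coeff (\<Prod>\<^sub># (image_mset Y k)) m \<noteq> 0}
      \<subseteq> mset ` {ys. set ys \<subseteq> V \<and> length ys \<le> size m}"
  proof
    fix k assume k: "k \<in> {k. mfps_coeff f k * mfps_coeff (\<Prod>\<^sub># (image_mset Y k)) m \<noteq> 0}"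
    then have "mfps_coeff f k \<noteq> 0"
      by auto
    then have V: "set_mset k \<subseteq> V"
      by (rule assms(2))
    have "mfps_coeff (\<Prod>\<^sub># (image_mset Y k)) m \<noteq> 0"
      using k by auto
    then have "\<not> size m < size k"
      using mfps_coeff_prod_eq_0[of k Y m] assms(3) V by blast
    moreover obtain ys where "k = mset ys"
      by (metis ex_mset)
    ultimately show "k \<in> mset ` {ys. set ys \<subseteq> V \<and> length ys \<le> size m}"
      using V by (metis (mono_tags, lifting) image_eqI linorder_not_less mem_Collect_eq set_mset_mset
          size_mset)
  qed
qed (use assms(1) in \<open>simp add: finite_lists_length_le\<close>)

text \<open>The operator $X_i^{d-1}\,\mathrm d^{d-1}/\mathrm dX_i^{d-1}$, where for $d = 0$ the
  derivative of order $-1$ is the antiderivative without constant term.\<close>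

definition diff_op :: "'v \<Rightarrow> nat \<Rightarrow> ('v, 'a::field) mfps \<Rightarrow> ('v, 'a) mfps" where
  "diff_op i d f =
     (if d = 0 then mfps_shift i (mfps_integral i f)
      else mfps_X i ^ (d - 1) * (mfps_deriv i ^^ (d - 1)) f)"

lemma mfps_integral_deriv:
  fixes f :: "('v, 'a::field_char_0) mfps"
  assumes "\<And>m. i \<notin># m \<Longrightarrow> mfps_coeff f m = 0"
  shows "mfps_integral i (mfps_deriv i f) = f"
proof (rule mfps_eqI)
  fix m
  show "mfps_coeff (mfps_integral i (mfps_deriv i f)) m = mfps_coeff f m"
  proof (cases "i \<in># m")
    case True
    then obtain k where "m = add_mset i k"
      by (metis multi_member_split)
    moreover have "(1 + of_nat (count k i) :: 'a) \<noteq> 0"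
      by (metis of_nat_Suc of_nat_neq_0)
    ultimately show ?thesis
      by (simp add: mfps_integral_def mfps_deriv_def)
  qed (use assms in \<open>simp add: mfps_integral_def\<close>)
qed


section \<open>Partitions and permutations\<close>

text \<open>The join of two partitions; \<open>part_join_least\<close> shows that it is their least upper bound.\<close>

definition part_join :: "'a set set \<Rightarrow> 'a set set \<Rightarrow> 'a set set" where
  "part_join P Q = (\<Union>P \<union> \<Union>Q) // {(x, y). \<exists>B\<in>P \<union> Q. x \<in> B \<and> y \<in> B}\<^sup>+"

lemma part_join_least:
  assumes P: "partition_on A P" and Q: "partition_on A Q"
  shows "refines A P (part_join P Q)" and "refines A Q (part_join P Q)"
    and "refines A P R \<Longrightarrow> refines A Q R \<Longrightarrow> refines A (part_join P Q) R"
proof -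
  let ?r = "{(x, y). \<exists>B\<in>P \<union> Q. x \<in> B \<and> y \<in> B}"
  have A: "A = \<Union>P" "A = \<Union>Q"
    using P Q by (auto simp: partition_on_def)
  have "sym ?r"
    by (auto intro: symI)
  then have r: "sym (?r\<^sup>+)" "trans (?r\<^sup>+)"
    by (auto intro: sym_trancl)
  have "?r \<subseteq> A \<times> A"
    using A by auto
  then have rA: "?r\<^sup>+ \<subseteq> A \<times> A"
    by (rule trancl_subset_Sigma)
  have "refl_on A (?r\<^sup>+)"
    using A by (intro refl_onI) (auto intro!: r_into_trancl)
  then have eq: "equiv A (?r\<^sup>+)"
    using r rA by (intro equivI)
  have J: "part_join P Q = A // ?r\<^sup>+"
    using A by (simp add: part_join_def)
  have part: "partition_on A (part_join P Q)"
    unfolding J by (rule partition_on_quotient[OF eq])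
  have sub: "\<exists>Y\<in>part_join P Q. X \<subseteq> Y" if X: "X \<in> P \<union> Q" for X
  proof -
    have "X \<noteq> {}"
      using X P Q by (auto simp: partition_on_def)
    then obtain x where x: "x \<in> X" by blast
    have "?r\<^sup>+ `` {x} \<in> part_join P Q"
      unfolding J using x X A by (auto intro!: quotientI)
    moreover have "X \<subseteq> ?r\<^sup>+ `` {x}"
      using x X by (auto intro!: r_into_trancl)
    ultimately show ?thesis by blast
  qed
  show "refines A P (part_join P Q)" "refines A Q (part_join P Q)"
    using P Q part sub by (auto simp: refines_def)
  assume R: "refines A P R" "refines A Q R"
  then have pR: "partition_on A R"
    by (simp add: refines_def)
  have "\<exists>Y\<in>R. X \<subseteq> Y" if "X \<in> part_join P Q" for X
  proof -
    from that obtain x where x: "x \<in> A" "X = ?r\<^sup>+ `` {x}"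
      unfolding J by (auto elim!: quotientE)
    then obtain Y where Y: "Y \<in> R" "x \<in> Y"
      using pR by (auto simp: partition_on_def)
    have "y \<in> Y" if "(x, y) \<in> ?r\<^sup>+" for y
      using that
    proof (induction rule: trancl_induct)
      case (base y)
      then obtain B where B: "B \<in> P \<union> Q" "x \<in> B" "y \<in> B" by auto
      then obtain Z where Z: "Z \<in> R" "B \<subseteq> Z"
        using R by (auto simp: refines_def)
      moreover have "Z = Y"
        using Z B Y partition_onD2[OF pR] by (meson disjoint_iff disjointD subsetD)
      ultimately show ?case
        using B by blast
    next
      case (step y z)
      then obtain B where B: "B \<in> P \<union> Q" "y \<in> B" "z \<in> B" by auto
      then obtain Z where Z: "Z \<in> R" "B \<subseteq> Z"
        using R by (auto simp: refines_def)
      moreover have "Z = Y"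
        using Z B Y step.IH partition_onD2[OF pR] by (meson disjoint_iff disjointD subsetD)
      ultimately show ?case
        using B by blast
    qed
    then show ?thesis
      using x Y by blast
  qed
  then show "refines A (part_join P Q) R"
    using part pR by (simp add: refines_def)
qed

definition cycle_partition :: "'a set \<Rightarrow> ('a \<Rightarrow> 'a) \<Rightarrow> 'a set set" where
  "cycle_partition A \<sigma> = orbit \<sigma> ` A"

definition cycle_type :: "'a set \<Rightarrow> ('a \<Rightarrow> 'a) \<Rightarrow> nat multiset" where
  "cycle_type A \<sigma> = image_mset card (mset_set (cycle_partition A \<sigma>))"

definition genus :: "'a set \<Rightarrow> ('a \<Rightarrow> 'a) \<Rightarrow> ('a \<Rightarrow> 'a) \<Rightarrow> rat" where
  "genus A \<sigma> \<tau> =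
     of_nat (card (part_join (cycle_partition A \<sigma>) (cycle_partition A \<tau>))) -
     (of_nat (card (cycle_partition A \<sigma>)) + of_nat (card (cycle_partition A \<tau>))
       + of_nat (card (cycle_partition A (\<sigma> \<circ> \<tau>))) - of_nat (card A)) / 2"

text \<open>The quantity $L[\pi_1,\pi_2;\rho]$.\<close>

definition L_loops :: "'a set set \<Rightarrow> 'a set set \<Rightarrow> 'a set set \<Rightarrow> int" where
  "L_loops P1 P2 R =
     int (card R) - int (card P1) - int (card P2) + int (card (part_join P1 P2))"

text \<open>The restriction of \<open>\<sigma>\<close> to a finite union \<open>G\<close> of cycles, relabelled as a permutation of
  \<open>{1..card G}\<close> along the increasing bijection.\<close>

definition std_restrict :: "(nat \<Rightarrow> nat) \<Rightarrow> nat set \<Rightarrow> nat \<Rightarrow> nat" where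
  "std_restrict \<sigma> G = map_permutation G (\<lambda>x. card {y \<in> G. y \<le> x}) \<sigma>"

text \<open>A function of pairs $(\pi,\sigma)$ is a curried function; the number \<open>n\<close> is determined by
  $\pi$, as $\bigcup\pi = \{1,\dots,n\}$. Values at pairs not satisfying $\pi\ge\Pi(\sigma)$ are irrelevant.\<close>

definition multiplicative :: "(nat set set \<Rightarrow> (nat \<Rightarrow> nat) \<Rightarrow> complex) \<Rightarrow> bool" where
  "multiplicative f \<longleftrightarrow>
     (\<forall>n \<pi> \<sigma>. n \<ge> 1 \<and> \<sigma> permutes {1..n} \<and> refines {1..n} (cycle_partition {1..n} \<sigma>) \<pi> \<longrightarrow>
        f \<pi> \<sigma> = (\<Prod>G\<in>\<pi>. f {{1..card G}} (std_restrict \<sigma> G))) \<and>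
     (\<forall>n \<sigma> \<tau>. n \<ge> 1 \<and> \<sigma> permutes {1..n} \<and> \<tau> permutes {1..n} \<and>
        cycle_type {1..n} \<sigma> = cycle_type {1..n} \<tau> \<longrightarrow> f {{1..n}} \<sigma> = f {{1..n}} \<tau>)"

text \<open>The support of the cycle of index \<open>i\<close> (counted from \<open>0\<close>) of $\gamma_{ls}$.\<close>

definition cycle_support :: "nat list \<Rightarrow> nat \<Rightarrow> nat set" where
  "cycle_support ls i = {sum_list (take i ls) + 1..sum_list (take (Suc i) ls)}"

definition gamma_perm :: "nat list \<Rightarrow> nat \<Rightarrow> nat" where
  "gamma_perm ls =
     foldr (\<lambda>i \<sigma>. cycle_of_list (sorted_list_of_set (cycle_support ls i)) \<circ> \<sigma>) [0..<length ls] id"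

definition NC :: "nat list \<Rightarrow> (nat \<Rightarrow> nat) set" where
  "NC ls = {\<tau>. \<tau> permutes {1..sum_list ls} \<and>
     refines {1..sum_list ls}
       (cycle_partition {1..sum_list ls} \<tau>) (cycle_partition {1..sum_list ls} (gamma_perm ls)) \<and>
     (\<forall>i<length ls. genus (cycle_support ls i)
        (perm_restrict \<tau> (cycle_support ls i))
        (inv (perm_restrict (gamma_perm ls) (cycle_support ls i))) = 0)}"


section \<open>The generating series\<close>

definition alpha :: "(nat set set \<Rightarrow> (nat \<Rightarrow> nat) \<Rightarrow> complex) \<Rightarrow> nat list \<Rightarrow> complex" where
  "alpha g ks = g {{1..sum_list ks}} (gamma_perm ks)"

definition beta :: "(nat set set \<Rightarrow> (nat \<Rightarrow> nat) \<Rightarrow> complex) \<Rightarrow> nat list \<Rightarrow> complex" where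
  "beta g ls =
     (let n = sum_list ls; \<Gamma> = cycle_partition {1..n} (gamma_perm ls) in
      \<Sum>\<tau>\<in>NC ls.
        \<Sum>\<pi> | refines {1..n} (cycle_partition {1..n} \<tau>) \<pi> \<and> part_join \<pi> \<Gamma> = {{1..n}} \<and>
            L_loops \<pi> (part_join \<Gamma> (cycle_partition {1..n} \<tau>)) (cycle_partition {1..n} \<tau>) = 0.
          g \<pi> \<tau>)"

text \<open>$\delta_{p,1}+\sum_{k_1,\dots,k_p\ge1}a_{k_1,\dots,k_p}X_1^{k_1}\cdots X_p^{k_p}$, for $p\ge1$:
  the monomials of the sum are those in which exactly \<open>1..p\<close> occur.\<close>

definition gen_series :: "(nat list \<Rightarrow> complex) \<Rightarrow> nat \<Rightarrow> (nat, complex) mfps" where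
  "gen_series a p = (if p = 1 then 1 else 0) +
     Abs_mfps (\<lambda>m. if set_mset m = {1..p} then a (map (count m) [1..<p + 1]) else 0)"

definition H_series :: "(nat set set \<Rightarrow> (nat \<Rightarrow> nat) \<Rightarrow> complex) \<Rightarrow> nat \<Rightarrow> (nat, complex) mfps" where
  "H_series g = gen_series (alpha g)"

definition B_series :: "(nat set set \<Rightarrow> (nat \<Rightarrow> nat) \<Rightarrow> complex) \<Rightarrow> nat \<Rightarrow> (nat, complex) mfps" where
  "B_series g = gen_series (beta g)"

text \<open>$B_1(X_i)$ and $Y_i = X_iB_1(X_i)$.\<close>

definition B1_at :: "(nat set set \<Rightarrow> (nat \<Rightarrow> nat) \<Rightarrow> complex) \<Rightarrow> nat \<Rightarrow> (nat, complex) mfps" where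
  "B1_at g i = mfps_subst (\<lambda>_. mfps_X i) (B_series g 1)"

definition Y_series :: "(nat set set \<Rightarrow> (nat \<Rightarrow> nat) \<Rightarrow> complex) \<Rightarrow> nat \<Rightarrow> (nat, complex) mfps" where
  "Y_series g i = mfps_X i * B1_at g i"

text \<open>$H_{|I|}(Y_I)$: the \<open>j\<close>-th variable of $H_{|I|}$ is replaced by $Y_i$ for the \<open>j\<close>-th smallest
  element \<open>i\<close> of \<open>I\<close>. For multiplicative \<open>g\<close>, $H_{|I|}$ is symmetric in its variables.\<close>

definition H_at :: "(nat set set \<Rightarrow> (nat \<Rightarrow> nat) \<Rightarrow> complex) \<Rightarrow> nat set \<Rightarrow> (nat, complex) mfps" where
  "H_at g I = mfps_subst (\<lambda>j. Y_series g (sorted_list_of_set I ! (j - 1))) (H_series g (card I))"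

lemma mfps_integral_deriv_Y:
  "mfps_integral i (mfps_deriv i (Y_series g i)) = Y_series g i"
proof (rule mfps_integral_deriv)
  fix m :: "nat multiset" assume "i \<notin># m"
  then show "mfps_coeff (Y_series g i) m = 0"
    by (auto simp: Y_series_def times_mfps_def mfps_X_def intro!: sum.neutral)
qed


section \<open>Bipartite trees\<close>

text \<open>The bipartite graph with white vertices \<open>Inl i\<close> for \<open>i\<close> in \<open>{1..p}\<close> and black vertices
  \<open>Inr I\<close> for \<open>I\<close> in \<open>\<I>\<close>, in which \<open>I\<close> is the set of neighbours of \<open>Inr I\<close>.\<close>

definition bip_vertices :: "nat \<Rightarrow> nat set set \<Rightarrow> (nat + nat set) set" where
  "bip_vertices p \<I> = Inl ` {1..p} \<union> Inr ` \<I>"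

definition bip_edges :: "nat set set \<Rightarrow> ((nat + nat set) \<times> (nat + nat set)) set" where
  "bip_edges \<I> = {(Inl i, Inr I) | i I. I \<in> \<I> \<and> i \<in> I}"

definition bip_connected :: "nat \<Rightarrow> nat set set \<Rightarrow> bool" where
  "bip_connected p \<I> \<longleftrightarrow>
     (\<forall>u\<in>bip_vertices p \<I>. \<forall>v\<in>bip_vertices p \<I>. (u, v) \<in> (bip_edges \<I> \<union> (bip_edges \<I>)\<inverse>)\<^sup>*)"

text \<open>A tree is represented by its set of black neighbourhoods. For a connected graph, the
  condition on the cardinalities says that the number of edges is one less than the number
  of vertices, i.e. that the graph is a tree.\<close>

definition bip_trees :: "nat \<Rightarrow> nat set set set" where
  "bip_trees p = {\<I>. (\<forall>I\<in>\<I>. I \<subseteq> {1..p} \<and> card I \<ge> 2) \<and> bip_connected p \<I> \<and>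
     (\<Sum>I\<in>\<I>. card I - 1) = p - 1}"

definition white_degree :: "nat set set \<Rightarrow> nat \<Rightarrow> nat" where
  "white_degree \<I> i = card {I \<in> \<I>. i \<in> I}"

text \<open>The product over \<open>i\<close> of the operators \<open>diff_op i (d i)\<close>, which commute since they act on
  different variables.\<close>

definition diff_ops :: "nat \<Rightarrow> (nat \<Rightarrow> nat) \<Rightarrow> (nat, complex) mfps \<Rightarrow> (nat, complex) mfps" where
  "diff_ops p d F = foldr (\<lambda>i. diff_op i (d i)) [1..<p + 1] F"

end

theory Submission
  imports Defs "HOL-Computational_Algebra.Formal_Power_Series"
begin

text \<open>
  Let \<open>\<tau>\<close> be in \<open>NC(\<lambda>)\<close>. The condition \<open>L = 0\<close> says that the bipartite graph with the cycles of
  \<open>\<gamma>\<close> as white vertices, the blocks of \<open>\<pi>'\<close> as black vertices and the cycles of \<open>\<tau>\<close> as edges is a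
  tree. Cutting off its black leaves gives \<open>T\<close>, and \<open>\<pi>'\<close> is recovered from \<open>T\<close> by choosing, for every
  white vertex \<open>i\<close>, distinct cycles of \<open>\<tau>\<close> in the \<open>i\<close>-th support, one for each neighbour of \<open>i\<close>. Hence
  \<open>\<beta>\<close> is a sum over \<open>T\<close> of products of weighted numbers of noncrossing permutations with \<open>d = d_T(i)\<close>
  marked cycles of prescribed lengths.

  Without marks, and with weight \<open>w k\<close> for a cycle of length \<open>k\<close>, the generating function \<open>B\<close> of these
  numbers satisfies \<open>B(X) = H(X B(X))\<close>, where \<open>H(z)\<close> is the sum of \<open>1\<close> and the \<open>w k z^k\<close>: multiplying \<open>\<tau>\<close>
  and a cycle \<open>\<gamma>\<close> by the same transposition isolates a point of \<open>\<tau>\<close> and cuts \<open>\<gamma>\<close> into two cycles. By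
  Lagrange inversion, the number for length \<open>n\<close> is the coefficient of \<open>z^n\<close> in \<open>H^(n+1) / (n+1)\<close>. To mark
  a cycle of length \<open>k\<close> is to differentiate with respect to \<open>w k\<close>, so \<open>d\<close> marked cycles of total length
  \<open>K\<close> yield the coefficient of \<open>z^(n-K)\<close> in \<open>n (n-1) \<dots> (n-d+2) H^(n+1-d)\<close>. With \<open>Y = X B(X)\<close>, Lagrange
  inversion turns this into the coefficient of \<open>X^n\<close> in \<open>X^(d-1) D^(d-1) (Y' Y^K / B^d)\<close>, and the product
  over the white vertices gives the summand of \<open>T\<close>.
\<close>

unbundle fps_syntax

section \<open>Cycles and transpositions\<close>

text \<open>Measure a permutation by \<open>card A\<close> minus its number of cycles. Genus zero
  then means that \<open>\<tau>\<close> lies on a shortest path from the identity to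
  \<open>\<gamma>\<close>; hence the name \<open>geodesic\<close>. Cutting a cycle leaves a
  \<open>\<gamma>\<close> with several cycles, so the condition is needed for these too. There a
  triangle inequality holds on every block, and equality of the totals forces equality on each
  block; this makes the sums factorise. The constants match as follows. After \<open>d\<close>
  derivatives, \<open>H^(n+1) / (n+1)\<close> has \<open>d - 1\<close> factors \<open>n\<close>,
  \<open>n - 1\<close>, ..., the same that \<open>d - 1\<close> derivatives produce from
  \<open>X^n\<close>; dividing by \<open>B^d\<close> turns the Lagrange exponent
  \<open>n + 1\<close> into \<open>n + 1 - d\<close>. Differentiation with respect to
  \<open>w k\<close> takes place in the complex numbers: for fixed \<open>n\<close>, replacing
  \<open>w k\<close> by \<open>w k + \<epsilon>\<close> gives an identity of polynomials in
  \<open>\<epsilon>\<close>, which is differentiated at \<open>0\<close>. The case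
  \<open>p = 1\<close> stands apart, since its only tree marks no cycle and its operator is an
  antiderivative.\<close>

lemma orbit_self:
  assumes "finite A" "f permutes A" shows "x \<in> orbit f x"
  using assms by (intro permutation_self_in_orbit) (auto simp: permutation_permutes)

lemma orbit_eq_iff:
  assumes "finite A" "f permutes A" shows "orbit f y = orbit f x \<longleftrightarrow> y \<in> orbit f x"
  by (metis assms cyclic_on_alldef cyclic_on_orbit orbit_self)

lemma partition_on_cycle_partition:
  assumes "finite A" "f permutes A" shows "partition_on A (cycle_partition A f)"
proof (rule partition_onI)
  show "\<Union> (cycle_partition A f) = A"
    using permutes_orbit_subset[OF assms(2)] orbit_self[OF assms]
    by (auto simp: cycle_partition_def)
next
  fix p q assume "p \<in> cycle_partition A f" "q \<in> cycle_partition A f" "p \<noteq> q"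
  then show "disjnt p q"
    using orbit_eq_iff[OF assms] unfolding cycle_partition_def disjnt_def by blast
next
  show "{} \<notin> cycle_partition A f" using orbit_nonempty by (fastforce simp: cycle_partition_def)
qed

lemma finite_cycle_partition: "finite A \<Longrightarrow> finite (cycle_partition A f)"
  by (simp add: cycle_partition_def)

lemma cycle_partition_eq_orbit:
  assumes "finite A" "f permutes A" "c \<in> cycle_partition A f" "x \<in> c"
  shows "c = orbit f x"
proof -
  obtain z where "c = orbit f z" using assms(3) by (auto simp: cycle_partition_def)
  then show ?thesis using assms(4) orbit_eq_iff[OF assms(1,2)] by metis
qed

abbreviation ncyc :: "'a set \<Rightarrow> ('a \<Rightarrow> 'a) \<Rightarrow> nat" where
  "ncyc A f \<equiv> card (cycle_partition A f)"

section \<open>Composition of a permutation with a transposition\<close>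

context
  fixes A :: "'a set" and f g :: "'a \<Rightarrow> 'a" and x y :: 'a
  assumes A: "finite A" "f permutes A" and xy: "x \<in> A" "y \<in> A" "x \<noteq> y"
  defines "g \<equiv> f \<circ> transpose x y"
begin

lemma permutes_comp_transpose: "g permutes A"
  unfolding g_def using A xy by (intro permutes_compose permutes_swap_id)

lemma orbit_transpose_avoid:
  assumes "x \<notin> orbit f z" "y \<notin> orbit f z" shows "orbit g z = orbit f z"
  by (rule orbit_cong[OF orbit_self[OF A]])
    (use assms in \<open>auto simp: g_def transpose_def\<close>)

lemma orbit_transpose_avoid':
  assumes "x \<notin> orbit g z" "y \<notin> orbit g z" shows "orbit f z = orbit g z"
  by (rule orbit_cong[OF orbit_self[OF A(1) permutes_comp_transpose]])
    (use assms in \<open>auto simp: g_def transpose_def\<close>)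

text \<open>Along a cycle that avoids \<open>x\<close> and \<open>y\<close> the two maps coincide.
  So only the cycles through \<open>x\<close> or \<open>y\<close> have to be compared.\<close>

lemma cycle_partition_transpose_avoid:
  "{c \<in> cycle_partition A g. x \<notin> c \<and> y \<notin> c} = {c \<in> cycle_partition A f. x \<notin> c \<and> y \<notin> c}"
proof (intro equalityI subsetI)
  fix c assume "c \<in> {c \<in> cycle_partition A g. x \<notin> c \<and> y \<notin> c}"
  then obtain z where "z \<in> A" "c = orbit g z" "x \<notin> c" "y \<notin> c" by (auto simp: cycle_partition_def)
  then show "c \<in> {c \<in> cycle_partition A f. x \<notin> c \<and> y \<notin> c}"
    using orbit_transpose_avoid'[of z] by (auto simp: cycle_partition_def image_iff intro!: bexI[of _ z])
next
  fix c assume "c \<in> {c \<in> cycle_partition A f. x \<notin> c \<and> y \<notin> c}"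
  then obtain z where "z \<in> A" "c = orbit f z" "x \<notin> c" "y \<notin> c" by (auto simp: cycle_partition_def)
  then show "c \<in> {c \<in> cycle_partition A g. x \<notin> c \<and> y \<notin> c}"
    using orbit_transpose_avoid[of z] by (auto simp: cycle_partition_def image_iff intro!: bexI[of _ z])
qed

lemma cycle_partition_split2:
  assumes "h permutes A"
  shows "cycle_partition A h = insert (orbit h x) (insert (orbit h y)
    {c \<in> cycle_partition A h. x \<notin> c \<and> y \<notin> c})"
proof (intro equalityI subsetI)
  fix c assume c: "c \<in> cycle_partition A h"
  have "x \<in> c \<Longrightarrow> c = orbit h x" "y \<in> c \<Longrightarrow> c = orbit h y"
    using cycle_partition_eq_orbit[OF A(1) assms c] by blast+
  then show "c \<in> insert (orbit h x) (insert (orbit h y)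
      {c \<in> cycle_partition A h. x \<notin> c \<and> y \<notin> c})"
    using c by blast
qed (use xy in \<open>auto simp: cycle_partition_def\<close>)

lemma card_cycle_partition_split2:
  assumes "h permutes A"
  shows "ncyc A h = card {c \<in> cycle_partition A h. x \<notin> c \<and> y \<notin> c}
    + (if y \<in> orbit h x then 1 else 2)"
proof -
  let ?N = "{c \<in> cycle_partition A h. x \<notin> c \<and> y \<notin> c}"
  have "finite ?N" using finite_cycle_partition[OF A(1)] by simp
  moreover have "orbit h x \<notin> ?N" "orbit h y \<notin> ?N" using orbit_self[OF A(1) assms] by auto
  moreover have "orbit h x = orbit h y \<longleftrightarrow> y \<in> orbit h x"
    using orbit_eq_iff[OF A(1) assms] by metis
  ultimately have "card (insert (orbit h x) (insert (orbit h y) ?N)) =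
      card ?N + (if y \<in> orbit h x then 1 else 2)"
    by (simp add: card_insert_if)
  then show ?thesis using cycle_partition_split2[OF assms] by simp
qed

text \<open>First \<open>g y = f x\<close>; after that the transposition is not felt until the
  \<open>f\<close>-trajectory of \<open>x\<close> meets \<open>x\<close> or
  \<open>y\<close>.\<close>

lemma funpow_transpose:
  assumes "0 < i" "i \<le> m" "\<And>k. 0 < k \<Longrightarrow> k < m \<Longrightarrow> (f ^^ k) x \<noteq> x \<and> (f ^^ k) x \<noteq> y"
  shows "(g ^^ i) y = (f ^^ i) x"
  using assms(1,2)
proof (induction i)
  case (Suc i)
  show ?case
  proof (cases "i = 0")
    case True then show ?thesis by (simp add: g_def)
  next
    case False
    then have "(g ^^ i) y = (f ^^ i) x" "(f ^^ i) x \<noteq> x" "(f ^^ i) x \<noteq> y"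
      using Suc assms(3)[of i] by auto
    then have "(g ^^ Suc i) y = f (transpose x y ((f ^^ i) x))" by (simp add: g_def)
    then show ?thesis using \<open>(f ^^ i) x \<noteq> x\<close> \<open>(f ^^ i) x \<noteq> y\<close> by simp
  qed
qed simp

lemma orbit_transpose_arc:
  assumes "0 < m" "(f ^^ m) x = y" "\<And>k. 0 < k \<Longrightarrow> k < m \<Longrightarrow> (f ^^ k) x \<noteq> x \<and> (f ^^ k) x \<noteq> y"
  shows "orbit g y = (\<lambda>i. (f ^^ i) x) ` {1..m}"
proof -
  have fp: "(g ^^ i) y = (f ^^ i) x" if "0 < i" "i \<le> m" for i
    by (rule funpow_transpose[OF that]) (use assms(3) in auto)
  have "(g ^^ m) y = y" using fp[of m] assms(1,2) by simp
  then have o: "orbit g y = {(g ^^ i) y |i. i < m}"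
    using assms(1) by (rule orbit_altdef_bounded)
  have "(g ^^ i) y \<in> (\<lambda>i. (f ^^ i) x) ` {1..m}" if "i < m" for i
  proof (cases "i = 0")
    case True then show ?thesis using assms(1,2) by force
  qed (use that fp[of i] in auto)
  moreover have "(f ^^ i) x \<in> {(g ^^ i) y |i. i < m}" if "1 \<le> i" "i \<le> m" for i
  proof (cases "i = m")
    case True then show ?thesis using assms by (auto intro: exI[of _ 0])
  next
    case False
    then show ?thesis using that fp[of i] by (intro CollectI exI[of _ i]) auto
  qed
  ultimately show ?thesis unfolding o by auto
qed

lemma orbit_transpose_separates:
  assumes "y \<in> orbit f x" shows "x \<notin> orbit g y"
proof -
  define m where "m = (LEAST m. 0 < m \<and> (f ^^ m) x = y)"
  have ex: "\<exists>m. 0 < m \<and> (f ^^ m) x = y" using assms by (auto simp: orbit_altdef)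
  have m: "0 < m" "(f ^^ m) x = y" using LeastI_ex[OF ex] by (auto simp: m_def)
  have least: "(f ^^ k) x \<noteq> y" if "0 < k" "k < m" for k
    using not_less_Least[of k] that by (auto simp: m_def)
  \<comment> \<open>Leaving out a return to \<open>x\<close> would give a shorter way from
    \<open>x\<close> to \<open>y\<close>.\<close>
  have nx: "(f ^^ k) x \<noteq> x" if "0 < k" "k < m" for k
  proof
    assume k: "(f ^^ k) x = x"
    have "(f ^^ (m - k)) ((f ^^ k) x) = (f ^^ ((m - k) + k)) x" by (simp only: funpow_add o_apply)
    then have "(f ^^ (m - k)) x = y" using k m that by simp
    then show False using least[of "m - k"] that by simp
  qed
  have "orbit g y = (\<lambda>i. (f ^^ i) x) ` {1..m}"
    by (rule orbit_transpose_arc[OF m]) (use least nx in auto)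
  moreover have "(f ^^ i) x \<noteq> x" if "1 \<le> i" "i \<le> m" for i
    using nx[of i] that m xy by (cases "i = m") auto
  ultimately show ?thesis by force
qed

text \<open>Here the \<open>g\<close>-trajectory of \<open>y\<close> runs through the whole
  \<open>f\<close>-cycle of \<open>x\<close>, which does not contain \<open>y\<close>, and arrives
  at \<open>x\<close>.\<close>

lemma orbit_transpose_joins:
  assumes "y \<notin> orbit f x" shows "x \<in> orbit g y"
proof -
  define m where "m = (LEAST m. 0 < m \<and> (f ^^ m) x = x)"
  have ex: "\<exists>m. 0 < m \<and> (f ^^ m) x = x" using orbit_self[OF A, of x] by (auto simp: orbit_altdef)
  have m: "0 < m" "(f ^^ m) x = x" using LeastI_ex[OF ex] by (auto simp: m_def)
  have least: "(f ^^ k) x \<noteq> x" if "0 < k" "k < m" for k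
    using not_less_Least[of k] that by (auto simp: m_def)
  have "(g ^^ m) y = (f ^^ m) x"
    by (rule funpow_transpose[OF m(1) order_refl]) (use least assms in \<open>auto simp: orbit_altdef\<close>)
  then show ?thesis using m by (auto simp: orbit_altdef)
qed

text \<open>The cycles avoiding both points are common to \<open>f\<close> and \<open>g\<close>, so
  the counts differ only by the one or two cycles through \<open>x\<close> or \<open>y\<close>. A
  shared cycle is cut in two; two different cycles merge.\<close>

lemma ncyc_transpose:
  "y \<in> orbit f x \<Longrightarrow> ncyc A g = ncyc A f + 1"
  "y \<notin> orbit f x \<Longrightarrow> ncyc A g + 1 = ncyc A f"
  "y \<in> orbit f x \<longleftrightarrow> y \<notin> orbit g x"
proof -
  have sep: "y \<in> orbit f x \<longleftrightarrow> y \<notin> orbit g x"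
    using orbit_transpose_separates orbit_transpose_joins orbit_eq_iff[OF A(1) permutes_comp_transpose]
      orbit_self[OF A(1) permutes_comp_transpose] by metis
  show "y \<in> orbit f x \<longleftrightarrow> y \<notin> orbit g x" by (rule sep)
  show "y \<in> orbit f x \<Longrightarrow> ncyc A g = ncyc A f + 1" "y \<notin> orbit f x \<Longrightarrow> ncyc A g + 1 = ncyc A f"
    unfolding card_cycle_partition_split2[OF A(2)] card_cycle_partition_split2[OF permutes_comp_transpose]
      cycle_partition_transpose_avoid using sep by auto
qed

text \<open>Both unions are the complement of the common cycles that avoid \<open>x\<close> and
  \<open>y\<close>.\<close>

lemma orbit_transpose_Un: "orbit g x \<union> orbit g y = orbit f x \<union> orbit f y"
proof -
  have *: "orbit h x \<union> orbit h y = A - \<Union> {c \<in> cycle_partition A h. x \<notin> c \<and> y \<notin> c}"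
    if "h permutes A" for h
  proof -
    let ?N = "{c \<in> cycle_partition A h. x \<notin> c \<and> y \<notin> c}"
    have "\<Union> (cycle_partition A h) = orbit h x \<union> orbit h y \<union> \<Union> ?N"
      by (rule trans[OF arg_cong[where f = Union, OF cycle_partition_split2[OF that]]])
        (simp add: Un_assoc)
    then have "A = orbit h x \<union> orbit h y \<union> \<Union> ?N"
      using partition_onD1[OF partition_on_cycle_partition[OF A(1) that]] by simp
    moreover have "(orbit h x \<union> orbit h y) \<inter> \<Union> ?N = {}"
    proof (safe)
      fix z c assume "c \<in> cycle_partition A h" "x \<notin> c" "y \<notin> c" "z \<in> c"
      then have "c = orbit h z" by (intro cycle_partition_eq_orbit[OF A(1) that])
      moreover have "x \<in> orbit h z" if "z \<in> orbit h x"
        using that orbit_eq_iff[OF A(1) \<open>h permutes A\<close>] by metis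
      moreover have "y \<in> orbit h z" if "z \<in> orbit h y"
        using that orbit_eq_iff[OF A(1) \<open>h permutes A\<close>] by metis
      ultimately show "z \<in> orbit h x \<Longrightarrow> z \<in> {}" "z \<in> orbit h y \<Longrightarrow> z \<in> {}"
        using \<open>x \<notin> c\<close> \<open>y \<notin> c\<close> by auto
    qed
    ultimately show ?thesis by blast
  qed
  show ?thesis
    using *[OF A(2)] *[OF permutes_comp_transpose] cycle_partition_transpose_avoid by simp
qed

end

lemma orbit_transpose_subset:
  assumes "finite A" "f permutes A" "x \<in> A" "y \<in> A" "x \<noteq> y" "y \<in> orbit f x"
  shows "orbit (f \<circ> transpose x y) z \<subseteq> orbit f z"
proof (cases "x \<in> orbit (f \<circ> transpose x y) z \<or> y \<in> orbit (f \<circ> transpose x y) z")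
  case True
  let ?g = "f \<circ> transpose x y"
  have g: "?g permutes A" using permutes_comp_transpose[OF assms(1-5)] .
  have "orbit f y = orbit f x" using orbit_eq_iff[OF assms(1,2)] assms(6) by blast
  then have U: "orbit ?g x \<union> orbit ?g y = orbit f x"
    using orbit_transpose_Un[OF assms(1-5)] by simp
  have "orbit ?g z = orbit ?g x \<or> orbit ?g z = orbit ?g y"
    using True orbit_eq_iff[OF assms(1) g] by metis
  then have *: "orbit ?g z \<subseteq> orbit f x" using U by blast
  then have "z \<in> orbit f x" using orbit_self[OF assms(1) g] by blast
  then have "orbit f z = orbit f x" using orbit_eq_iff[OF assms(1,2)] by blast
  then show ?thesis using * by simp
next
  case False
  then show ?thesis using orbit_transpose_avoid'[OF assms(1-5), of z] by simp
qed

section \<open>Geodesic permutations\<close>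

lemma comp_inv_transpose:
  assumes "\<gamma> permutes A"
  shows "(\<tau> \<circ> transpose x y) \<circ> inv (\<gamma> \<circ> transpose x y) = \<tau> \<circ> inv \<gamma>"
proof -
  have "inv (\<gamma> \<circ> transpose x y) = transpose x y \<circ> inv \<gamma>"
    using permutes_bij[OF assms] by (subst o_inv_distrib) auto
  then show ?thesis by (simp add: fun_eq_iff)
qed

lemma ncyc_id: "ncyc A (\<lambda>x. x) = card A"
proof -
  have "orbit (\<lambda>x. x) x = {x}" for x :: 'a by (simp add: orbit_eq_singleton_iff)
  then show ?thesis by (simp add: cycle_partition_def card_image)
qed

lemma cycle_partition_inv:
  assumes "finite A" "f permutes A" shows "cycle_partition A (inv f) = cycle_partition A f"
proof -
  have "permutation f" using assms by (auto simp: permutation_permutes)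
  then show ?thesis by (simp add: cycle_partition_def orbit_inv_eq)
qed

text \<open>Multiplying \<open>\<tau>\<close> and \<open>\<gamma>\<close> by the same transposition does not change \<open>\<tau> \<circ> inv \<gamma>\<close>; choosing it so
  that \<open>\<tau>\<close> gets a new fixed point reduces the claim to \<open>\<tau> = id\<close>.\<close>

lemma ncyc_bound:
  assumes "finite A" "\<tau> permutes A" "\<gamma> permutes A"
  shows "ncyc A \<tau> + ncyc A (\<tau> \<circ> inv \<gamma>) \<le> card A + ncyc A \<gamma> \<and>
    (ncyc A \<tau> + ncyc A (\<tau> \<circ> inv \<gamma>) = card A + ncyc A \<gamma> \<longrightarrow> (\<forall>x. \<tau> x \<in> orbit \<gamma> x))"
  using assms(2,3)
proof (induction "card {x\<in>A. \<tau> x \<noteq> x}" arbitrary: \<tau> \<gamma> rule: less_induct)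
  case less
  show ?case
  proof (cases "\<forall>x\<in>A. \<tau> x = x")
    case True
    then have "\<tau> = (\<lambda>x. x)" using less.prems(1) by (auto simp: permutes_def)
    then show ?thesis
      using ncyc_id[of A] cycle_partition_inv[OF assms(1) less.prems(2)] orbit_self[OF assms(1) less.prems(2)]
      by (auto simp: o_def)
  next
    case False
    then obtain x where x: "x \<in> A" "\<tau> x \<noteq> x" by blast
    \<comment> \<open>The preimage of \<open>x\<close>, so that \<open>\<tau>\<close> composed with
      the transposition maps \<open>x\<close> to \<open>\<tau> j = x\<close>.\<close>
    define j where "j = inv \<tau> x"
    have tj: "\<tau> j = x" using less.prems(1) by (simp add: j_def permutes_inverses)
    have j: "j \<in> A" using x less.prems(1) tj permutes_in_image by metis
    have xj: "x \<noteq> j" using tj x by auto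
    have jo: "j \<in> orbit \<tau> x"
      using tj orbit_eq_iff[OF assms(1) less.prems(1)] orbit.base[of \<tau> j] orbit_self[OF assms(1) less.prems(1)]
      by metis
    let ?t = "transpose x j"
    note T = assms(1) less.prems(1) x(1) j xj and G = assms(1) less.prems(2) x(1) j xj
    have eq: "(\<tau> \<circ> ?t) \<circ> inv (\<gamma> \<circ> ?t) = \<tau> \<circ> inv \<gamma>"
      using less.prems by (intro comp_inv_transpose)
    have "{z\<in>A. (\<tau> \<circ> ?t) z \<noteq> z} \<subseteq> {z\<in>A. \<tau> z \<noteq> z} - {x}"
    proof
      fix z assume z: "z \<in> {z\<in>A. (\<tau> \<circ> ?t) z \<noteq> z}"
      then have "z \<noteq> x" using tj by auto
      then show "z \<in> {z\<in>A. \<tau> z \<noteq> z} - {x}"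
        using z tj xj by (cases "z = j") auto
    qed
    then have "{z\<in>A. (\<tau> \<circ> ?t) z \<noteq> z} \<subset> {z\<in>A. \<tau> z \<noteq> z}"
      using x by blast
    then have "card {z\<in>A. (\<tau> \<circ> ?t) z \<noteq> z} < card {z\<in>A. \<tau> z \<noteq> z}"
      using assms(1) by (intro psubset_card_mono) auto
    note IH = less.hyps[OF this permutes_comp_transpose[OF T] permutes_comp_transpose[OF G], unfolded eq]
    have n1: "ncyc A (\<tau> \<circ> ?t) = ncyc A \<tau> + 1" using ncyc_transpose(1)[OF T jo] .
    have n2: "ncyc A (\<gamma> \<circ> ?t) \<le> ncyc A \<gamma> + 1"
      using ncyc_transpose(1,2)[OF G] by force
    have "\<tau> z \<in> orbit \<gamma> z" if e: "ncyc A \<tau> + ncyc A (\<tau> \<circ> inv \<gamma>) = card A + ncyc A \<gamma>" for z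
    proof -
      \<comment> \<open>Equality leaves no slack: \<open>\<gamma>\<close> must gain a cycle as
        \<open>\<tau>\<close> does. Hence the transposition cuts a cycle of \<open>\<gamma>\<close>,
        and membership in the smaller cycles implies membership in those of
        \<open>\<gamma>\<close>.\<close>
      have "ncyc A (\<gamma> \<circ> ?t) = ncyc A \<gamma> + 1" using IH n1 n2 e by linarith
      then have jg: "j \<in> orbit \<gamma> x" using ncyc_transpose(2)[OF G] by fastforce
      note sub = orbit_transpose_subset[OF G jg]
      have "ncyc A (\<tau> \<circ> ?t) + ncyc A (\<tau> \<circ> inv \<gamma>) = card A + ncyc A (\<gamma> \<circ> ?t)"
        using IH n1 n2 e by linarith
      then have I: "(\<tau> \<circ> ?t) z \<in> orbit (\<gamma> \<circ> ?t) z" for z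
        using IH by blast
      have xo: "orbit \<gamma> j = orbit \<gamma> x" using orbit_eq_iff[OF G(1,2)] jg by blast
      consider "z = x" | "z = j" | "z \<noteq> x" "z \<noteq> j" by blast
      then show ?thesis
      proof cases
        case 1 then show ?thesis using I[of j] sub[of j] xo by auto
      next
        case 2 then show ?thesis using I[of x] sub[of x] xo by auto
      next
        case 3 then show ?thesis using I[of z] sub[of z] by auto
      qed
    qed
    then show ?thesis using IH n1 n2 by auto
  qed
qed

text \<open>If \<open>\<gamma>\<close> is a single cycle, this says that the genus of \<open>\<tau>\<close> and \<open>inv \<gamma>\<close> is zero. The recursion cuts
  \<open>\<gamma>\<close> into several cycles.\<close>

definition geodesic :: "'a set \<Rightarrow> ('a \<Rightarrow> 'a) \<Rightarrow> ('a \<Rightarrow> 'a) set" where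
  "geodesic A \<gamma> = {\<tau>. \<tau> permutes A \<and> ncyc A \<tau> + ncyc A (\<tau> \<circ> inv \<gamma>) = card A + ncyc A \<gamma>}"

lemma geodesic_permutes: "\<tau> \<in> geodesic A \<gamma> \<Longrightarrow> \<tau> permutes A"
  by (simp add: geodesic_def)

lemma finite_geodesic: "finite A \<Longrightarrow> finite (geodesic A \<gamma>)"
  by (rule finite_subset[OF _ finite_permutations]) (auto simp: geodesic_def)

lemma geodesic_in_orbit:
  assumes "finite A" "\<gamma> permutes A" "\<tau> \<in> geodesic A \<gamma>" shows "\<tau> x \<in> orbit \<gamma> x"
  using ncyc_bound[of A \<tau> \<gamma>] assms by (auto simp: geodesic_def)

text \<open>A cycle is cut both in \<open>\<tau>\<close> and in \<open>\<gamma>\<close>, which adds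
  one to either side of the defining equation, while \<open>\<tau> \<circ> inv \<gamma>\<close> is
  unchanged.\<close>

lemma geodesic_transpose:
  assumes "finite A" "\<tau> permutes A" "\<gamma> permutes A" "x \<in> A" "y \<in> A" "x \<noteq> y"
    "y \<in> orbit \<tau> x" "y \<in> orbit \<gamma> x"
  shows "\<tau> \<circ> transpose x y \<in> geodesic A (\<gamma> \<circ> transpose x y) \<longleftrightarrow> \<tau> \<in> geodesic A \<gamma>"
  using assms permutes_comp_transpose[OF assms(1,2,4-6)] comp_inv_transpose[OF assms(3), of \<tau> x y]
    ncyc_transpose(1)[OF assms(1,2,4-7)] ncyc_transpose(1)[OF assms(1,3-6,8)]
  by (simp add: geodesic_def)

section \<open>Restriction to invariant blocks\<close>

lemma perm_restrict_permutes:
  assumes "finite B" "inj \<tau>" "\<And>x. x \<in> B \<Longrightarrow> \<tau> x \<in> B"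
  shows "perm_restrict \<tau> B permutes B"
proof (rule bij_imp_permutes)
  have "inj_on (perm_restrict \<tau> B) B"
    using assms(2) by (auto simp: inj_on_def perm_restrict_def)
  moreover have "perm_restrict \<tau> B ` B \<subseteq> B" using assms(3) by (auto simp: perm_restrict_def)
  ultimately show "bij_betw (perm_restrict \<tau> B) B B"
    using assms(1) by (simp add: bij_betw_def endo_inj_surj)
qed (simp add: perm_restrict_def)

lemma orbit_perm_restrict:
  assumes "\<And>x. x \<in> B \<Longrightarrow> \<tau> x \<in> B" "x \<in> B"
  shows "orbit (perm_restrict \<tau> B) x = orbit \<tau> x"
  using assms by (intro orbit_cong0[of x B]) (auto simp: perm_restrict_def)

lemma cycle_partition_perm_restrict:
  assumes "\<And>x. x \<in> B \<Longrightarrow> \<tau> x \<in> B"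
  shows "cycle_partition B (perm_restrict \<tau> B) = cycle_partition B \<tau>"
  using orbit_perm_restrict[of B \<tau>, OF assms] by (simp add: cycle_partition_def)

text \<open>As \<open>B\<close> is finite, the injective \<open>\<gamma>\<close> maps it onto
  itself. So the inverse preserves \<open>B\<close> too, and restriction commutes with
  inversion.\<close>

lemma perm_restrict_comp_inv:
  assumes "finite B" "\<gamma> permutes A" "\<And>x. x \<in> B \<Longrightarrow> \<gamma> x \<in> B"
  shows "perm_restrict (\<tau> \<circ> inv \<gamma>) B = perm_restrict \<tau> B \<circ> inv (perm_restrict \<gamma> B)"
    and "\<And>x. x \<in> B \<Longrightarrow> inv \<gamma> x \<in> B"
proof -
  have p: "perm_restrict \<gamma> B permutes B"
    using assms permutes_inj by (intro perm_restrict_permutes) auto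
  have *: "inv \<gamma> x \<in> B \<and> inv (perm_restrict \<gamma> B) x = inv \<gamma> x" if "x \<in> B" for x
  proof -
    let ?y = "inv (perm_restrict \<gamma> B) x"
    have y: "?y \<in> B" using p that permutes_in_image[OF permutes_inv[OF p]] by blast
    have "perm_restrict \<gamma> B ?y = x" using p by (simp add: permutes_inverses)
    then have "\<gamma> ?y = x" using y by (simp add: perm_restrict_def)
    then have "inv \<gamma> x = ?y" using assms(2) by (metis permutes_inverses(2))
    then show ?thesis using y by simp
  qed
  then show "\<And>x. x \<in> B \<Longrightarrow> inv \<gamma> x \<in> B" by blast
  have "inv (perm_restrict \<gamma> B) x = x" if "x \<notin> B" for x
    using permutes_inv[OF p] that by (simp add: permutes_not_in)
  then show "perm_restrict (\<tau> \<circ> inv \<gamma>) B = perm_restrict \<tau> B \<circ> inv (perm_restrict \<gamma> B)"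
    using * by (auto simp: fun_eq_iff perm_restrict_def)
qed

text \<open>Used for the three pieces \<open>{x}\<close>, \<open>B\<close>, \<open>C\<close> left by
  a cut, and again for the supports of the cycles of \<open>gamma_perm\<close>.\<close>

locale perm_family =
  fixes I :: "'i set" and S :: "'i \<Rightarrow> 'a set"
  assumes finite_I: "finite I" and finite_S: "\<And>i. i \<in> I \<Longrightarrow> finite (S i)"
    and disj: "\<And>i j. i \<in> I \<Longrightarrow> j \<in> I \<Longrightarrow> i \<noteq> j \<Longrightarrow> S i \<inter> S j = {}"
begin

abbreviation "U \<equiv> \<Union>(S ` I)"

definition "preserves f \<longleftrightarrow> (\<forall>i\<in>I. \<forall>x\<in>S i. f x \<in> S i)"

lemma finite_U: "finite U" using finite_I finite_S by auto

lemma preservesD: "preserves f \<Longrightarrow> i \<in> I \<Longrightarrow> x \<in> S i \<Longrightarrow> f x \<in> S i"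
  by (auto simp: preserves_def)

lemma cycle_partition_U: "cycle_partition U f = (\<Union>i\<in>I. cycle_partition (S i) f)"
  by (auto simp: cycle_partition_def)

lemma orbit_preserves: "preserves f \<Longrightarrow> i \<in> I \<Longrightarrow> x \<in> S i \<Longrightarrow> orbit f x \<subseteq> S i"
proof
  fix y assume "preserves f" "i \<in> I" "x \<in> S i" and "y \<in> orbit f x"
  from this(4) show "y \<in> S i" using \<open>preserves f\<close> \<open>i \<in> I\<close> \<open>x \<in> S i\<close>
    by induction (auto simp: preserves_def)
qed

lemma cycle_partition_disj:
  assumes "preserves f" "i \<in> I" "j \<in> I" "i \<noteq> j"
  shows "cycle_partition (S i) f \<inter> cycle_partition (S j) f = {}"
proof -
  have False if "x \<in> S i" "y \<in> S j" "orbit f x = orbit f y" for x y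
    using orbit_preserves[OF assms(1) assms(2) that(1)] orbit_preserves[OF assms(1) assms(3) that(2)] that(3)
      orbit_nonempty[of f x] disj[OF assms(2-4)] by auto
  then show ?thesis by (auto simp: cycle_partition_def)
qed

lemma ncyc_U:
  assumes "preserves f" shows "ncyc U f = (\<Sum>i\<in>I. ncyc (S i) f)"
  unfolding cycle_partition_U
  by (rule card_UN_disjoint) (use finite_I finite_S finite_cycle_partition cycle_partition_disj[OF assms] in auto)

lemma card_U: "card U = (\<Sum>i\<in>I. card (S i))"
  by (rule card_UN_disjoint) (use finite_I finite_S disj in auto)

context
  fixes \<gamma> assumes \<gamma>: "\<gamma> permutes U" "preserves \<gamma>"
begin

lemma perm_restrict_block_permutes:
  assumes "\<tau> permutes U" "preserves \<tau>" "i \<in> I" shows "perm_restrict \<tau> (S i) permutes S i"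
  using assms permutes_inj finite_S preservesD by (intro perm_restrict_permutes) auto

lemma ncyc_restrict:
  assumes "\<tau> permutes U" "preserves \<tau>" "i \<in> I"
  shows "ncyc (S i) (perm_restrict \<tau> (S i)) = ncyc (S i) \<tau>"
    "ncyc (S i) (perm_restrict \<tau> (S i) \<circ> inv (perm_restrict \<gamma> (S i))) = ncyc (S i) (\<tau> \<circ> inv \<gamma>)"
proof -
  show "ncyc (S i) (perm_restrict \<tau> (S i)) = ncyc (S i) \<tau>"
    using assms preservesD by (subst cycle_partition_perm_restrict) auto
  have g: "\<And>x. x \<in> S i \<Longrightarrow> \<gamma> x \<in> S i" using \<gamma>(2) assms(3) preservesD by blast
  have "perm_restrict \<tau> (S i) \<circ> inv (perm_restrict \<gamma> (S i)) = perm_restrict (\<tau> \<circ> inv \<gamma>) (S i)"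
    using perm_restrict_comp_inv(1)[OF finite_S[OF assms(3)] \<gamma>(1) g] by simp
  moreover have "cycle_partition (S i) (perm_restrict (\<tau> \<circ> inv \<gamma>) (S i)) = cycle_partition (S i) (\<tau> \<circ> inv \<gamma>)"
    by (rule cycle_partition_perm_restrict)
      (use perm_restrict_comp_inv(2)[OF finite_S[OF assms(3)] \<gamma>(1) g] preservesD[OF assms(2,3)] in auto)
  ultimately show "ncyc (S i) (perm_restrict \<tau> (S i) \<circ> inv (perm_restrict \<gamma> (S i))) = ncyc (S i) (\<tau> \<circ> inv \<gamma>)"
    by simp
qed

lemma geodesic_preserves:
  assumes "\<tau> \<in> geodesic U \<gamma>" shows "preserves \<tau>"
  using geodesic_in_orbit[OF finite_U \<gamma>(1) assms] orbit_preserves[OF \<gamma>(2)]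
  unfolding preserves_def by blast

lemma inv_preserves: "preserves (inv \<gamma>)"
  unfolding preserves_def
  using perm_restrict_comp_inv(2)[OF finite_S \<gamma>(1)] preservesD[OF \<gamma>(2)] by blast

text \<open>Both sides of the cycle equation are sums over the blocks, and \<open>ncyc_bound\<close>
  compares them block by block, so the totals agree only if they agree on every block. That a
  geodesic preserves the blocks follows from the second half of \<open>ncyc_bound\<close> on the
  whole set.\<close>

lemma geodesic_U_iff:
  assumes "\<tau> permutes U"
  shows "\<tau> \<in> geodesic U \<gamma> \<longleftrightarrow>
    preserves \<tau> \<and> (\<forall>i\<in>I. perm_restrict \<tau> (S i) \<in> geodesic (S i) (perm_restrict \<gamma> (S i)))"
proof (cases "preserves \<tau>")
  case True
  let ?r = "\<lambda>f i. perm_restrict f (S i)"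
  let ?a = "\<lambda>i. ncyc (S i) (?r \<tau> i) + ncyc (S i) (?r \<tau> i \<circ> inv (?r \<gamma> i))"
    and ?b = "\<lambda>i. card (S i) + ncyc (S i) (?r \<gamma> i)"
  have "preserves (\<tau> \<circ> inv \<gamma>)" using True inv_preserves by (auto simp: preserves_def)
  then have a: "ncyc U \<tau> + ncyc U (\<tau> \<circ> inv \<gamma>) = (\<Sum>i\<in>I. ?a i)"
    using True assms ncyc_restrict by (simp add: ncyc_U sum.distrib)
  have b: "card U + ncyc U \<gamma> = (\<Sum>i\<in>I. ?b i)"
    using \<gamma> ncyc_restrict(1)[OF \<gamma>] by (simp add: ncyc_U card_U sum.distrib)
  have le: "?a i \<le> ?b i" if "i \<in> I" for i
    using ncyc_bound[OF finite_S[OF that] perm_restrict_block_permutes[OF assms True that]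
      perm_restrict_block_permutes[OF \<gamma> that]] by simp
  have "(\<Sum>i\<in>I. ?a i) = (\<Sum>i\<in>I. ?b i) \<longleftrightarrow> (\<forall>i\<in>I. ?a i = ?b i)"
  proof
    assume e: "(\<Sum>i\<in>I. ?a i) = (\<Sum>i\<in>I. ?b i)"
    show "\<forall>i\<in>I. ?a i = ?b i"
    proof (rule ccontr)
      assume "\<not> ?thesis"
      then obtain i where "i \<in> I" "?a i < ?b i" using le by (meson antisym_conv2)
      then have "(\<Sum>i\<in>I. ?a i) < (\<Sum>i\<in>I. ?b i)"
        using le finite_I by (intro sum_strict_mono_ex1) auto
      then show False using e by simp
    qed
  qed (rule sum.cong; simp)
  then show ?thesis
    using a b True assms perm_restrict_block_permutes[OF assms True] by (auto simp: geodesic_def)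
qed (use geodesic_preserves in blast)

lemma bij_betw_geodesic:
  "bij_betw (\<lambda>\<tau>. \<lambda>i\<in>I. perm_restrict \<tau> (S i)) (geodesic U \<gamma>)
    (PiE I (\<lambda>i. geodesic (S i) (perm_restrict \<gamma> (S i))))"
proof (rule bij_betwI')
  fix \<tau> \<tau>' assume t: "\<tau> \<in> geodesic U \<gamma>" "\<tau>' \<in> geodesic U \<gamma>"
  show "((\<lambda>i\<in>I. perm_restrict \<tau> (S i)) = (\<lambda>i\<in>I. perm_restrict \<tau>' (S i))) = (\<tau> = \<tau>')"
  proof
    assume e: "(\<lambda>i\<in>I. perm_restrict \<tau> (S i)) = (\<lambda>i\<in>I. perm_restrict \<tau>' (S i))"
    show "\<tau> = \<tau>'"
    proof
      fix x
      show "\<tau> x = \<tau>' x"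
      proof (cases "x \<in> U")
        case True
        then obtain i where "i \<in> I" "x \<in> S i" by blast
        then show ?thesis using fun_cong[OF fun_cong[OF e, of i], of x] by (simp add: perm_restrict_def)
      next
        case False
        then show ?thesis using t[THEN geodesic_permutes] by (simp add: permutes_not_in)
      qed
    qed
  qed simp
next
  fix \<tau> assume "\<tau> \<in> geodesic U \<gamma>"
  then show "(\<lambda>i\<in>I. perm_restrict \<tau> (S i)) \<in> (PiE I (\<lambda>i. geodesic (S i) (perm_restrict \<gamma> (S i))))"
    using geodesic_U_iff[OF geodesic_permutes] by auto
next
  fix h assume h: "h \<in> (PiE I (\<lambda>i. geodesic (S i) (perm_restrict \<gamma> (S i))))"
  then have hp: "h i permutes S i" if "i \<in> I" for i using that geodesic_permutes by blast
  \<comment> \<open>The permutations \<open>h i\<close> are glued together. Disjointness of the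
    blocks makes \<open>THE\<close> well defined, and outside \<open>U\<close> the result is the
    identity.\<close>
  define \<tau> where "\<tau> = (\<lambda>x. if x \<in> U then h (THE i. i \<in> I \<and> x \<in> S i) x else x)"
  have \<tau>: "\<tau> x = h i x" if "i \<in> I" "x \<in> S i" for i x
  proof -
    have "(THE i. i \<in> I \<and> x \<in> S i) = i" using that disj by (intro the_equality) blast+
    then show ?thesis using that by (auto simp: \<tau>_def)
  qed
  have pres: "preserves \<tau>" using \<tau> hp by (auto simp: preserves_def permutes_in_image)
  have "inj_on \<tau> U"
  proof (rule inj_onI)
    fix x y assume "x \<in> U" "y \<in> U" and e: "\<tau> x = \<tau> y"
    then obtain i j where ij: "i \<in> I" "x \<in> S i" "j \<in> I" "y \<in> S j" by blast
    then have "\<tau> x \<in> S i" "\<tau> y \<in> S j" using pres by (auto simp: preserves_def)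
    then have "\<tau> x \<in> S i" "\<tau> x \<in> S j" using e by simp_all
    then have "i = j" using disj ij by blast
    then show "x = y" using \<tau>[of i x] \<tau>[of i y] ij e permutes_inj[OF hp[OF ij(1)]] by (auto dest: injD)
  qed
  moreover have "\<tau> ` U \<subseteq> U" using pres by (auto simp: preserves_def)
  ultimately have "bij_betw \<tau> U U" using finite_U by (simp add: bij_betw_def endo_inj_surj)
  then have tp: "\<tau> permutes U" by (rule bij_imp_permutes) (auto simp: \<tau>_def)
  have r: "perm_restrict \<tau> (S i) = h i" if "i \<in> I" for i
    using that \<tau> hp[OF that] by (auto simp: fun_eq_iff perm_restrict_def permutes_not_in)
  then have "\<tau> \<in> geodesic U \<gamma>" using geodesic_U_iff[OF tp] pres h by auto
  moreover have "h = (\<lambda>i\<in>I. perm_restrict \<tau> (S i))"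
    using h r by (auto simp: fun_eq_iff PiE_def extensional_def)
  ultimately show "\<exists>\<tau>\<in>geodesic U \<gamma>. h = (\<lambda>i\<in>I. perm_restrict \<tau> (S i))" by blast
qed

lemma sum_geodesic_PiE:
  "(\<Sum>\<tau>\<in>geodesic U \<gamma>. F (\<lambda>i\<in>I. perm_restrict \<tau> (S i))) =
    (\<Sum>h\<in>PiE I (\<lambda>i. geodesic (S i) (perm_restrict \<gamma> (S i))). F h)"
  by (rule sum.reindex_bij_betw[OF bij_betw_geodesic])

lemma sum_geodesic_prod:
  fixes \<phi> :: "'i \<Rightarrow> ('a \<Rightarrow> 'a) \<Rightarrow> 'c::comm_semiring_1"
  shows "(\<Sum>\<tau>\<in>geodesic U \<gamma>. \<Prod>i\<in>I. \<phi> i (perm_restrict \<tau> (S i))) =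
    (\<Prod>i\<in>I. \<Sum>\<tau>\<in>geodesic (S i) (perm_restrict \<gamma> (S i)). \<phi> i \<tau>)"
proof -
  have "(\<Sum>\<tau>\<in>geodesic U \<gamma>. \<Prod>i\<in>I. \<phi> i (perm_restrict \<tau> (S i))) =
      (\<Sum>\<tau>\<in>geodesic U \<gamma>. (\<lambda>h. \<Prod>i\<in>I. \<phi> i (h i)) (\<lambda>i\<in>I. perm_restrict \<tau> (S i)))"
    by simp
  also have "\<dots> = (\<Sum>h\<in>PiE I (\<lambda>i. geodesic (S i) (perm_restrict \<gamma> (S i))). \<Prod>i\<in>I. \<phi> i (h i))"
    by (rule sum_geodesic_PiE)
  also have "\<dots> = (\<Prod>i\<in>I. \<Sum>\<tau>\<in>geodesic (S i) (perm_restrict \<gamma> (S i)). \<phi> i \<tau>)"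
    by (rule prod_sum_PiE[symmetric]) (use finite_I finite_S finite_geodesic in auto)
  finally show ?thesis .
qed

end

end

section \<open>Deletion of a point from its cycle\<close>

context
  fixes A :: "'a set" and f f' :: "'a \<Rightarrow> 'a" and x :: 'a
  assumes A: "finite A" "f permutes A" and x: "x \<in> A"
  defines "f' \<equiv> f \<circ> transpose x (inv f x)"
begin

lemma inv_mem: "inv f x \<in> A"
  using permutes_in_image[OF permutes_inv[OF A(2)]] x by blast

lemma inv_mem_orbit: "inv f x \<in> orbit f x"
  by (metis A orbit.base orbit_eq_iff orbit_self permutes_inverses(1))

lemma permutes_remove_point: "f' permutes A"
  unfolding f'_def using A x inv_mem by (intro permutes_compose permutes_swap_id) auto

lemma remove_point_fixed: "f' x = x"
  unfolding f'_def using A(2) by (simp add: permutes_inverses)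

text \<open>\<open>f'\<close> fixes \<open>x\<close> and, if \<open>x\<close> was not fixed before,
  sends \<open>inv f x\<close> directly to \<open>f x\<close>: the cycle of \<open>x\<close> closes
  up without it.\<close>

lemma orbit_remove_point:
  assumes "z \<noteq> x" shows "orbit f' z = orbit f z - {x}"
proof (cases "inv f x = x")
  case True
  then have "f x = x" using A(2) permutes_inverses(1) by metis
  then have "orbit f x = {x}" by (simp add: orbit_eq_singleton_iff)
  then have "x \<notin> orbit f z" using orbit_eq_iff[OF A] orbit_self[OF A] assms by blast
  then show ?thesis using True by (simp add: f'_def)
next
  case False
  note T = A x inv_mem False[symmetric]
  have p: "f' permutes A" by (rule permutes_remove_point)
  have fx: "orbit f' x = {x}" using remove_point_fixed by (simp add: orbit_eq_singleton_iff)
  have xz: "x \<notin> orbit f' z" using fx orbit_eq_iff[OF A(1) p] orbit_self[OF A(1) p] assms by blast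
  have yx: "orbit f (inv f x) = orbit f x" using orbit_eq_iff[OF A] inv_mem_orbit by blast
  show ?thesis
  proof (cases "x \<in> orbit f z")
    case True
    then have "orbit f z = orbit f x" using orbit_eq_iff[OF A] by metis
    moreover have "{x} \<union> orbit f' (inv f x) = orbit f x"
      using orbit_transpose_Un[OF T] fx yx by (simp add: f'_def)
    moreover have "x \<notin> orbit f' (inv f x)"
      using fx orbit_eq_iff[OF A(1) p] orbit_self[OF A(1) p] False by blast
    ultimately have e: "orbit f' (inv f x) = orbit f z - {x}" by auto
    then have "z \<in> orbit f' (inv f x)" using orbit_self[OF A, of z] assms by auto
    then have "orbit f' z = orbit f' (inv f x)" using orbit_eq_iff[OF A(1) p] by metis
    then show ?thesis using e by simp
  next
    case False
    moreover have "inv f x \<notin> orbit f z" using False yx orbit_eq_iff[OF A] by metis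
    ultimately show ?thesis using orbit_transpose_avoid[OF T] by (simp add: f'_def)
  qed
qed

text \<open>Since \<open>\<tau>\<close> fixes \<open>x\<close>, the quotient
  \<open>\<tau> \<circ> inv f\<close> sends \<open>f x\<close> to \<open>x\<close>. Deleting
  \<open>x\<close> from \<open>f\<close> multiplies the quotient by the transposition of these two
  points of one cycle. So, unless \<open>f' = f\<close>, both \<open>f\<close> and the quotient gain
  a cycle.\<close>

lemma geodesic_remove_point:
  assumes "\<tau> permutes A" "\<tau> x = x"
  shows "\<tau> \<in> geodesic A f' \<longleftrightarrow> \<tau> \<in> geodesic A f"
proof (cases "inv f x = x")
  case True then show ?thesis by (simp add: f'_def)
next
  case False
  note T = A x inv_mem False[symmetric]
  let ?u = "transpose x (inv f x)" and ?\<kappa> = "\<tau> \<circ> inv f"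
  have \<kappa>: "?\<kappa> permutes A" using assms A(2) by (intro permutes_compose permutes_inv) auto
  have fx: "f x \<noteq> x" using False A(2) permutes_inverses(2) by metis
  have fxA: "f x \<in> A" using x A(2) permutes_in_image by metis
  have "inv f' = ?u \<circ> inv f"
    unfolding f'_def using permutes_bij[OF A(2)] by (subst o_inv_distrib) auto
  \<comment> \<open>Conjugation moves the transposition to the right, the side on which
    \<open>ncyc_transpose\<close> composes.\<close>
  also have "\<dots> = inv f \<circ> transpose (f x) x"
    using A(2) permutes_inj[OF permutes_inv[OF A(2)]]
    by (auto simp: fun_eq_iff transpose_def permutes_inverses dest: injD)
  finally have e: "\<tau> \<circ> inv f' = ?\<kappa> \<circ> transpose (f x) x" by (simp add: o_assoc)
  have "?\<kappa> (f x) = x" using assms(2) A(2) by (simp add: permutes_inverses)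
  then have "x \<in> orbit ?\<kappa> (f x)" by (metis orbit.base)
  then have "ncyc A (\<tau> \<circ> inv f') = ncyc A ?\<kappa> + 1"
    unfolding e by (rule ncyc_transpose(1)[OF A(1) \<kappa> fxA x fx])
  moreover have "ncyc A f' = ncyc A f + 1"
    unfolding f'_def by (rule ncyc_transpose(1)[OF T inv_mem_orbit])
  ultimately show ?thesis using assms by (simp add: geodesic_def)
qed

end

definition single_cycle :: "'a set \<Rightarrow> ('a \<Rightarrow> 'a) \<Rightarrow> bool" where
  "single_cycle A \<gamma> \<longleftrightarrow> \<gamma> permutes A \<and> (\<forall>z\<in>A. orbit \<gamma> z = A)"

lemma geodesic_trivial: "geodesic {} \<gamma> = {id}" "geodesic {x} id = {id}"
  by (auto simp: geodesic_def cycle_partition_def)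

lemma perm_family3:
  assumes "finite B" "finite C" "x \<notin> B" "x \<notin> C" "B \<inter> C = {}"
  shows "perm_family {..<3::nat} (\<lambda>i. if i = 0 then {x} else if i = 1 then B else C)"
  using assms by unfold_locales (auto split: if_splits)

text \<open>The piece \<open>{x}\<close> contributes the factor \<open>1\<close>, as its only
  geodesic is the identity. With \<open>C = {}\<close> this also covers the deletion of a fixed
  point.\<close>

lemma sum_geodesic_split3:
  fixes \<phi> \<psi> :: "('a \<Rightarrow> 'a) \<Rightarrow> 'c::comm_semiring_1"
  assumes fin: "finite B" "finite C" "x \<notin> B" "x \<notin> C" "B \<inter> C = {}"
    and \<gamma>: "\<gamma> permutes insert x (B \<union> C)" "\<gamma> x = x" "\<And>z. z \<in> B \<Longrightarrow> \<gamma> z \<in> B" "\<And>z. z \<in> C \<Longrightarrow> \<gamma> z \<in> C"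
  shows "(\<Sum>\<tau>\<in>geodesic (insert x (B \<union> C)) \<gamma>. \<phi> (perm_restrict \<tau> B) * \<psi> (perm_restrict \<tau> C)) =
    (\<Sum>\<tau>\<in>geodesic B (perm_restrict \<gamma> B). \<phi> \<tau>) * (\<Sum>\<tau>\<in>geodesic C (perm_restrict \<gamma> C). \<psi> \<tau>)"
proof -
  let ?S = "\<lambda>i::nat. if i = 0 then {x} else if i = 1 then B else C"
  interpret perm_family "{..<3::nat}" ?S using fin by (rule perm_family3)
  have three: "{..<3::nat} = {0,1,2}" by auto
  have U: "\<Union> (?S ` {..<3}) = insert x (B \<union> C)" by (auto simp: three)
  have pres: "preserves \<gamma>" using \<gamma> by (auto simp: preserves_def)
  let ?F = "\<lambda>i::nat. if i = 0 then (\<lambda>_. 1) else if i = 1 then \<phi> else \<psi>"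
  have id: "perm_restrict \<gamma> {x} = id" using \<gamma>(2) by (auto simp: perm_restrict_def)
  from sum_geodesic_prod[of \<gamma> ?F] \<gamma>(1) pres
  show ?thesis unfolding U by (simp add: three id geodesic_trivial)
qed

section \<open>Weighted enumeration of geodesics\<close>

definition cycle_weight :: "(nat \<Rightarrow> complex) \<Rightarrow> 'a set \<Rightarrow> ('a \<Rightarrow> 'a) \<Rightarrow> complex" where
  "cycle_weight w A \<tau> = (\<Prod>c\<in>cycle_partition A \<tau>. w (card c))"

text \<open>The cycle of the root \<open>x\<close> has a prescribed length and no weight, because
  the recursion shortens it point by point; \<open>cycle_weight_eq_sum_rooted\<close> puts the
  factor \<open>w s\<close> back.\<close>

definition rooted_weight :: "(nat \<Rightarrow> complex) \<Rightarrow> 'a set \<Rightarrow> 'a \<Rightarrow> nat \<Rightarrow> ('a \<Rightarrow> 'a) \<Rightarrow> complex" where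
  "rooted_weight w A x s \<tau> =
    (if card (orbit \<tau> x) = s then \<Prod>c\<in>cycle_partition A \<tau> - {orbit \<tau> x}. w (card c) else 0)"

lemma orbit_subset_closed:
  assumes "\<And>z. z \<in> B \<Longrightarrow> f z \<in> B" "x \<in> B" shows "orbit f x \<subseteq> B"
proof
  fix y assume "y \<in> orbit f x"
  then show "y \<in> B" by induction (use assms in auto)
qed

lemma funpow_cycle:
  assumes "finite A" "single_cycle A \<gamma>" "x \<in> A"
  shows "inj_on (\<lambda>i. (\<gamma> ^^ i) x) {..<card A}" "(\<lambda>i. (\<gamma> ^^ i) x) ` {..<card A} = A"
    "(\<gamma> ^^ card A) x = x"
proof -
  have o: "orbit \<gamma> x = A" using assms by (auto simp: single_cycle_def)
  have xo: "x \<in> orbit \<gamma> x" using o assms by simp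
  define n where "n = funpow_dist1 \<gamma> x x"
  have n: "orbit \<gamma> x = (\<lambda>i. (\<gamma> ^^ i) x) ` {0..<n}" "inj_on (\<lambda>i. (\<gamma> ^^ i) x) {0..<n}"
    "(\<gamma> ^^ n) x = x"
    unfolding n_def
    using orbit_conv_funpow_dist1[OF xo] inj_on_funpow_dist1[OF xo] funpow_dist1_prop[OF xo] by auto
  then have "card A = n" using o by (metis card_atLeastLessThan card_image diff_zero)
  then show "inj_on (\<lambda>i. (\<gamma> ^^ i) x) {..<card A}" "(\<lambda>i. (\<gamma> ^^ i) x) ` {..<card A} = A"
    "(\<gamma> ^^ card A) x = x"
    using n o by (auto simp: atLeast0LessThan)
qed

lemma single_cycle_perm_restrict:
  assumes "finite A" "f permutes A" "\<And>z. z \<in> B \<Longrightarrow> orbit f z = B"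
  shows "single_cycle B (perm_restrict f B)" "\<And>z. z \<in> B \<Longrightarrow> f z \<in> B"
proof -
  show *: "\<And>z. z \<in> B \<Longrightarrow> f z \<in> B" using assms(3) orbit.base by metis
  have "finite B"
  proof (cases "B = {}")
    case False
    then obtain z where "z \<in> B" by blast
    then show ?thesis using assms(3) finite_orbit orbit_self[OF assms(1,2)] by metis
  qed simp
  then have "perm_restrict f B permutes B"
    using perm_restrict_permutes[of B f] permutes_inj[OF assms(2)] * by blast
  then show "single_cycle B (perm_restrict f B)"
    using orbit_perm_restrict[of B f] * assms(3) by (auto simp: single_cycle_def)
qed

text \<open>The transposition of \<open>x\<close> and \<open>j\<close> turns \<open>x\<close> into a fixed point of \<open>\<tau>\<close> and splits \<open>\<gamma>\<close> into an arc \<open>C\<close>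
  ending in \<open>j\<close> and the union of \<open>B\<close> and \<open>x\<close>.\<close>

lemma sum_rooted_step:
  fixes A :: "'a set"
  assumes A: "finite A" "single_cycle A \<gamma>" "x \<in> A" and m: "0 < m" "m < card A"
    and j: "j = (\<gamma> ^^ m) x" and s: "1 \<le> s"
  shows "\<exists>(B :: 'a set) C \<beta> \<delta>. finite B \<and> finite C \<and> single_cycle B \<beta> \<and> single_cycle C \<delta> \<and> j \<in> C \<and> j \<noteq> x
    \<and> card C = m \<and> card B = card A - 1 - m \<and>
    (\<Sum>\<tau> | \<tau> \<in> geodesic A \<gamma> \<and> \<tau> j = x. rooted_weight w A x s \<tau>) =
      (\<Sum>\<tau>\<in>geodesic B \<beta>. cycle_weight w B \<tau>) * (\<Sum>\<tau>\<in>geodesic C \<delta>. rooted_weight w C j (s - 1) \<tau>)"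
proof -
  note fc = funpow_cycle[OF A]
  have \<gamma>: "\<gamma> permutes A" and o: "orbit \<gamma> x = A" using A by (auto simp: single_cycle_def)
  have inj: "(\<gamma> ^^ a) x = (\<gamma> ^^ b) x \<longleftrightarrow> a = b" if "a < card A" "b < card A" for a b
    using inj_onD[OF fc(1), of a b] that by auto
  have jA: "j \<in> A" using fc(2) m j by auto
  have xj: "x \<noteq> j" using inj[of 0 m] m by (auto simp: j)
  have jo: "j \<in> orbit \<gamma> x" using o jA by simp
  note G = A(1) \<gamma> A(3) jA xj
  let ?t = "transpose x j"
  define g where "g = \<gamma> \<circ> ?t"
  have gp: "g permutes A" unfolding g_def by (rule permutes_comp_transpose[OF G])
  \<comment> \<open>\<open>g\<close> maps \<open>j\<close> to \<open>\<gamma> x\<close>, so its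
    cycle through \<open>j\<close> is the arc of \<open>\<gamma>\<close> from
    \<open>\<gamma> x\<close> to \<open>j\<close>.\<close>
  define C where "C = (\<lambda>i. (\<gamma> ^^ i) x) ` {1..m}"
  have C: "orbit g j = C"
    unfolding g_def C_def
  proof (rule orbit_transpose_arc[OF G m(1) j[symmetric]])
    fix k assume "0 < k" "k < m"
    then show "(\<gamma> ^^ k) x \<noteq> x \<and> (\<gamma> ^^ k) x \<noteq> j" using inj[of k 0] inj[of k m] m by (auto simp: j)
  qed
  have finC: "finite C" by (simp add: C_def)
  have "inj_on (\<lambda>i. (\<gamma> ^^ i) x) {1..m}" using m by (intro inj_on_subset[OF fc(1)]) auto
  then have cardC: "card C = m" by (simp add: C_def card_image)
  have jC: "j \<in> C" using m by (auto simp: C_def j)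
  have xC: "x \<notin> C" using inj[of 0] m by (force simp: C_def)
  have CA: "C \<subseteq> A" using fc(2) m by (auto simp: C_def)
  define B where "B = A - C - {x}"
  have xB: "x \<notin> B" and BC: "B \<inter> C = {}" and AB: "A = insert x (B \<union> C)" and finB: "finite B"
    using A(1,3) CA by (auto simp: B_def)
  have cardB: "card B = card A - 1 - m"
    using xC cardC CA A(1,3) finC by (simp add: B_def card_Diff_subset)
  have "orbit g x \<union> C = A"
    using orbit_transpose_Un[OF G] o C orbit_eq_iff[OF A(1) \<gamma>] jo by (auto simp: g_def)
  moreover have "orbit g x \<inter> C = {}"
  proof -
    have "False" if "z \<in> orbit g x" "z \<in> orbit g j" for z
    proof -
      have "orbit g x = orbit g j" using that orbit_eq_iff[OF A(1) gp] by metis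
      then show False using xC C orbit_self[OF A(1) gp] by blast
    qed
    then show ?thesis using C by blast
  qed
  ultimately have B: "orbit g x - {x} = B" by (auto simp: B_def)
  define h where "h = g \<circ> transpose x (inv g x)"
  note R = A(1) gp A(3)
  have hp: "h permutes A" unfolding h_def by (rule permutes_remove_point[OF R])
  have hx: "h x = x" unfolding h_def by (rule remove_point_fixed[OF R])
  have ho: "orbit h z = orbit g z - {x}" if "z \<noteq> x" for z
    unfolding h_def by (rule orbit_remove_point[OF R that])
  have hB: "orbit h z = B" if "z \<in> B" for z
  proof -
    have "z \<in> orbit g x" "z \<noteq> x" using that B by auto
    then show ?thesis using ho B orbit_eq_iff[OF A(1) gp] by metis
  qed
  have hC: "orbit h z = C" if "z \<in> C" for z
  proof -
    have "z \<in> orbit g j" "z \<noteq> x" using that C xC by auto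
    then have "orbit g z = C" using C orbit_eq_iff[OF A(1) gp] by metis
    then show ?thesis using ho[OF \<open>z \<noteq> x\<close>] xC by simp
  qed
  note sB = single_cycle_perm_restrict[OF A(1) hp hB] and sC = single_cycle_perm_restrict[OF A(1) hp hC]
  have joint: "j \<in> orbit \<tau> x" if "\<tau> permutes A" "\<tau> j = x" for \<tau>
    using that orbit.base[of \<tau> j] orbit_eq_iff[OF A(1) that(1)] orbit_self[OF A(1) that(1)] by metis
  have to_h: "\<tau> \<circ> ?t \<in> geodesic A h \<longleftrightarrow> \<tau> \<in> geodesic A \<gamma>" if "\<tau> permutes A" "\<tau> j = x" for \<tau>
  proof -
    have "\<tau> \<circ> ?t \<in> geodesic A g \<longleftrightarrow> \<tau> \<in> geodesic A \<gamma>"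
      unfolding g_def by (rule geodesic_transpose[OF A(1) that(1) \<gamma> A(3) jA xj joint[OF that] jo])
    moreover have "\<tau> \<circ> ?t permutes A"
      using that(1) A(3) jA by (intro permutes_compose permutes_swap_id) auto
    ultimately show ?thesis using geodesic_remove_point[OF R, of "\<tau> \<circ> ?t"] that(2) by (simp add: h_def)
  qed
  let ?cw = "\<lambda>\<tau>. cycle_weight w B (perm_restrict \<tau> B)"
    and ?rw = "\<lambda>\<tau>. rooted_weight w C j (s - 1) (perm_restrict \<tau> C)"
  have val: "?cw (\<tau> \<circ> ?t) * ?rw (\<tau> \<circ> ?t) = rooted_weight w A x s \<tau>"
    if \<tau>: "\<tau> \<in> geodesic A \<gamma>" "\<tau> j = x" for \<tau>
  proof -
    have tp: "\<tau> permutes A" using \<tau>(1) by (rule geodesic_permutes)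
    note T = A(1) tp A(3) jA xj
    define \<rho> where "\<rho> = \<tau> \<circ> ?t"
    have tp': "\<rho> permutes A" unfolding \<rho>_def by (rule permutes_comp_transpose[OF T])
    have h: "\<rho> \<in> geodesic A h" using to_h[OF tp \<tau>(2)] \<tau>(1) by (simp add: \<rho>_def)
    have in_orb: "\<rho> z \<in> orbit h z" for z by (rule geodesic_in_orbit[OF A(1) hp h])
    have presB: "\<rho> z \<in> B" if "z \<in> B" for z using in_orb[of z] hB that by simp
    have presC: "\<rho> z \<in> C" if "z \<in> C" for z using in_orb[of z] hC that by simp
    have fix_x: "\<rho> x = x" using \<tau>(2) by (simp add: \<rho>_def)
    have ox: "orbit \<rho> x = {x}" using fix_x orbit_eq_singleton_iff by metis
    have subC: "orbit \<rho> j \<subseteq> C"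
      using presC jC by (rule orbit_subset_closed)
    have jox: "j \<in> orbit \<tau> x" by (rule joint[OF tp \<tau>(2)])
    have "orbit \<tau> j = orbit \<tau> x" using orbit_eq_iff[OF A(1) tp] jox by blast
    \<comment> \<open>The cut separates the fixed point \<open>x\<close> from the cycle of
      \<open>j\<close>; so \<open>j\<close> becomes the new root, with a cycle shorter by
      one.\<close>
    then have orb: "orbit \<tau> x = insert x (orbit \<rho> j)"
      using orbit_transpose_Un[OF T] ox by (auto simp: \<rho>_def)
    have "card (orbit \<tau> x) = Suc (card (orbit \<rho> j))"
      using orb subC xC finite_subset[OF subC finC] by (metis card_insert_disjoint subsetD)
    then have card: "card (orbit \<tau> x) = s \<longleftrightarrow> card (orbit \<rho> j) = s - 1" using s by auto
    have BB: "c \<subseteq> B" if "c \<in> cycle_partition B \<rho>" for c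
      using that orbit_subset_closed[of B \<rho>] presB by (auto simp: cycle_partition_def)
    have CC: "c \<subseteq> C" if "c \<in> cycle_partition C \<rho>" for c
      using that orbit_subset_closed[of C \<rho>] presC by (auto simp: cycle_partition_def)
    have jc: "j \<in> c \<longleftrightarrow> c = orbit \<rho> j" if cc: "c \<in> cycle_partition C \<rho>" for c
    proof -
      obtain z where "c = orbit \<rho> z" using cc by (auto simp: cycle_partition_def)
      then show ?thesis using orbit_eq_iff[OF A(1) tp'] by metis
    qed
    have "cycle_partition A \<tau> - {orbit \<tau> x} = {c \<in> cycle_partition A \<tau>. x \<notin> c \<and> j \<notin> c}"
    proof (intro equalityI subsetI)
      fix c assume c: "c \<in> cycle_partition A \<tau> - {orbit \<tau> x}"
      have "c = orbit \<tau> z" if "z \<in> c" for z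
        using c that by (intro cycle_partition_eq_orbit[OF A(1) tp]) auto
      then have "x \<notin> c" "j \<notin> c"
        using c \<open>orbit \<tau> j = orbit \<tau> x\<close> by (metis DiffD2 singletonI)+
      then show "c \<in> {c \<in> cycle_partition A \<tau>. x \<notin> c \<and> j \<notin> c}" using c by blast
    qed (use jox in auto)
    also have "\<dots> = {c \<in> cycle_partition A \<rho>. x \<notin> c \<and> j \<notin> c}"
      unfolding \<rho>_def by (rule cycle_partition_transpose_avoid[OF T, symmetric])
    also have "\<dots> = {c \<in> insert {x} (cycle_partition B \<rho> \<union> cycle_partition C \<rho>). x \<notin> c \<and> j \<notin> c}"
      unfolding AB by (simp add: cycle_partition_def image_Un ox)
    also have "\<dots> = cycle_partition B \<rho> \<union> (cycle_partition C \<rho> - {orbit \<rho> j})"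
    proof (intro equalityI subsetI)
      fix c assume "c \<in> {c \<in> insert {x} (cycle_partition B \<rho> \<union> cycle_partition C \<rho>). x \<notin> c \<and> j \<notin> c}"
      then show "c \<in> cycle_partition B \<rho> \<union> (cycle_partition C \<rho> - {orbit \<rho> j})"
        using jc[of c] by auto
    next
      fix c assume "c \<in> cycle_partition B \<rho> \<union> (cycle_partition C \<rho> - {orbit \<rho> j})"
      then show "c \<in> {c \<in> insert {x} (cycle_partition B \<rho> \<union> cycle_partition C \<rho>). x \<notin> c \<and> j \<notin> c}"
        using jc[of c] BB[of c] CC[of c] xB xC BC jC by auto
    qed
    finally have split: "cycle_partition A \<tau> - {orbit \<tau> x} =
      cycle_partition B \<rho> \<union> (cycle_partition C \<rho> - {orbit \<rho> j})" .
    have disj: "cycle_partition B \<rho> \<inter> (cycle_partition C \<rho> - {orbit \<rho> j}) = {}"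
    proof -
      have "c \<noteq> {}" if "c \<in> cycle_partition B \<rho>" for c
        using that by (auto simp: cycle_partition_def orbit_nonempty)
      then show ?thesis using BB CC BC by blast
    qed
    have cB: "cycle_partition B (perm_restrict \<rho> B) = cycle_partition B \<rho>"
      using presB by (rule cycle_partition_perm_restrict)
    have cC: "cycle_partition C (perm_restrict \<rho> C) = cycle_partition C \<rho>"
      using presC by (rule cycle_partition_perm_restrict)
    have oC: "orbit (perm_restrict \<rho> C) j = orbit \<rho> j" using presC jC by (rule orbit_perm_restrict)
    show ?thesis
      unfolding \<rho>_def[symmetric] cycle_weight_def rooted_weight_def cB cC oC split card
      using disj finB finC by (simp add: prod.union_disjoint finite_cycle_partition)
  qed
  have "(\<Sum>\<tau> | \<tau> \<in> geodesic A \<gamma> \<and> \<tau> j = x. rooted_weight w A x s \<tau>) =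
      (\<Sum>\<tau>\<in>geodesic A h. ?cw \<tau> * ?rw \<tau>)"
  proof (rule sum.reindex_bij_witness[of _ "\<lambda>\<tau>. \<tau> \<circ> ?t" "\<lambda>\<tau>. \<tau> \<circ> ?t"])
    fix \<tau> assume "\<tau> \<in> {\<tau>. \<tau> \<in> geodesic A \<gamma> \<and> \<tau> j = x}"
    then have t: "\<tau> \<in> geodesic A \<gamma>" "\<tau> j = x" by auto
    show "\<tau> \<circ> ?t \<in> geodesic A h" using to_h[OF geodesic_permutes[OF t(1)] t(2)] t(1) by simp
    show "?cw (\<tau> \<circ> ?t) * ?rw (\<tau> \<circ> ?t) = rooted_weight w A x s \<tau>" by (rule val[OF t])
  next
    \<comment> \<open>The \<open>h\<close>-cycle of \<open>x\<close> is a singleton, so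
      \<open>\<tau>\<close> fixes \<open>x\<close>, and undoing the transposition sends
      \<open>j\<close> to \<open>x\<close>.\<close>
    fix \<tau> assume t: "\<tau> \<in> geodesic A h"
    have "\<tau> x \<in> orbit h x" by (rule geodesic_in_orbit[OF A(1) hp t])
    then have "\<tau> x = x" using hx orbit_eq_singleton_iff by (metis singletonD)
    moreover have "\<tau> \<circ> ?t permutes A"
      using geodesic_permutes[OF t] A(3) jA by (intro permutes_compose permutes_swap_id) auto
    ultimately show "\<tau> \<circ> ?t \<in> {\<tau>. \<tau> \<in> geodesic A \<gamma> \<and> \<tau> j = x}"
      using to_h[of "\<tau> \<circ> ?t"] t by (simp add: comp_assoc)
  qed (simp_all add: comp_assoc)
  also have "\<dots> = (\<Sum>\<tau>\<in>geodesic B (perm_restrict h B). cycle_weight w B \<tau>) *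
      (\<Sum>\<tau>\<in>geodesic C (perm_restrict h C). rooted_weight w C j (s - 1) \<tau>)"
    unfolding AB
    by (rule sum_geodesic_split3[OF finB finC xB xC BC hp[unfolded AB] hx])
      (use sB(2) sC(2) in \<open>auto simp: AB\<close>)
  finally have eq: "(\<Sum>\<tau> | \<tau> \<in> geodesic A \<gamma> \<and> \<tau> j = x. rooted_weight w A x s \<tau>) = \<dots>" .
  have "single_cycle B (perm_restrict h B)" "single_cycle C (perm_restrict h C)"
    using sB(1) sC(1) by blast+
  then show ?thesis
    apply -
    apply (rule exI[of _ B], rule exI[of _ C], rule exI[of _ "perm_restrict h B"],
      rule exI[of _ "perm_restrict h C"])
    using eq finB finC jC cardB cardC xj[symmetric] by simp
qed

text \<open>A root cycle of length \<open>1\<close> is a fixed point of \<open>\<tau>\<close>, so it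
  is deleted from \<open>\<gamma>\<close> alone. This ends the recursion on the length of the root
  cycle.\<close>

lemma sum_rooted_1:
  fixes A :: "'a set"
  assumes A: "finite A" "single_cycle A \<gamma>" "x \<in> A"
  shows "\<exists>(B :: 'a set) \<beta>. finite B \<and> single_cycle B \<beta> \<and> card B = card A - 1 \<and>
    (\<Sum>\<tau>\<in>geodesic A \<gamma>. rooted_weight w A x 1 \<tau>) = (\<Sum>\<tau>\<in>geodesic B \<beta>. cycle_weight w B \<tau>)"
proof -
  have \<gamma>: "\<gamma> permutes A" and o: "\<And>z. z \<in> A \<Longrightarrow> orbit \<gamma> z = A" using A by (auto simp: single_cycle_def)
  define h where "h = \<gamma> \<circ> transpose x (inv \<gamma> x)"
  note R = A(1) \<gamma> A(3)
  have hp: "h permutes A" unfolding h_def by (rule permutes_remove_point[OF R])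
  have hx: "h x = x" unfolding h_def by (rule remove_point_fixed[OF R])
  define B where "B = A - {x}"
  have finB: "finite B" and AB: "A = insert x (B \<union> {})" and xB: "x \<notin> B" using A by (auto simp: B_def)
  have hB: "orbit h z = B" if "z \<in> B" for z
    using orbit_remove_point[OF R, of z] o[of z] that by (simp add: h_def B_def)
  note sB = single_cycle_perm_restrict[OF A(1) hp hB]
  let ?cw = "\<lambda>\<tau>. cycle_weight w B (perm_restrict \<tau> B)"
  have "(\<Sum>\<tau>\<in>geodesic A \<gamma>. rooted_weight w A x 1 \<tau>) =
      (\<Sum>\<tau> | \<tau> \<in> geodesic A \<gamma> \<and> \<tau> x = x. rooted_weight w A x 1 \<tau>)"
  proof (rule sum.mono_neutral_right)
    show "\<forall>\<tau>\<in>geodesic A \<gamma> - {\<tau> \<in> geodesic A \<gamma>. \<tau> x = x}. rooted_weight w A x 1 \<tau> = 0"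
    proof
      fix \<tau> assume t: "\<tau> \<in> geodesic A \<gamma> - {\<tau> \<in> geodesic A \<gamma>. \<tau> x = x}"
      then have tp: "\<tau> permutes A" using geodesic_permutes by blast
      have "card (orbit \<tau> x) \<noteq> 1"
      proof
        assume "card (orbit \<tau> x) = 1"
        then have "orbit \<tau> x = {x}" using orbit_self[OF A(1) tp, of x] by (metis card_1_singletonE singletonD)
        then show False using t by (simp add: orbit_eq_singleton_iff)
      qed
      then show "rooted_weight w A x 1 \<tau> = 0" by (simp add: rooted_weight_def)
    qed
  qed (use finite_geodesic[OF A(1)] in auto)
  also have "\<dots> = (\<Sum>\<tau>\<in>geodesic A h. ?cw \<tau> * (\<lambda>_. 1) (perm_restrict \<tau> {}))"
  proof (rule sum.cong)
    show "{\<tau> \<in> geodesic A \<gamma>. \<tau> x = x} = geodesic A h"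
    proof (intro equalityI subsetI)
      fix \<tau> assume t: "\<tau> \<in> geodesic A h"
      have "\<tau> x \<in> orbit h x" by (rule geodesic_in_orbit[OF A(1) hp t])
      then have "\<tau> x = x" using hx orbit_eq_singleton_iff by (metis singletonD)
      then show "\<tau> \<in> {\<tau> \<in> geodesic A \<gamma>. \<tau> x = x}"
        using geodesic_remove_point[OF R] t geodesic_permutes[OF t] by (simp add: h_def)
    qed (use geodesic_remove_point[OF R] geodesic_permutes in \<open>auto simp: h_def\<close>)
  next
    fix \<tau> assume t: "\<tau> \<in> geodesic A h"
    have tp: "\<tau> permutes A" by (rule geodesic_permutes[OF t])
    have in_orb: "\<tau> z \<in> orbit h z" for z by (rule geodesic_in_orbit[OF A(1) hp t])
    have "\<tau> x = x" using hx orbit_eq_singleton_iff in_orb[of x] by (metis singletonD)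
    then have ox: "orbit \<tau> x = {x}" by (simp add: orbit_eq_singleton_iff)
    have pres: "\<tau> z \<in> B" if "z \<in> B" for z using in_orb[of z] hB that by simp
    have "x \<notin> c" if "c \<in> cycle_partition B \<tau>" for c
      using that orbit_subset_closed[of B \<tau>] pres xB by (auto simp: cycle_partition_def)
    then have "{x} \<notin> cycle_partition B \<tau>" by blast
    moreover have "cycle_partition A \<tau> = insert {x} (cycle_partition B \<tau>)"
      unfolding AB by (simp add: cycle_partition_def ox)
    ultimately show "rooted_weight w A x 1 \<tau> = ?cw \<tau> * (\<lambda>_. 1) (perm_restrict \<tau> {})"
      using cycle_partition_perm_restrict[of B \<tau>] pres finite_cycle_partition[OF finB, of \<tau>]
      by (simp add: rooted_weight_def cycle_weight_def ox)
  qed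
  also have "\<dots> = (\<Sum>\<tau>\<in>geodesic B (perm_restrict h B). cycle_weight w B \<tau>) *
      (\<Sum>\<tau>\<in>geodesic {} (perm_restrict h {}). 1)"
    unfolding AB
    by (rule sum_geodesic_split3[OF finB finite.emptyI xB _ Int_empty_right hp[unfolded AB] hx])
      (use sB(2) in \<open>auto simp: AB\<close>)
  finally have "(\<Sum>\<tau>\<in>geodesic A \<gamma>. rooted_weight w A x 1 \<tau>) =
      (\<Sum>\<tau>\<in>geodesic B (perm_restrict h B). cycle_weight w B \<tau>)" by (simp add: geodesic_trivial)
  moreover have "card B = card A - 1" using A by (simp add: B_def)
  moreover have "single_cycle B (perm_restrict h B)" using sB(1) by blast
  ultimately show ?thesis
    apply -
    apply (rule exI[of _ B], rule exI[of _ "perm_restrict h B"])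
    using finB by simp
qed

section \<open>The generating function of the geodesics of one cycle\<close>

definition weight_series :: "(nat \<Rightarrow> complex) \<Rightarrow> complex fps" where
  "weight_series w = Abs_fps (\<lambda>i. if i = 0 then 1 else w i)"

text \<open>The equation \<open>B = H oo (fps_X * B)\<close> says that \<open>Y = fps_X * B\<close>
  solves \<open>Y / H(Y) = X\<close>. So \<open>Y\<close> is the compositional inverse of
  \<open>X / H\<close>, and \<open>B = H oo Y\<close>.\<close>

definition cycle_series :: "(nat \<Rightarrow> complex) \<Rightarrow> complex fps" where
  "cycle_series w = weight_series w oo fps_inv (fps_X * inverse (weight_series w))"

lemma weight_series_nth: "weight_series w $ i = (if i = 0 then 1 else w i)"
  by (simp add: weight_series_def)

lemma cycle_series_eq: "cycle_series w = weight_series w oo (fps_X * cycle_series w)"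
proof -
  let ?H = "weight_series w" and ?a = "fps_X * inverse (weight_series w)"
  let ?Y = "fps_inv ?a"
  have Y0: "?Y $ 0 = 0" by (simp add: fps_inv_def)
  have "?a oo ?Y = fps_X"
    by (rule fps_inv_right) (simp_all add: weight_series_nth)
  then have "?Y * inverse (?H oo ?Y) = fps_X"
    using Y0 by (simp add: fps_compose_mult_distrib fps_inverse_compose weight_series_nth)
  then have "?Y * (inverse (?H oo ?Y) * (?H oo ?Y)) = fps_X * (?H oo ?Y)"
    by (simp add: mult.assoc)
  moreover have "inverse (?H oo ?Y) * (?H oo ?Y) = 1"
    by (rule inverse_mult_eq_1) (simp add: weight_series_nth)
  ultimately have "?Y = fps_X * (?H oo ?Y)" by simp
  then show ?thesis by (simp add: cycle_series_def)
qed

lemma cycle_series_0 [simp]: "cycle_series w $ 0 = 1"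
  by (subst cycle_series_eq) (simp add: weight_series_nth)

lemma orbit_card_bounds:
  assumes "finite A" "\<tau> permutes A" "x \<in> A" shows "card (orbit \<tau> x) \<in> {1..card A}"
proof -
  have sub: "orbit \<tau> x \<subseteq> A" using permutes_orbit_subset[OF assms(2,3)] .
  have "finite (orbit \<tau> x)" using sub assms(1) finite_subset by blast
  then have "card (orbit \<tau> x) > 0" using orbit_nonempty by (metis card_gt_0_iff)
  then show ?thesis using card_mono[OF assms(1) sub] by simp
qed

lemma cycle_weight_eq_sum_rooted:
  assumes "finite A" "\<tau> permutes A" "x \<in> A"
  shows "cycle_weight w A \<tau> = (\<Sum>s=1..card A. w s * rooted_weight w A x s \<tau>)"
proof -
  let ?P = "\<Prod>c\<in>cycle_partition A \<tau> - {orbit \<tau> x}. w (card c)"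
  have "cycle_weight w A \<tau> = w (card (orbit \<tau> x)) * ?P"
    unfolding cycle_weight_def using assms finite_cycle_partition[OF assms(1)]
    by (intro prod.remove) (auto simp: cycle_partition_def)
  also have "\<dots> = (\<Sum>s=1..card A. if card (orbit \<tau> x) = s then w s * ?P else 0)"
    using orbit_card_bounds[OF assms] by (simp only: sum.delta' finite_atLeastAtMost if_True)
  also have "\<dots> = (\<Sum>s=1..card A. w s * rooted_weight w A x s \<tau>)"
    by (intro sum.cong) (auto simp: rooted_weight_def)
  finally show ?thesis .
qed

text \<open>A root cycle of length \<open>s\<close> cuts \<open>\<gamma>\<close> into
  \<open>s\<close> gaps that are filled independently, whence the \<open>s\<close>-th power of
  \<open>fps_X * B\<close>. Summing over \<open>s\<close> with weights gives
  \<open>H oo (fps_X * B)\<close>, which is \<open>B\<close>. Both claims share one induction,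
  because the rooted sums need both of them on smaller sets.\<close>

lemma sum_geodesic_rooted:
  fixes A :: "'a set"
  assumes "finite A" "single_cycle A \<gamma>"
  shows "(\<Sum>\<tau>\<in>geodesic A \<gamma>. cycle_weight w A \<tau>) = cycle_series w $ card A \<and>
    (\<forall>x\<in>A. \<forall>s\<ge>1.
      (\<Sum>\<tau>\<in>geodesic A \<gamma>. rooted_weight w A x s \<tau>) = (fps_X * cycle_series w) ^ s $ card A)"
  using assms
proof (induction "card A" arbitrary: A \<gamma> rule: less_induct)
  case less
  note A = less.prems
  let ?B = "cycle_series w" and ?Y = "fps_X * cycle_series w"
  have rooted: "(\<Sum>\<tau>\<in>geodesic A \<gamma>. rooted_weight w A x s \<tau>) = ?Y ^ s $ card A"
    if x: "x \<in> A" and s: "s \<ge> 1" for x s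
  proof -
    have n: "card A > 0" using x A(1) by (auto simp: card_gt_0_iff)
    \<comment> \<open>One factor \<open>fps_X * ?B\<close> is split off: \<open>fps_X\<close> for
      the root, \<open>?B\<close> for the piece that does not contain the rest of the root
      cycle.\<close>
    have rec: "?Y ^ s $ card A = (?Y ^ (s - 1) * ?B) $ (card A - 1)"
      using s n by (cases s) (simp_all add: mult_ac)
    show ?thesis
    proof (cases "s = 1")
      case True
      obtain B :: "'a set" and \<beta> where B: "finite B" "single_cycle B \<beta>" "card B = card A - 1"
        "(\<Sum>\<tau>\<in>geodesic A \<gamma>. rooted_weight w A x 1 \<tau>) = (\<Sum>\<tau>\<in>geodesic B \<beta>. cycle_weight w B \<tau>)"
        using sum_rooted_1[OF A x, of w] by blast
      have "card B < card A" using B n by simp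
      then have "(\<Sum>\<tau>\<in>geodesic B \<beta>. cycle_weight w B \<tau>) = ?B $ card B"
        using less.hyps B by blast
      then show ?thesis using True B rec by simp
    next
      case False
      then have s2: "1 \<le> s - 1" using s by simp
      have \<gamma>: "\<gamma> permutes A" using A(2) by (simp add: single_cycle_def)
      let ?y = "\<lambda>m. (\<gamma> ^^ m) x"
      have zero: "rooted_weight w A x s \<tau> = 0" if "\<tau> x = x" for \<tau>
      proof -
        have "orbit \<tau> x = {x}" using that by (simp add: orbit_eq_singleton_iff)
        then show ?thesis using False by (simp add: rooted_weight_def)
      qed
      have step: "(\<Sum>\<tau> | \<tau> \<in> geodesic A \<gamma> \<and> \<tau> (?y m) = x. rooted_weight w A x s \<tau>) =
          ?Y ^ (s - 1) $ m * ?B $ (card A - 1 - m)" if m: "m < card A" for m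
      \<comment> \<open>For \<open>m = 0\<close> the condition says that \<open>\<tau>\<close> fixes
        \<open>x\<close>, so a root cycle of length \<open>s > 1\<close> is impossible; the
        coefficient of \<open>?Y ^ (s - 1)\<close> at \<open>0\<close> vanishes too.\<close>
      proof (cases "m = 0")
        case True
        then have "(\<Sum>\<tau> | \<tau> \<in> geodesic A \<gamma> \<and> \<tau> (?y m) = x. rooted_weight w A x s \<tau>) = 0"
          using zero by (intro sum.neutral) auto
        moreover have "1 < s" using s2 by simp
        ultimately show ?thesis using True by (simp add: fps_power_zeroth)
      next
        case False
        obtain B C :: "'a set" and \<beta> \<delta> where B: "finite B" "single_cycle B \<beta>" "card B = card A - 1 - m"
          and C: "finite C" "single_cycle C \<delta>" "?y m \<in> C" "card C = m"
          and e: "(\<Sum>\<tau> | \<tau> \<in> geodesic A \<gamma> \<and> \<tau> (?y m) = x. rooted_weight w A x s \<tau>) =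
            (\<Sum>\<tau>\<in>geodesic B \<beta>. cycle_weight w B \<tau>) *
            (\<Sum>\<tau>\<in>geodesic C \<delta>. rooted_weight w C (?y m) (s - 1) \<tau>)"
          using sum_rooted_step[OF A x _ m refl s, of w] False by blast
        have "card B < card A" "card C < card A" using B C m by auto
        then have "(\<Sum>\<tau>\<in>geodesic B \<beta>. cycle_weight w B \<tau>) = ?B $ card B"
          "(\<Sum>\<tau>\<in>geodesic C \<delta>. rooted_weight w C (?y m) (s - 1) \<tau>) = ?Y ^ (s - 1) $ card C"
          using less.hyps[OF _ B(1,2)] less.hyps[OF _ C(1,2)] C(3) s2 by blast+
        then show ?thesis using e B(3) C(4) by simp
      qed
      note fc = funpow_cycle[OF A x]
      have "(\<Sum>\<tau>\<in>geodesic A \<gamma>. rooted_weight w A x s \<tau>) =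
          (\<Sum>j\<in>A. \<Sum>\<tau> | \<tau> \<in> geodesic A \<gamma> \<and> inv \<tau> x = j. rooted_weight w A x s \<tau>)"
      proof (intro sum.group[symmetric] finite_geodesic A(1) image_subsetI)
        fix \<tau> assume t: "\<tau> \<in> geodesic A \<gamma>"
        show "inv \<tau> x \<in> A"
          using permutes_in_image[OF permutes_inv[OF geodesic_permutes[OF t]]] x by simp
      qed
      also have "\<dots> = (\<Sum>m<card A. \<Sum>\<tau> | \<tau> \<in> geodesic A \<gamma> \<and> inv \<tau> x = ?y m. rooted_weight w A x s \<tau>)"
        by (rule sum.reindex_bij_betw[symmetric]) (use fc in \<open>auto simp: bij_betw_def\<close>)
      also have "\<dots> = (\<Sum>m<card A. \<Sum>\<tau> | \<tau> \<in> geodesic A \<gamma> \<and> \<tau> (?y m) = x. rooted_weight w A x s \<tau>)"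
      proof -
        have "inv \<tau> x = y \<longleftrightarrow> \<tau> y = x" if "\<tau> \<in> geodesic A \<gamma>" for \<tau> y
          using permutes_inverses[OF geodesic_permutes[OF that]] by metis
        then show ?thesis by (intro sum.cong) auto
      qed
      also have "\<dots> = (\<Sum>m<card A. ?Y ^ (s - 1) $ m * ?B $ (card A - 1 - m))"
        using step by (intro sum.cong) auto
      also have "{..<card A} = {0..card A - 1}" using n by auto
      finally show ?thesis unfolding rec fps_mult_nth .
    qed
  qed
  have "(\<Sum>\<tau>\<in>geodesic A \<gamma>. cycle_weight w A \<tau>) = cycle_series w $ card A"
    proof (cases "A = {}")
      case True
      then show ?thesis by (simp add: geodesic_trivial cycle_weight_def cycle_partition_def)
    next
      case False
      then obtain x where x: "x \<in> A" by blast
      have n: "card A > 0" using x A(1) by (auto simp: card_gt_0_iff)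
      have "(\<Sum>\<tau>\<in>geodesic A \<gamma>. cycle_weight w A \<tau>) =
          (\<Sum>\<tau>\<in>geodesic A \<gamma>. \<Sum>s=1..card A. w s * rooted_weight w A x s \<tau>)"
        using cycle_weight_eq_sum_rooted[OF A(1) geodesic_permutes x] by (intro sum.cong) auto
      also have "\<dots> = (\<Sum>s=1..card A. w s * (\<Sum>\<tau>\<in>geodesic A \<gamma>. rooted_weight w A x s \<tau>))"
        by (subst sum.swap) (simp add: sum_distrib_left)
      also have "\<dots> = (\<Sum>s=1..card A. w s * ?Y ^ s $ card A)"
      proof (rule sum.cong)
        fix s assume "s \<in> {1..card A}"
        then have "1 \<le> s" by simp
        from rooted[OF x this]
        show "w s * (\<Sum>\<tau>\<in>geodesic A \<gamma>. rooted_weight w A x s \<tau>) = w s * ?Y ^ s $ card A" by simp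
      qed simp
      \<comment> \<open>The added term \<open>s = 0\<close> is the coefficient of the series
        \<open>1\<close> at a positive exponent.\<close>
      also have "\<dots> = (\<Sum>s=0..card A. weight_series w $ s * ?Y ^ s $ card A)"
      proof (rule sum.mono_neutral_cong_left)
        show "\<forall>i\<in>{0..card A} - {1..card A}. weight_series w $ i * ?Y ^ i $ card A = 0"
          using n by (auto simp: not_le)
      qed (auto simp: weight_series_nth)
      also have "\<dots> = (weight_series w oo ?Y) $ card A" by (simp add: fps_compose_nth)
      finally show ?thesis by (simp only: cycle_series_eq[symmetric])
    qed
  then show ?case using rooted by blast
qed

section \<open>Lagrange inversion and marked cycles\<close>

text \<open>As \<open>Y ^ i\<close> starts in degree \<open>i\<close>, the inner sums of the
  composition may all be extended to \<open>N\<close>; then they can be interchanged with the sum of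
  the product.\<close>

lemma fps_compose_mult_nth:
  fixes a Y G :: "'a::comm_ring_1 fps"
  assumes "Y $ 0 = 0"
  shows "((a oo Y) * G) $ N = (\<Sum>i=0..N. a $ i * (Y ^ i * G) $ N)"
proof -
  have "((a oo Y) * G) $ N = (\<Sum>k=0..N. (\<Sum>i=0..k. a $ i * Y ^ i $ k) * G $ (N - k))"
    by (simp add: fps_mult_nth fps_compose_nth)
  also have "\<dots> = (\<Sum>k=0..N. (\<Sum>i=0..N. a $ i * Y ^ i $ k) * G $ (N - k))"
  proof (rule sum.cong)
    fix k assume "k \<in> {0..N}"
    then have "(\<Sum>i=0..k. a $ i * Y ^ i $ k) = (\<Sum>i=0..N. a $ i * Y ^ i $ k)"
      using startsby_zero_power_prefix[OF assms] by (intro sum.mono_neutral_left) auto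
    then show "(\<Sum>i=0..k. a $ i * Y ^ i $ k) * G $ (N - k) = (\<Sum>i=0..N. a $ i * Y ^ i $ k) * G $ (N - k)"
      by simp
  qed simp
  also have "\<dots> = (\<Sum>i=0..N. a $ i * (Y ^ i * G) $ N)"
    by (simp add: fps_mult_nth sum_distrib_left sum_distrib_right mult.assoc) (rule sum.swap)
  finally show ?thesis .
qed

text \<open>The coefficient is the residue of \<open>Y powi (m - N - 1) * Y'\<close>, written without Laurent series.\<close>

lemma fps_power_deriv_residue:
  fixes B :: "complex fps"
  assumes B0: "B $ 0 = 1" defines "Y \<equiv> fps_X * B"
  shows "(Y ^ m * (fps_deriv Y * inverse B ^ (N + 1))) $ N = (if m = N then 1 else 0)"
proof -
  let ?C = "inverse B"
  have BC: "B * ?C = 1" using B0 by (intro inverse_mult_eq_1') simp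
  have Bm: "B ^ a * ?C ^ (a + b) = ?C ^ b" for a b
    by (simp only: power_add mult.assoc[symmetric] power_mult_distrib[symmetric] BC) simp
  have Y': "fps_deriv Y = B + fps_X * fps_deriv B" by (simp add: Y_def)
  have Ym: "Y ^ m * (fps_deriv Y * ?C ^ (N + 1)) = fps_X ^ m * (B ^ m * ?C ^ (N + 1) * fps_deriv Y)"
    by (simp add: Y_def power_mult_distrib mult_ac)
  consider "m > N" | "m = N" | "m < N" by linarith
  then show ?thesis
  proof cases
    case 1
    then show ?thesis unfolding Ym by (simp add: fps_X_power_mult_nth)
  next
    case 2
    then have Cm: "B ^ m * ?C ^ (N + 1) = ?C" using Bm[of m 1] by simp
    show ?thesis unfolding Ym Cm using 2 B0 by (simp add: fps_X_power_mult_nth Y')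
  next
    case 3
    then obtain r where r: "N = m + r" "r \<ge> 1"
      by (metis less_imp_add_positive less_eq_Suc_le One_nat_def)
    \<comment> \<open>A derivative has no residue: \<open>r\<close> times the series in question is
      \<open>r * ?C ^ r - X * ?D\<close>, and the two terms cancel in degree
      \<open>r\<close>.\<close>
    let ?D = "fps_deriv (?C ^ r)"
    have "?D = fps_const (of_nat r) * (- fps_deriv B * ?C ^ 2) * ?C ^ (r - 1)"
      using B0 by (simp only: fps_deriv_power) (simp add: fps_inverse_deriv)
    also have "\<dots> = - (fps_const (of_nat r) * (fps_deriv B * ?C ^ (2 + (r - 1))))"
      by (simp only: power_add mult_minus_left mult_minus_right mult_ac)
    also have "2 + (r - 1) = r + 1" using r by simp
    finally have D: "fps_const (of_nat r) * (fps_deriv B * ?C ^ (r + 1)) = - ?D" by simp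
    have "B ^ m * ?C ^ (N + 1) * fps_deriv Y = ?C ^ (r + 1) * fps_deriv Y"
      using Bm[of m "r + 1"] r by (simp add: add.assoc)
    also have "\<dots> = ?C ^ r + fps_X * (fps_deriv B * ?C ^ (r + 1))"
    proof -
      have "?C ^ (r + 1) * B = ?C ^ r * (B * ?C)" by (simp only: power_add power_one_right mult_ac)
      then have "?C ^ (r + 1) * B = ?C ^ r" by (simp only: BC mult_1_right)
      then show ?thesis by (simp only: Y' distrib_left) (simp only: mult_ac)
    qed
    finally have B_r: "B ^ m * ?C ^ (N + 1) * fps_deriv Y = ?C ^ r + fps_X * (fps_deriv B * ?C ^ (r + 1))" .
    have e: "fps_const (of_nat r) * (B ^ m * ?C ^ (N + 1) * fps_deriv Y) =
        fps_const (of_nat r) * ?C ^ r - fps_X * ?D"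
    proof -
      have "fps_const (of_nat r) * (fps_X * (fps_deriv B * ?C ^ (r + 1))) = fps_X * - ?D"
        unfolding D[symmetric] by (rule mult.left_commute)
      then show ?thesis unfolding B_r by (simp only: distrib_left) simp
    qed
    have "of_nat r * (B ^ m * ?C ^ (N + 1) * fps_deriv Y) $ r = 0"
      using arg_cong[OF e, of "\<lambda>f. f $ r"] r by simp
    then have "(B ^ m * ?C ^ (N + 1) * fps_deriv Y) $ r = 0" using r by simp
    then show ?thesis unfolding Ym using r by (simp add: fps_X_power_mult_nth)
  qed
qed

text \<open>The product of \<open>H ^ (N + 1) oo Y\<close> and \<open>inverse B ^ (N + 1)\<close> is
  \<open>1\<close>. Insert it and expand the first factor in powers of \<open>Y\<close>: the terms
  are the residues of \<open>fps_power_deriv_residue\<close>, and only the power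
  \<open>N - j\<close> survives.\<close>

lemma fps_lagrange:
  fixes B H :: "complex fps"
  assumes B0: "B $ 0 = 1" and B: "B = H oo (fps_X * B)" defines "Y \<equiv> fps_X * B"
  shows "(fps_deriv Y * Y ^ j) $ N = (if j \<le> N then (H ^ (N + 1)) $ (N - j) else 0)"
proof -
  have Y0: "Y $ 0 = 0" by (simp add: Y_def)
  have P: "H ^ (N + 1) oo Y = B ^ (N + 1)"
    using B by (simp only: fps_compose_power[OF Y0] Y_def[symmetric])
  have "B * inverse B = 1" using B0 by (intro inverse_mult_eq_1') simp
  then have BC: "B ^ (N + 1) * inverse B ^ (N + 1) = 1"
    by (simp only: power_mult_distrib[symmetric] power_one)
  have "fps_deriv Y * Y ^ j = (H ^ (N + 1) oo Y) * (Y ^ j * (fps_deriv Y * inverse B ^ (N + 1)))"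
  proof -
    have "B ^ (N + 1) * (Y ^ j * (fps_deriv Y * inverse B ^ (N + 1))) =
        (B ^ (N + 1) * inverse B ^ (N + 1)) * (fps_deriv Y * Y ^ j)"
      by (simp only: mult_ac)
    then show ?thesis by (simp only: P BC mult_1_left)
  qed
  then have "(fps_deriv Y * Y ^ j) $ N =
      (\<Sum>i=0..N. (H ^ (N + 1)) $ i * (Y ^ i * (Y ^ j * (fps_deriv Y * inverse B ^ (N + 1)))) $ N)"
    by (simp only: fps_compose_mult_nth[OF Y0])
  also have "\<dots> = (\<Sum>i=0..N. (H ^ (N + 1)) $ i * (if i + j = N then 1 else 0))"
    using fps_power_deriv_residue[OF B0, of _ N]
    by (simp only: mult.assoc[symmetric] power_add[symmetric]) (simp only: mult.assoc Y_def)
  also have "\<dots> = (\<Sum>i=0..N. if i = N - j then (if j \<le> N then (H ^ (N + 1)) $ i else 0) else 0)"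
    by (intro sum.cong) auto
  also have "\<dots> = (if j \<le> N then (H ^ (N + 1)) $ (N - j) else 0)" by simp
  finally show ?thesis .
qed

text \<open>\<open>Y ^ d * inverse B ^ d\<close> is \<open>fps_X ^ d\<close>, which reduces the
  claim to \<open>fps_lagrange\<close> at \<open>n - d\<close>. For \<open>n < d\<close> both
  coefficients vanish, so truncated subtraction does no harm.\<close>

lemma fps_lagrange_scaled:
  fixes B H :: "complex fps"
  assumes B0: "B $ 0 = 1" and B: "B = H oo (fps_X * B)" and dK: "d \<le> K" and d: "d \<ge> 1"
  defines "Y \<equiv> fps_X * B"
  shows "(fps_deriv Y * Y ^ K * inverse B ^ d) $ n = (fps_X ^ K * H ^ (n + 1 - d)) $ n"
proof -
  have "B * inverse B = 1" using B0 by (intro inverse_mult_eq_1') simp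
  then have BC: "B ^ d * inverse B ^ d = 1"
    by (simp only: power_mult_distrib[symmetric] power_one)
  have "Y ^ K = Y ^ (K - d) * (fps_X ^ d * B ^ d)"
    using dK by (simp add: Y_def power_add[symmetric] power_mult_distrib[symmetric])
  then have "fps_deriv Y * Y ^ K * inverse B ^ d = fps_X ^ d * (fps_deriv Y * Y ^ (K - d)) * (B ^ d * inverse B ^ d)"
    by (simp only: mult_ac)
  then have e: "fps_deriv Y * Y ^ K * inverse B ^ d = fps_X ^ d * (fps_deriv Y * Y ^ (K - d))"
    unfolding BC by simp
  show ?thesis
  proof (cases "K \<le> n")
    case True
    then have "n - d + 1 = n + 1 - d" "n - d - (K - d) = n - K" "K - d \<le> n - d" "\<not> n < d" using dK by auto
    then show ?thesis unfolding e
      using fps_lagrange[OF B0 B, of "K - d" "n - d"] True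
      by (simp add: fps_X_power_mult_nth Y_def)
  next
    case False
    then have "n < d \<or> \<not> K - d \<le> n - d" by auto
    then show ?thesis unfolding e
      using fps_lagrange[OF B0 B, of "K - d" "n - d"] False
      by (auto simp: fps_X_power_mult_nth Y_def)
  qed
qed

text \<open>The marks have names, the elements of \<open>D\<close>; these will be the black vertices
  adjacent to a white vertex.\<close>

definition marked_choices :: "'i set \<Rightarrow> ('i \<Rightarrow> nat) \<Rightarrow> 'a set set \<Rightarrow> ('i \<Rightarrow> 'a set) set" where
  "marked_choices D k C = {c \<in> D \<rightarrow>\<^sub>E C. inj_on c D \<and> (\<forall>I\<in>D. card (c I) = k I)}"

text \<open>Marked cycles have no weight of their own, because they enter the weight of a black
  vertex jointly with cycles of other supports.\<close>

definition marked_weight :: "(nat \<Rightarrow> complex) \<Rightarrow> 'i set \<Rightarrow> ('i \<Rightarrow> nat) \<Rightarrow> 'a set set \<Rightarrow> complex" where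
  "marked_weight w D k C = (\<Sum>c\<in>marked_choices D k C. \<Prod>e\<in>C - c ` D. w (card e))"

lemma finite_marked_choices: "finite D \<Longrightarrow> finite C \<Longrightarrow> finite (marked_choices D k C)"
  unfolding marked_choices_def by (rule finite_subset[OF _ finite_PiE[of D "\<lambda>_. C"]]) auto

lemma marked_choices_empty: "marked_choices {} k C = {\<lambda>_. undefined}"
  by (simp add: marked_choices_def)

text \<open>The cycle with mark \<open>J\<close> is chosen last. For a fixed choice of the others,
  the inner sum is the derivative of a product of weights with respect to
  \<open>w (k J)\<close>.\<close>

lemma marked_weight_insert:
  assumes "finite D" "finite C" "J \<notin> D"
  shows "marked_weight w (insert J D) k C =
    (\<Sum>c\<in>marked_choices D k C. \<Sum>e | e \<in> C - c ` D \<and> card e = k J. \<Prod>e\<in>C - c ` D - {e}. w (card e))"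
proof -
  have "marked_weight w (insert J D) k C =
    (\<Sum>(c, e)\<in>(SIGMA c:marked_choices D k C. {e. e \<in> C - c ` D \<and> card e = k J}).
      \<Prod>e\<in>C - c ` D - {e}. w (card e))"
    unfolding marked_weight_def
  proof (rule sum.reindex_bij_witness[of _ "\<lambda>(c, e). c(J := e)" "\<lambda>c. (c(J := undefined), c J)"], goal_cases)
    case (1 c) then show ?case by simp
  next
    case (2 c)
    have im: "(c(J := undefined)) ` D = c ` D" using assms(3) by (intro image_cong) auto
    have "inj_on (c(J := undefined)) D \<longleftrightarrow> inj_on c D" by (rule inj_on_cong) (use assms(3) in auto)
    then show ?case
      using 2 assms(3) im by (auto simp: marked_choices_def PiE_iff extensional_def)
  next
    case (3 ce)
    then obtain c e where ce: "ce = (c, e)" "c \<in> D \<rightarrow>\<^sub>E C" by (auto simp: marked_choices_def)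
    then have "c J = undefined" using assms(3) by (auto simp: PiE_iff extensional_def)
    then show ?case using ce by (auto simp: fun_upd_idem)
  next
    case (4 ce)
    then obtain c e where ce: "ce = (c, e)" "c \<in> D \<rightarrow>\<^sub>E C" "inj_on c D" "\<forall>I\<in>D. card (c I) = k I"
      "e \<in> C - c ` D" "card e = k J" by (auto simp: marked_choices_def)
    have im: "(c(J := e)) ` D = c ` D" using assms(3) by (intro image_cong) auto
    have "inj_on (c(J := e)) D \<longleftrightarrow> inj_on c D" by (rule inj_on_cong) (use assms(3) in auto)
    then show ?case
      using ce assms(3) im by (auto simp: marked_choices_def PiE_iff extensional_def)
  next
    case (5 c)
    have im: "(c(J := undefined)) ` D = c ` D" using assms(3) by (intro image_cong) auto
    have "C - c ` D - {c J} = C - c ` insert J D" by auto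
    then show ?case by (simp only: prod.case im)
  qed
  then show ?thesis
    using finite_marked_choices[OF assms(1,2)] assms(2) by (simp add: sum.Sigma)
qed

text \<open>This is the partial derivative with respect to \<open>w k\<close>: the product rule
  removes each set of size \<open>k\<close> in turn.\<close>

lemma has_derivative_prod_weight:
  fixes w :: "nat \<Rightarrow> complex"
  assumes "finite S"
  shows "((\<lambda>\<epsilon>. \<Prod>e\<in>S. (w(k := w k + \<epsilon>)) (card e)) has_field_derivative
    (\<Sum>e | e \<in> S \<and> card e = k. \<Prod>e\<in>S - {e}. w (card e))) (at 0)"
  using assms
proof (induction S rule: finite_induct)
  case (insert x S)
  let ?D = "\<lambda>S. \<Sum>e | e \<in> S \<and> card e = k. \<Prod>e\<in>S - {e}. w (card e)"
  let ?f = "\<lambda>\<epsilon>. (w(k := w k + \<epsilon>)) (card x)"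
  let ?d = "if card x = k then 1 else 0 :: complex"
  have d: "(?f has_field_derivative ?d) (at 0)" by (auto intro!: derivative_eq_intros)
  have "((\<lambda>\<epsilon>. ?f \<epsilon> * (\<Prod>e\<in>S. (w(k := w k + \<epsilon>)) (card e))) has_field_derivative
    ?d * (\<Prod>e\<in>S. (w(k := w k + 0)) (card e)) + ?D S * ?f 0) (at 0)"
    by (rule DERIV_mult[OF d insert.IH])
  moreover have "?D (insert x S) = ?d * (\<Prod>e\<in>S. (w(k := w k + 0)) (card e)) + ?D S * ?f 0"
  proof -
    have "?D S * ?f 0 = (\<Sum>e | e \<in> S \<and> card e = k. \<Prod>e\<in>insert x S - {e}. w (card e))"
      unfolding sum_distrib_right
    proof (rule sum.cong)
      fix e assume e: "e \<in> {e. e \<in> S \<and> card e = k}"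
      then have "insert x S - {e} = insert x (S - {e})" using insert.hyps by auto
      then show "(\<Prod>e\<in>S - {e}. w (card e)) * ?f 0 = (\<Prod>e\<in>insert x S - {e}. w (card e))"
        using insert.hyps by (simp add: mult.commute)
    qed simp
    moreover have "insert x S - {x} = S" using insert.hyps by auto
    moreover have "{e. e \<in> insert x S \<and> card e = k} =
        (if card x = k then insert x {e. e \<in> S \<and> card e = k} else {e. e \<in> S \<and> card e = k})" by auto
    ultimately show ?thesis using insert.hyps by simp
  qed
  ultimately show ?case using insert.hyps by simp
qed simp

lemma has_derivative_marked_weight:
  assumes "finite D" "finite C" "J \<notin> D"
  shows "((\<lambda>\<epsilon>. marked_weight (w(k J := w (k J) + \<epsilon>)) D k C) has_field_derivative
    marked_weight w (insert J D) k C) (at 0)"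
  unfolding marked_weight_insert[OF assms] unfolding marked_weight_def
  by (intro DERIV_sum has_derivative_prod_weight) (use assms in auto)

text \<open>Only a coefficient is differentiated, and it is a polynomial in
  \<open>\<epsilon>\<close>. In the induction \<open>P\<close> is arbitrary, so that a factor taken
  off the power can be moved into it. For \<open>N = 0\<close> the factor \<open>of_nat N\<close>
  covers the truncated exponent.\<close>

lemma has_derivative_fps_power:
  fixes P H :: "complex fps"
  shows "((\<lambda>\<epsilon>. (P * (H + fps_const \<epsilon> * fps_X ^ k) ^ N) $ n) has_field_derivative
    of_nat N * (P * fps_X ^ k * H ^ (N - 1)) $ n) (at 0)"
proof (induction N arbitrary: P)
  case (Suc N)
  let ?G = "\<lambda>\<epsilon>. H + fps_const \<epsilon> * fps_X ^ k"
  have e: "(P * ?G \<epsilon> ^ Suc N) $ n = (P * H * ?G \<epsilon> ^ N) $ n + \<epsilon> * (P * fps_X ^ k * ?G \<epsilon> ^ N) $ n" for \<epsilon>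
  proof -
    have "P * ?G \<epsilon> ^ Suc N = P * H * ?G \<epsilon> ^ N + fps_const \<epsilon> * (P * fps_X ^ k * ?G \<epsilon> ^ N)"
      by (simp add: algebra_simps)
    then show ?thesis by simp
  qed
  have "((\<lambda>\<epsilon>. (P * H * ?G \<epsilon> ^ N) $ n + \<epsilon> * (P * fps_X ^ k * ?G \<epsilon> ^ N) $ n) has_field_derivative
      of_nat N * (P * H * fps_X ^ k * H ^ (N - 1)) $ n +
      (1 * (P * fps_X ^ k * ?G 0 ^ N) $ n + (of_nat N * (P * fps_X ^ k * fps_X ^ k * H ^ (N - 1)) $ n) * 0)) (at 0)"
    by (intro DERIV_add DERIV_mult Suc.IH DERIV_ident)
  moreover have "of_nat N * (P * H * fps_X ^ k * H ^ (N - 1)) $ n = of_nat N * (P * fps_X ^ k * H ^ N) $ n"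
    by (cases N) (simp_all add: mult_ac)
  ultimately show ?case unfolding e
    by (elim back_subst[of "\<lambda>d. (_ has_field_derivative d) _"]) (simp add: algebra_simps)
qed simp

lemma weight_series_upd:
  assumes "k \<ge> 1"
  shows "weight_series (w(k := w k + \<epsilon>)) = weight_series w + fps_const \<epsilon> * fps_X ^ k"
  using assms by (intro fps_ext) (simp add: weight_series_nth fps_X_power_nth)

text \<open>Adding the mark \<open>J\<close> differentiates both sides with respect to
  \<open>w (k J)\<close>, so the induction needs the claim for all \<open>w\<close>. Each derivative
  of the power of \<open>weight_series w\<close> contributes one factor of the falling product and
  lowers the exponent by one. The factor \<open>card A + 1\<close> on the left avoids a
  division.\<close>

lemma sum_geodesic_marked_aux:
  fixes A :: "'a set"
  assumes A: "finite A" "single_cycle A \<gamma>" and D: "finite D" "\<And>I. I \<in> D \<Longrightarrow> k I \<ge> 1"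
  shows "of_nat (card A + 1) * (\<Sum>\<tau>\<in>geodesic A \<gamma>. marked_weight w D k (cycle_partition A \<tau>)) =
    of_nat (\<Prod>i<card D. card A + 1 - i) *
      (fps_X ^ (\<Sum>I\<in>D. k I) * weight_series w ^ (card A + 1 - card D)) $ card A"
  using D
proof (induction D arbitrary: w rule: finite_induct)
  case empty
  have "(\<Sum>\<tau>\<in>geodesic A \<gamma>. marked_weight w {} k (cycle_partition A \<tau>)) = cycle_series w $ card A"
    using sum_geodesic_rooted[OF A, of w]
    by (simp add: marked_weight_def marked_choices_empty cycle_weight_def)
  \<comment> \<open>Without marks this is Lagrange inversion with \<open>j = 0\<close>, and the
    derivative of \<open>fps_X * cycle_series w\<close> brings the factor
    \<open>card A + 1\<close>.\<close>
  moreover have "(weight_series w ^ (card A + 1)) $ card A = fps_deriv (fps_X * cycle_series w) $ card A"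
    using fps_lagrange[OF cycle_series_0 cycle_series_eq, of w 0 "card A"] by simp
  moreover have "fps_deriv (fps_X * cycle_series w) $ card A = of_nat (card A + 1) * cycle_series w $ card A"
    by (simp only: fps_deriv_nth fps_mult_fps_X_commute[symmetric]) simp
  ultimately show ?case by simp
next
  case (insert J D)
  let ?n = "card A" and ?K = "\<Sum>I\<in>D. k I" and ?m = "card A + 1 - card D"
  let ?w = "\<lambda>\<epsilon>. w(k J := w (k J) + \<epsilon>)"
  have kJ: "k J \<ge> 1" using insert.prems by simp
  have IH: "of_nat (?n + 1) * (\<Sum>\<tau>\<in>geodesic A \<gamma>. marked_weight (?w \<epsilon>) D k (cycle_partition A \<tau>)) =
    of_nat (\<Prod>i<card D. ?n + 1 - i) *
      (fps_X ^ ?K * (weight_series w + fps_const \<epsilon> * fps_X ^ k J) ^ ?m) $ ?n" for \<epsilon>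
    unfolding weight_series_upd[OF kJ, of w \<epsilon>, symmetric] by (rule insert.IH) (use insert.prems in auto)
  have d1: "((\<lambda>\<epsilon>. of_nat (?n + 1) * (\<Sum>\<tau>\<in>geodesic A \<gamma>. marked_weight (?w \<epsilon>) D k (cycle_partition A \<tau>)))
     has_field_derivative of_nat (?n + 1) *
       (\<Sum>\<tau>\<in>geodesic A \<gamma>. marked_weight w (insert J D) k (cycle_partition A \<tau>))) (at 0)"
    by (intro DERIV_cmult DERIV_sum has_derivative_marked_weight)
      (use insert.hyps finite_cycle_partition[OF A(1)] in auto)
  have "((\<lambda>\<epsilon>. of_nat (\<Prod>i<card D. ?n + 1 - i) *
      (fps_X ^ ?K * (weight_series w + fps_const \<epsilon> * fps_X ^ k J) ^ ?m) $ ?n) has_field_derivative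
    of_nat (\<Prod>i<card D. ?n + 1 - i) * (of_nat ?m * (fps_X ^ ?K * fps_X ^ k J * weight_series w ^ (?m - 1)) $ ?n)) (at 0)"
    by (intro DERIV_cmult has_derivative_fps_power)
  then have "of_nat (?n + 1) * (\<Sum>\<tau>\<in>geodesic A \<gamma>. marked_weight w (insert J D) k (cycle_partition A \<tau>)) =
    of_nat (\<Prod>i<card D. ?n + 1 - i) * (of_nat ?m * (fps_X ^ ?K * fps_X ^ k J * weight_series w ^ (?m - 1)) $ ?n)"
    using d1 unfolding IH by (rule DERIV_unique[rotated])
  then show ?case using insert.hyps by (simp add: power_add mult_ac)
qed

text \<open>With at least one mark the falling product starts with \<open>card A + 1\<close>, which
  cancels. As every \<open>k I\<close> is positive, the total length is at least the number of
  marks, as \<open>fps_lagrange_scaled\<close> requires.\<close>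

lemma sum_geodesic_marked:
  fixes A :: "'a set"
  assumes A: "finite A" "single_cycle A \<gamma>" and D: "finite D" "D \<noteq> {}" "\<And>I. I \<in> D \<Longrightarrow> k I \<ge> 1"
  shows "(\<Sum>\<tau>\<in>geodesic A \<gamma>. marked_weight w D k (cycle_partition A \<tau>)) =
    of_nat (\<Prod>i<card D - 1. card A - i) *
      (fps_deriv (fps_X * cycle_series w) * (fps_X * cycle_series w) ^ (\<Sum>I\<in>D. k I)
        * inverse (cycle_series w) ^ card D) $ card A"
proof -
  have d: "card D \<ge> 1" using D by (simp add: Suc_leI card_gt_0_iff)
  have "card D \<le> (\<Sum>I\<in>D. k I)" using sum_mono[of D "\<lambda>_. 1" k] D by simp
  from fps_lagrange_scaled[OF cycle_series_0 cycle_series_eq this d]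
  have e: "(fps_deriv (fps_X * cycle_series w) * (fps_X * cycle_series w) ^ (\<Sum>I\<in>D. k I)
        * inverse (cycle_series w) ^ card D) $ card A =
      (fps_X ^ (\<Sum>I\<in>D. k I) * weight_series w ^ (card A + 1 - card D)) $ card A" .
  have "(\<Prod>i<card D. card A + 1 - i) = (\<Prod>i<Suc (card D - 1). card A + 1 - i)" using d by simp
  also have "\<dots> = (card A + 1) * (\<Prod>i<card D - 1. card A - i)" by (subst prod.lessThan_Suc_shift) simp
  finally have p: "(\<Prod>i<card D. card A + 1 - i) = (card A + 1) * (\<Prod>i<card D - 1. card A - i)" .
  have "of_nat (card A + 1) * (\<Sum>\<tau>\<in>geodesic A \<gamma>. marked_weight w D k (cycle_partition A \<tau>)) =
      of_nat (card A + 1) * (of_nat (\<Prod>i<card D - 1. card A - i) *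
      (fps_X ^ (\<Sum>I\<in>D. k I) * weight_series w ^ (card A + 1 - card D)) $ card A)"
    using sum_geodesic_marked_aux[OF A D(1,3), where w = w] unfolding p by (simp only: of_nat_mult mult.assoc)
  then show ?thesis unfolding e by (simp only: mult_cancel_left of_nat_eq_0_iff) simp
qed

section \<open>Coefficients of multivariate series\<close>

lemma mfps_coeff_simps [simp]:
  "mfps_coeff 0 m = 0" "mfps_coeff 1 m = (if m = {#} then 1 else 0)"
  "mfps_coeff (f + g) m = mfps_coeff f m + mfps_coeff g m"
  by (simp_all add: zero_mfps_def one_mfps_def plus_mfps_def)

lemma mfps_coeff_mult:
  "mfps_coeff (f * g) m = (\<Sum>a | a \<subseteq># m. mfps_coeff f a * mfps_coeff g (m - a))"
  by (simp add: times_mfps_def)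

lemma mfps_coeff_sum: "mfps_coeff (sum F S) m = (\<Sum>x\<in>S. mfps_coeff (F x) m)"
  by (induction S rule: infinite_finite_induct) auto

definition mfps_const :: "'a \<Rightarrow> ('v, 'a::comm_ring_1) mfps" where
  "mfps_const c = Abs_mfps (\<lambda>m. if m = {#} then c else 0)"

text \<open>A ring homomorphism compatible with derivatives and with inverses of units; it carries
  one-variable results over to \<open>B1_at\<close> and \<open>Y_series\<close>.\<close>

definition mfps_of_fps :: "'v \<Rightarrow> 'a::comm_ring_1 fps \<Rightarrow> ('v, 'a) mfps" where
  "mfps_of_fps i f = Abs_mfps (\<lambda>m. if set_mset m \<subseteq> {i} then f $ count m i else 0)"

lemma mfps_coeff_of_fps: "mfps_coeff (mfps_of_fps i f) m = (if set_mset m \<subseteq> {i} then f $ count m i else 0)"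
  by (simp add: mfps_of_fps_def)

lemma mfps_coeff_const_mult: "mfps_coeff (mfps_const c * f) m = c * mfps_coeff f m"
proof -
  have "mfps_coeff (mfps_const c * f) m = (\<Sum>a | a \<subseteq># m. if a = {#} then c * mfps_coeff f (m - a) else 0)"
    unfolding mfps_coeff_mult by (intro sum.cong) (auto simp: mfps_const_def)
  then show ?thesis by (simp add: finite_submultisets)
qed

lemma mfps_const_mult: "mfps_const (a * b) = mfps_const a * mfps_const b"
  by (rule mfps_eqI, subst mfps_coeff_const_mult) (simp add: mfps_const_def)

lemma mfps_const_prod: "mfps_const (prod F S) = (\<Prod>x\<in>S. mfps_const (F x))"
proof (induction S rule: infinite_finite_induct)
  case (insert x S) then show ?case by (simp add: mfps_const_mult)
qed (simp_all add: mfps_const_def one_mfps_def)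

lemma mset_eq_replicate_iff: "set_mset a \<subseteq> {i} \<longleftrightarrow> a = replicate_mset (count a i) i"
proof
  assume "set_mset a \<subseteq> {i}"
  then show "a = replicate_mset (count a i) i"
    by (intro multiset_eqI) (auto simp: count_eq_zero_iff)
next
  assume "a = replicate_mset (count a i) i"
  then show "set_mset a \<subseteq> {i}" by (metis set_mset_replicate_mset_subset empty_subsetI subset_refl)
qed

lemma submultisets_replicate: "{a. a \<subseteq># replicate_mset n i} = (\<lambda>k. replicate_mset k i) ` {0..n}"
proof (intro equalityI subsetI)
  fix a assume "a \<in> {a. a \<subseteq># replicate_mset n i}"
  then have a: "a \<subseteq># replicate_mset n i" by simp
  then have "set_mset a \<subseteq> {i}" using set_mset_mono[OF a] by (auto split: if_splits)
  then have "a = replicate_mset (count a i) i" by (simp only: mset_eq_replicate_iff)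
  moreover have "count a i \<le> n" using mset_subset_eq_count[OF a, of i] by simp
  ultimately show "a \<in> (\<lambda>k. replicate_mset k i) ` {0..n}" by auto
qed (auto intro!: mset_subset_eqI)

lemma inj_replicate: "inj_on (\<lambda>k. replicate_mset k i) S"
  by (rule inj_onI) (metis size_replicate_mset)

lemma mfps_of_fps_mult: "mfps_of_fps i (f * g) = mfps_of_fps i f * mfps_of_fps i g"
proof (rule mfps_eqI)
  fix m :: "'a multiset"
  show "mfps_coeff (mfps_of_fps i (f * g)) m = mfps_coeff (mfps_of_fps i f * mfps_of_fps i g) m"
  proof (cases "set_mset m \<subseteq> {i}")
    case True
    define n where "n = count m i"
    have m: "m = replicate_mset n i" using True unfolding n_def by (simp only: mset_eq_replicate_iff)
    have rm: "replicate_mset n i - replicate_mset k i = replicate_mset (n - k) i" for k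
      by (intro multiset_eqI) simp
    have "mfps_coeff (mfps_of_fps i f * mfps_of_fps i g) m = (\<Sum>k=0..n. f $ k * g $ (n - k))"
      unfolding m mfps_coeff_mult submultisets_replicate
      by (subst sum.reindex[OF inj_replicate]) (auto simp: mfps_coeff_of_fps rm intro!: sum.cong)
    then show ?thesis using True by (simp add: mfps_coeff_of_fps fps_mult_nth n_def)
  next
    case False
    have "mfps_coeff (mfps_of_fps i f) a * mfps_coeff (mfps_of_fps i g) (m - a) = 0" if "a \<subseteq># m" for a
    proof -
      have "set_mset m \<subseteq> set_mset a \<union> set_mset (m - a)"
        using that by (metis set_mset_union subset_mset.add_diff_inverse subset_refl)
      then have "\<not> set_mset a \<subseteq> {i} \<or> \<not> set_mset (m - a) \<subseteq> {i}" using False by blast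
      then show ?thesis by (auto simp: mfps_coeff_of_fps)
    qed
    then show ?thesis using False unfolding mfps_coeff_mult by (simp add: mfps_coeff_of_fps)
  qed
qed

lemma mfps_of_fps_1 [simp]: "mfps_of_fps i 1 = 1"
  by (rule mfps_eqI) (auto simp: mfps_coeff_of_fps count_eq_zero_iff)

lemma mfps_of_fps_power: "mfps_of_fps i (f ^ n) = mfps_of_fps i f ^ n"
  by (induction n) (simp_all add: mfps_of_fps_mult)

lemma mfps_of_fps_prod: "mfps_of_fps i (prod F S) = (\<Prod>x\<in>S. mfps_of_fps i (F x))"
  by (induction S rule: infinite_finite_induct) (simp_all add: mfps_of_fps_mult)

lemma mfps_of_fps_X: "mfps_of_fps i fps_X = mfps_X i"
proof (rule mfps_eqI)
  fix m :: "'a multiset"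
  have "set_mset m \<subseteq> {i} \<and> count m i = 1 \<longleftrightarrow> m = {#i#}"
    using mset_eq_replicate_iff[of m i] by auto
  then show "mfps_coeff (mfps_of_fps i fps_X) m = mfps_coeff (mfps_X i) m"
    by (auto simp: mfps_coeff_of_fps mfps_X_def fps_X_def)
qed

lemma mfps_of_fps_deriv: "mfps_deriv i (mfps_of_fps i f) = mfps_of_fps i (fps_deriv f)"
  by (rule mfps_eqI) (auto simp: mfps_deriv_def mfps_coeff_of_fps)

lemma mfps_inverse_unique:
  fixes f :: "('v, 'a::field) mfps"
  assumes "f * g = 1" shows "inverse f = g"
proof -
  have "mfps_coeff (f * g) {#} = mfps_coeff f {#} * mfps_coeff g {#}"
    by (simp add: mfps_coeff_mult)
  then have "mfps_coeff f {#} \<noteq> 0" using assms by auto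
  then have "f * inverse f = 1" by (rule mfps_right_inverse)
  then have "inverse f * (f * g) = g" by (simp add: mult.assoc[symmetric] mult.commute[of "inverse f"])
  then show ?thesis using assms by simp
qed

lemma mfps_inverse_prod_of_fps:
  fixes f :: "'v \<Rightarrow> 'a::field fps"
  assumes "\<And>i. i \<in> S \<Longrightarrow> f i $ 0 \<noteq> 0"
  shows "inverse (\<Prod>i\<in>S. mfps_of_fps i (f i)) = (\<Prod>i\<in>S. mfps_of_fps i (inverse (f i)))"
proof (rule mfps_inverse_unique)
  have "(\<Prod>i\<in>S. mfps_of_fps i (f i)) * (\<Prod>i\<in>S. mfps_of_fps i (inverse (f i))) =
      (\<Prod>i\<in>S. mfps_of_fps i (f i * inverse (f i)))"
    by (simp add: prod.distrib mfps_of_fps_mult)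
  also have "\<dots> = (\<Prod>i\<in>S. 1)"
  proof (rule prod.cong)
    fix i assume "i \<in> S"
    then have "f i * inverse (f i) = 1" using assms by (intro inverse_mult_eq_1')
    then show "mfps_of_fps i (f i * inverse (f i)) = 1" by simp
  qed simp
  finally show "(\<Prod>i\<in>S. mfps_of_fps i (f i)) * (\<Prod>i\<in>S. mfps_of_fps i (inverse (f i))) = 1" by simp
qed

lemma mfps_coeff_prod_of_fps:
  fixes f :: "'v \<Rightarrow> 'a::comm_ring_1 fps"
  assumes "finite V"
  shows "mfps_coeff (\<Prod>i\<in>V. mfps_of_fps i (f i)) m =
    (if set_mset m \<subseteq> V then \<Prod>i\<in>V. f i $ count m i else 0)"
  using assms
proof (induction V arbitrary: m rule: finite_induct)
  case empty then show ?case by simp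
next
  case (insert x V)
  let ?G = "\<Prod>i\<in>V. mfps_of_fps i (f i)"
  \<comment> \<open>The variable \<open>x\<close> comes from the first factor only, and no other
    variable does; so a single splitting of \<open>m\<close> contributes.\<close>
  define r where "r = replicate_mset (count m x) x"
  have r: "r \<subseteq># m" by (auto simp: r_def intro!: mset_subset_eqI)
  have zero: "mfps_coeff (mfps_of_fps x (f x)) a * mfps_coeff ?G (m - a) = 0" if "a \<subseteq># m" "a \<noteq> r" for a
  proof (rule ccontr)
    assume "\<not> ?thesis"
    then have nz: "mfps_coeff (mfps_of_fps x (f x)) a \<noteq> 0" "mfps_coeff ?G (m - a) \<noteq> 0" by auto
    then have "set_mset a \<subseteq> {x}" "set_mset (m - a) \<subseteq> V"
      unfolding insert.IH by (auto simp: mfps_coeff_of_fps split: if_splits)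
    then have "a = replicate_mset (count a x) x" "x \<notin># m - a"
      using iffD1[OF mset_eq_replicate_iff, of a x] insert.hyps by auto
    moreover have "count a x = count m x"
      using \<open>x \<notin># m - a\<close> mset_subset_eq_count[OF that(1), of x] by (simp add: in_diff_count)
    ultimately show False using that(2) by (simp add: r_def)
  qed
  have "mfps_coeff (mfps_of_fps x (f x) * ?G) m = mfps_coeff (mfps_of_fps x (f x)) r * mfps_coeff ?G (m - r)"
    unfolding mfps_coeff_mult using r zero finite_submultisets[of m]
    by (subst sum.remove[of _ r]) (auto intro!: sum.neutral)
  also have "\<dots> = (if set_mset m \<subseteq> insert x V then \<Prod>i\<in>insert x V. f i $ count m i else 0)"
  proof -
    have "set_mset (m - r) = set_mset m - {x}"
    proof (rule set_eqI)
      fix y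
      have "count (m - r) y = (if y = x then 0 else count m y)" by (simp add: r_def)
      then show "y \<in># m - r \<longleftrightarrow> y \<in> set_mset m - {x}"
        by (cases "y = x") (simp_all add: not_in_iff count_greater_zero_iff[symmetric] del: count_greater_zero_iff)
    qed
    then have "set_mset (m - r) \<subseteq> V \<longleftrightarrow> set_mset m \<subseteq> insert x V" by auto
    moreover have "(\<Prod>i\<in>V. f i $ count (m - r) i) = (\<Prod>i\<in>V. f i $ count m i)"
      using insert.hyps by (intro prod.cong) (auto simp: r_def)
    moreover have "set_mset r \<subseteq> {x}" "count r x = count m x" by (auto simp: r_def)
    ultimately show ?thesis using insert.hyps unfolding insert.IH by (simp add: mfps_coeff_of_fps)
  qed
  finally show ?case using insert.hyps by simp
qed

lemma mfps_coeff_X_mult: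
  "mfps_coeff (mfps_X i * f) m = (if i \<in># m then mfps_coeff f (m - {#i#}) else 0)"
proof -
  have "mfps_coeff (mfps_X i * f) m = (\<Sum>a | a \<subseteq># m. if a = {#i#} then mfps_coeff f (m - a) else 0)"
    unfolding mfps_coeff_mult by (intro sum.cong) (auto simp: mfps_X_def)
  also have "\<dots> = (if {#i#} \<subseteq># m then mfps_coeff f (m - {#i#}) else 0)"
    by (simp add: finite_submultisets)
  finally show ?thesis by simp
qed

text \<open>The operator is diagonal on monomials. The eigenvalue is a falling factorial, which also
  with truncated subtraction vanishes when the exponent is less than \<open>e\<close>.\<close>

lemma mfps_coeff_X_power_deriv:
  "mfps_coeff (mfps_X i ^ e * (mfps_deriv i ^^ e) f) m =
    of_nat (\<Prod>t<e. count m i - t) * mfps_coeff f m"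
proof (induction e arbitrary: f m)
  case (Suc e)
  have "mfps_X i ^ Suc e * (mfps_deriv i ^^ Suc e) f =
      mfps_X i * (mfps_X i ^ e * (mfps_deriv i ^^ e) (mfps_deriv i f))"
    by (simp add: funpow_swap1 mult.assoc)
  then have *: "mfps_coeff (mfps_X i ^ Suc e * (mfps_deriv i ^^ Suc e) f) m =
      (if i \<in># m then of_nat (\<Prod>t<e. count m i - 1 - t) * mfps_coeff (mfps_deriv i f) (m - {#i#}) else 0)"
    by (simp only: mfps_coeff_X_mult Suc.IH count_diff count_single if_True refl)
  show ?case
  proof (cases "i \<in># m")
    case True
    then have "mfps_coeff (mfps_deriv i f) (m - {#i#}) = of_nat (count m i) * mfps_coeff f m"
      by (simp add: mfps_deriv_def)
    moreover have "(\<Prod>t<Suc e. count m i - t) = count m i * (\<Prod>t<e. count m i - 1 - t)"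
      by (subst prod.lessThan_Suc_shift) simp
    ultimately show ?thesis using True unfolding * by simp
  next
    case False
    then have "(\<Prod>t<Suc e. count m i - t) = 0"
      by (subst prod.lessThan_Suc_shift) (simp add: not_in_iff)
    then show ?thesis using False unfolding * by (simp only: if_False of_nat_0 mult_zero_left)
  qed
qed simp

text \<open>Positive degrees keep \<open>diff_op\<close> away from its antiderivative branch, so
  every operator is diagonal.\<close>

lemma mfps_coeff_diff_ops:
  assumes "\<And>i. i \<in> {1..p} \<Longrightarrow> d i \<ge> 1"
  shows "mfps_coeff (diff_ops p d F) m =
    of_nat (\<Prod>i\<in>{1..p}. \<Prod>t<d i - 1. count m i - t) * mfps_coeff F m"
proof -
  have *: "mfps_coeff (foldr (\<lambda>i. diff_op i (d i)) xs F) m =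
      of_nat (\<Prod>i\<leftarrow>xs. \<Prod>t<d i - 1. count m i - t) * mfps_coeff F m" if "\<And>i. i \<in> set xs \<Longrightarrow> d i \<ge> 1" for xs
    using that
  proof (induction xs)
    case (Cons x xs)
    have "d x \<ge> 1" using Cons.prems by simp
    then have "diff_op x (d x) G = mfps_X x ^ (d x - 1) * (mfps_deriv x ^^ (d x - 1)) G" for G :: "(nat, complex) mfps"
      by (simp add: diff_op_def)
    then show ?case using Cons by (simp add: mfps_coeff_X_power_deriv)
  qed simp
  have "(\<Prod>i\<leftarrow>[1..<p+1]. \<Prod>t<d i - 1. count m i - t) = (\<Prod>i\<in>{1..p}. \<Prod>t<d i - 1. count m i - t)"
    by (subst prod.distinct_set_conv_list[symmetric]) (auto intro!: prod.cong)
  then show ?thesis unfolding diff_ops_def using assms by (subst *) auto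
qed

text \<open>A coefficient of a substitution involves only finitely many exponents, so modulo terms of large
  degree the sums over exponents are finite.\<close>

definition agree :: "nat \<Rightarrow> ('v, 'a) mfps \<Rightarrow> ('v, 'a) mfps \<Rightarrow> bool" where
  "agree N f g \<longleftrightarrow> (\<forall>m. size m \<le> N \<longrightarrow> mfps_coeff f m = mfps_coeff g m)"

lemma agree_refl [simp]: "agree N f f" by (simp add: agree_def)

lemma agree_mult:
  fixes f g :: "('v, 'a::comm_ring_1) mfps"
  assumes "agree N f f'" "agree N g g'" shows "agree N (f * g) (f' * g')"
  unfolding agree_def mfps_coeff_mult
proof (intro allI impI sum.cong refl)
  fix m a :: "'v multiset" assume "size m \<le> N" "a \<in> {a. a \<subseteq># m}"
  moreover from this have "size a \<le> N" "size (m - a) \<le> N"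
    using size_mset_mono[of a m] size_mset_mono[of "m - a" m] by auto
  ultimately show "mfps_coeff f a * mfps_coeff g (m - a) = mfps_coeff f' a * mfps_coeff g' (m - a)"
    using assms by (simp add: agree_def)
qed

lemma agree_prod:
  fixes F G :: "'i \<Rightarrow> ('v, 'a::comm_ring_1) mfps"
  assumes "\<And>i. i \<in> S \<Longrightarrow> agree N (F i) (G i)" shows "agree N (prod F S) (prod G S)"
  using assms by (induction S rule: infinite_finite_induct) (auto intro: agree_mult)

lemma mfps_subst_X:
  fixes f :: "'a::comm_ring_1 fps" and i :: 'w and j :: 'v
  shows "mfps_subst (\<lambda>_. mfps_X i) (mfps_of_fps j f) = mfps_of_fps i f"
proof (rule mfps_eqI)
  fix m :: "'w multiset"
  let ?t = "\<lambda>k. mfps_coeff (mfps_of_fps j f) k * mfps_coeff (\<Prod>\<^sub># (image_mset (\<lambda>_. mfps_X i) k)) m"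
  have prod: "\<Prod>\<^sub># (image_mset (\<lambda>_. mfps_X i) k) = (mfps_of_fps i (fps_X ^ size k) :: ('w, 'a) mfps)" for k :: "'v multiset"
    by (simp add: mfps_of_fps_power mfps_of_fps_X)
  \<comment> \<open>A power of \<open>mfps_X i\<close> determines its exponent, so only this
    monomial can contribute.\<close>
  let ?r = "replicate_mset (count m i) j"
  have nz: "k = ?r" if "?t k \<noteq> 0" for k
  proof -
    have "set_mset k \<subseteq> {j}" "count m i = size k"
      using that unfolding prod by (auto simp: mfps_coeff_of_fps fps_X_power_nth split: if_splits)
    then have "k = replicate_mset (count k j) j" by (simp only: mset_eq_replicate_iff)
    moreover from this have "size k = count k j" by (metis size_replicate_mset)
    ultimately show ?thesis using \<open>count m i = size k\<close> by simp
  qed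
  have "Sum_any ?t = (\<Sum>k\<in>{?r}. ?t k)"
    by (rule Sum_any.expand_superset) (use nz in auto)
  also have "\<dots> = mfps_coeff (mfps_of_fps i f) m"
    unfolding prod by (auto simp: mfps_coeff_of_fps fps_X_power_nth)
  finally show "mfps_coeff (mfps_subst (\<lambda>_. mfps_X i) (mfps_of_fps j f)) m = mfps_coeff (mfps_of_fps i f) m"
    by (simp add: mfps_subst_def)
qed

lemma mfps_coeff_gen_series:
  assumes "p \<noteq> 1"
  shows "mfps_coeff (gen_series a p) m = (if set_mset m = {1..p} then a (map (count m) [1..<p + 1]) else 0)"
  using assms by (simp add: gen_series_def)

text \<open>As no \<open>Y i\<close> has a constant term, a monomial of size above \<open>N\<close>
  yields only terms of degree above \<open>N\<close>; so exponents up to \<open>N\<close> suffice.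
  The condition on \<open>card I\<close> excludes the constant \<open>1\<close> of
  \<open>gen_series\<close>.\<close>

lemma agree_subst_gen_series:
  fixes Y :: "nat \<Rightarrow> ('w, complex) mfps" and I :: "nat set"
  assumes I: "finite I" "card I \<noteq> 1" and Y: "\<And>i. i \<in> I \<Longrightarrow> mfps_coeff (Y i) {#} = 0"
  shows "agree N (mfps_subst (\<lambda>j. Y (sorted_list_of_set I ! (j - 1))) (gen_series a (card I)))
    (\<Sum>k\<in>I \<rightarrow>\<^sub>E {1..N}. mfps_const (a (map k (sorted_list_of_set I))) * (\<Prod>i\<in>I. Y i ^ k i))"
  unfolding agree_def
proof (intro allI impI)
  fix m :: "'w multiset" assume m: "size m \<le> N"
  let ?q = "card I" and ?s = "sorted_list_of_set I"
  define e where "e j = ?s ! (j - 1)" for j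
  have len: "length ?s = ?q" using I by simp
  have "bij_betw (\<lambda>j. ?s ! j) {..<?q} I"
    using bij_betw_nth[of ?s "{..<?q}" I] I len by simp
  moreover have "bij_betw (\<lambda>j::nat. j - 1) {1..?q} {..<?q}"
    by (rule bij_betw_byWitness[where f' = Suc]) auto
  ultimately have e: "bij_betw e {1..?q} I"
    unfolding e_def using bij_betw_trans[of "\<lambda>j. j - 1" _ _ "\<lambda>j. ?s ! j"] by (simp add: comp_def)
  have eI: "e j \<in> I" if "j \<in> {1..?q}" for j using e that by (auto simp: bij_betw_def)
  have eS: "\<exists>j\<in>{1..?q}. i = e j" if "i \<in> I" for i
    using e that unfolding bij_betw_def by blast
  \<comment> \<open>The exponents on \<open>I\<close> are moved to the variables
    \<open>1..?q\<close> along the increasing enumeration \<open>e\<close> of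
    \<open>I\<close>.\<close>
  define M where "M k = (\<Sum>j\<in>{1..?q}. replicate_mset (k (e j)) j)" for k :: "nat \<Rightarrow> nat"
  have countM: "count (M k) j = (if j \<in> {1..?q} then k (e j) else 0)" for k j
    by (simp add: M_def count_sum)
  let ?P = "I \<rightarrow>\<^sub>E {1..N}"
  have setM: "set_mset (M k) = {1..?q}" if "k \<in> ?P" for k
  proof -
    have "k (e j) \<noteq> 0" if "j \<in> {1..?q}" for j using \<open>k \<in> ?P\<close> eI[OF that] by (auto simp: PiE_iff)
    then show ?thesis using countM[of k] by (auto simp: set_mset_def split: if_splits)
  qed
  have mapM: "map (count (M k)) [1..<?q + 1] = map k ?s" for k
    by (rule nth_equalityI) (auto simp: countM len e_def simp del: upt_Suc)
  let ?t = "\<lambda>\<kappa>. mfps_coeff (gen_series a ?q) \<kappa> * mfps_coeff (\<Prod>\<^sub># (image_mset (\<lambda>j. Y (e j)) \<kappa>)) m"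
  have injM: "inj_on M ?P"
  proof (rule inj_onI)
    fix k k' assume k: "k \<in> ?P" "k' \<in> ?P" "M k = M k'"
    show "k = k'"
    proof (rule PiE_ext[OF k(1,2)])
      fix i assume "i \<in> I"
      then obtain j where "j \<in> {1..?q}" "i = e j" using eS by blast
      then show "k i = k' i" using countM[of k j] countM[of k' j] k(3) by simp
    qed
  qed
  have "\<kappa> \<in> M ` ?P" if nz: "?t \<kappa> \<noteq> 0" for \<kappa>
  proof -
    have \<kappa>: "set_mset \<kappa> = {1..?q}"
      using nz mfps_coeff_gen_series[OF I(2)] by (auto split: if_splits)
    have "\<not> size m < size \<kappa>"
      using nz mfps_coeff_prod_eq_0[of \<kappa> "\<lambda>j. Y (e j)" m] Y eI \<kappa> by auto
    then have size: "size \<kappa> \<le> N" using m by simp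
    define k where "k = (\<lambda>i\<in>I. count \<kappa> (inv_into {1..?q} e i))"
    have inv: "inv_into {1..?q} e (e j) = j" if "j \<in> {1..?q}" for j
      using e that by (auto simp: bij_betw_def)
    have "\<kappa> = M k"
      by (rule multiset_eqI) (use \<kappa> eI inv in \<open>auto simp: countM k_def not_in_iff\<close>)
    moreover have "k \<in> ?P"
    proof (rule PiE_I)
      fix i assume "i \<in> I"
      then obtain j where j: "j \<in> {1..?q}" "i = e j" using eS by blast
      then have "k i = count \<kappa> j" using inv eI by (simp add: k_def)
      moreover have "count \<kappa> j \<ge> 1" using j \<kappa> by (metis count_greater_eq_one_iff)
      moreover have "count \<kappa> j \<le> N" using count_le_size[of \<kappa> j] size by simp
      ultimately show "k i \<in> {1..N}" by simp
    qed (simp add: k_def)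
    ultimately show ?thesis by blast
  qed
  then have "Sum_any ?t = (\<Sum>\<kappa>\<in>M ` ?P. ?t \<kappa>)"
    using I by (intro Sum_any.expand_superset finite_imageI finite_PiE) auto
  also have "\<dots> = (\<Sum>k\<in>?P. ?t (M k))" by (subst sum.reindex[OF injM]) (simp only: comp_def)
  also have "\<dots> = (\<Sum>k\<in>?P. mfps_coeff (mfps_const (a (map k ?s)) * (\<Prod>i\<in>I. Y i ^ k i)) m)"
  proof (rule sum.cong)
    fix k assume k: "k \<in> ?P"
    have "\<Prod>\<^sub># (image_mset (\<lambda>j. Y (e j)) (M k)) = (\<Prod>j\<in>{1..?q}. Y (e j) ^ k (e j))"
      unfolding image_prod_mset_multiplicity setM[OF k] by (intro prod.cong) (auto simp: countM)
    also have "\<dots> = (\<Prod>i\<in>I. Y i ^ k i)" by (rule prod.reindex_bij_betw[OF e])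
    finally show "?t (M k) = mfps_coeff (mfps_const (a (map k ?s)) * (\<Prod>i\<in>I. Y i ^ k i)) m"
      by (simp only: mfps_coeff_gen_series[OF I(2)] setM[OF k] mapM mfps_coeff_const_mult if_True simp_thms)
  qed simp
  finally show "mfps_coeff (mfps_subst (\<lambda>j. Y (sorted_list_of_set I ! (j - 1))) (gen_series a (card I))) m =
    mfps_coeff (\<Sum>k\<in>I \<rightarrow>\<^sub>E {1..N}. mfps_const (a (map k (sorted_list_of_set I))) * (\<Prod>i\<in>I. Y i ^ k i)) m"
    by (simp add: mfps_subst_def e_def mfps_coeff_sum)
qed

text \<open>A double product over incidences, given by black vertices, is regrouped by white
  vertices. Each \<open>i\<close> collects the powers of its own \<open>y\<close> and one inverse of
  \<open>b\<close> per neighbour. Different white vertices have different variables, so the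
  coefficient is a product over \<open>V\<close>.\<close>

lemma mfps_coeff_tree_product:
  fixes V :: "'v set" and T :: "'v set set" and b y :: "complex fps"
  assumes V: "finite V" and T: "finite T" "\<And>I. I \<in> T \<Longrightarrow> I \<subseteq> V" and b: "b $ 0 \<noteq> 0"
    and H: "\<And>I. I \<in> T \<Longrightarrow> agree (size m) (H I)
      (\<Sum>k\<in>I \<rightarrow>\<^sub>E {1..size m}. mfps_const (a I k) * (\<Prod>i\<in>I. mfps_of_fps i y ^ k i))"
  shows "mfps_coeff ((\<Prod>i\<in>V. mfps_deriv i (mfps_of_fps i y)) *
      (\<Prod>I\<in>T. H I * inverse (\<Prod>i\<in>I. mfps_of_fps i b))) m =
    (\<Sum>k\<in>PiE T (\<lambda>I. I \<rightarrow>\<^sub>E {1..size m}). (\<Prod>I\<in>T. a I (k I)) *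
      (if set_mset m \<subseteq> V then \<Prod>i\<in>V. (fps_deriv y * y ^ (\<Sum>I | I \<in> T \<and> i \<in> I. k I i)
        * inverse b ^ card {I \<in> T. i \<in> I}) $ count m i else 0))"
proof -
  let ?N = "size m" and ?\<phi> = "mfps_of_fps :: 'v \<Rightarrow> complex fps \<Rightarrow> ('v, complex) mfps"
  let ?D = "\<Prod>i\<in>V. ?\<phi> i (fps_deriv y)"
  have fin: "finite I" if "I \<in> T" for I using T(2)[OF that] V finite_subset by blast
  let ?G = "\<lambda>I k. mfps_const (a I k) * (\<Prod>i\<in>I. ?\<phi> i (y ^ k i * inverse b))"
  have "agree ?N ((\<Prod>i\<in>V. mfps_deriv i (?\<phi> i y)) * (\<Prod>I\<in>T. H I * inverse (\<Prod>i\<in>I. ?\<phi> i b)))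
    (?D * (\<Prod>I\<in>T. \<Sum>k\<in>I \<rightarrow>\<^sub>E {1..?N}. ?G I k))"
  proof (rule agree_mult)
    show "agree ?N (\<Prod>i\<in>V. mfps_deriv i (?\<phi> i y)) ?D" by (simp add: mfps_of_fps_deriv)
    show "agree ?N (\<Prod>I\<in>T. H I * inverse (\<Prod>i\<in>I. ?\<phi> i b)) (\<Prod>I\<in>T. \<Sum>k\<in>I \<rightarrow>\<^sub>E {1..?N}. ?G I k)"
    proof (rule agree_prod)
      fix I assume I: "I \<in> T"
      have "agree ?N (H I * inverse (\<Prod>i\<in>I. ?\<phi> i b))
        ((\<Sum>k\<in>I \<rightarrow>\<^sub>E {1..?N}. mfps_const (a I k) * (\<Prod>i\<in>I. ?\<phi> i y ^ k i)) * (\<Prod>i\<in>I. ?\<phi> i (inverse b)))"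
        using H[OF I] b by (intro agree_mult) (simp_all add: mfps_inverse_prod_of_fps)
      also have "(\<Sum>k\<in>I \<rightarrow>\<^sub>E {1..?N}. mfps_const (a I k) * (\<Prod>i\<in>I. ?\<phi> i y ^ k i)) * (\<Prod>i\<in>I. ?\<phi> i (inverse b)) =
        (\<Sum>k\<in>I \<rightarrow>\<^sub>E {1..?N}. ?G I k)"
        by (simp add: sum_distrib_right prod.distrib mfps_of_fps_mult mfps_of_fps_power mult.assoc)
      finally show "agree ?N (H I * inverse (\<Prod>i\<in>I. ?\<phi> i b)) (\<Sum>k\<in>I \<rightarrow>\<^sub>E {1..?N}. ?G I k)" .
    qed
  qed
  then have "mfps_coeff ((\<Prod>i\<in>V. mfps_deriv i (?\<phi> i y)) * (\<Prod>I\<in>T. H I * inverse (\<Prod>i\<in>I. ?\<phi> i b))) m =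
      mfps_coeff (?D * (\<Prod>I\<in>T. \<Sum>k\<in>I \<rightarrow>\<^sub>E {1..?N}. ?G I k)) m"
    by (simp add: agree_def)
  also have "(\<Prod>I\<in>T. \<Sum>k\<in>I \<rightarrow>\<^sub>E {1..?N}. ?G I k) = (\<Sum>k\<in>PiE T (\<lambda>I. I \<rightarrow>\<^sub>E {1..?N}). \<Prod>I\<in>T. ?G I (k I))"
    by (rule prod_sum_PiE) (use T fin in \<open>auto intro: finite_PiE\<close>)
  also have "?D * \<dots> = (\<Sum>k\<in>PiE T (\<lambda>I. I \<rightarrow>\<^sub>E {1..?N}). mfps_const (\<Prod>I\<in>T. a I (k I)) *
      (\<Prod>i\<in>V. ?\<phi> i (fps_deriv y * y ^ (\<Sum>I | I \<in> T \<and> i \<in> I. k I i) * inverse b ^ card {I \<in> T. i \<in> I})))"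
    unfolding sum_distrib_left
  proof (rule sum.cong)
    fix k
    have "(\<Prod>I\<in>T. \<Prod>i\<in>I. ?\<phi> i (y ^ k I i * inverse b)) =
        (\<Prod>I\<in>T. \<Prod>i\<in>{i\<in>V. i \<in> I}. ?\<phi> i (y ^ k I i * inverse b))"
      using T(2) by (intro prod.cong) auto
    also have "\<dots> = (\<Prod>i\<in>V. \<Prod>I | I \<in> T \<and> i \<in> I. ?\<phi> i (y ^ k I i * inverse b))"
      by (rule prod.swap_restrict) (use V T in auto)
    also have "\<dots> = (\<Prod>i\<in>V. ?\<phi> i (y ^ (\<Sum>I | I \<in> T \<and> i \<in> I. k I i) * inverse b ^ card {I \<in> T. i \<in> I}))"
      by (simp add: mfps_of_fps_prod[symmetric] prod.distrib power_sum)
    finally have "(\<Prod>I\<in>T. ?G I (k I)) = mfps_const (\<Prod>I\<in>T. a I (k I)) *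
        (\<Prod>i\<in>V. ?\<phi> i (y ^ (\<Sum>I | I \<in> T \<and> i \<in> I. k I i) * inverse b ^ card {I \<in> T. i \<in> I}))"
      by (simp only: prod.distrib mfps_const_prod)
    then show "?D * (\<Prod>I\<in>T. ?G I (k I)) = mfps_const (\<Prod>I\<in>T. a I (k I)) *
      (\<Prod>i\<in>V. ?\<phi> i (fps_deriv y * y ^ (\<Sum>I | I \<in> T \<and> i \<in> I. k I i) * inverse b ^ card {I \<in> T. i \<in> I}))"
      by (simp only: mfps_of_fps_mult prod.distrib) (simp only: mult_ac)
  qed simp
  finally show ?thesis
    by (simp only: mfps_coeff_sum mfps_coeff_const_mult mfps_coeff_prod_of_fps[OF V])
qed

section \<open>Hypertrees\<close>

text \<open>Connectedness is phrased by closed sets instead of paths, since the proofs either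
  exhibit a closed set or let a set grow until it is closed.\<close>

definition hyper_connected :: "'v set \<Rightarrow> 'v set set \<Rightarrow> bool" where
  "hyper_connected V \<I> \<longleftrightarrow>
    (\<forall>U\<subseteq>V. U \<noteq> {} \<and> (\<forall>I\<in>\<I>. I \<inter> U \<noteq> {} \<longrightarrow> I \<subseteq> U) \<longrightarrow> U = V)"

lemma hyper_connectedD:
  assumes "hyper_connected V \<I>" "U \<subseteq> V" "U \<noteq> {}" "\<And>I. I \<in> \<I> \<Longrightarrow> I \<inter> U \<noteq> {} \<Longrightarrow> I \<subseteq> U"
  shows "U = V"
  using assms unfolding hyper_connected_def by blast

lemma hyper_connectedI:
  assumes "\<And>U. U \<subseteq> V \<Longrightarrow> U \<noteq> {} \<Longrightarrow> (\<And>I. I \<in> \<I> \<Longrightarrow> I \<inter> U \<noteq> {} \<Longrightarrow> I \<subseteq> U) \<Longrightarrow> U = V"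
  shows "hyper_connected V \<I>"
  using assms unfolding hyper_connected_def by blast

text \<open>A hyperedge with one element lies in every set that it meets. This is why black leaves
  can be cut off or added.\<close>

lemma hyper_connected_cong:
  assumes "{I \<in> \<I>. card I \<noteq> 1} = {I \<in> \<J>. card I \<noteq> 1}"
  shows "hyper_connected V \<I> \<longleftrightarrow> hyper_connected V \<J>"
proof -
  have *: "(\<forall>I\<in>\<K>. I \<inter> U \<noteq> {} \<longrightarrow> I \<subseteq> U) \<longleftrightarrow> (\<forall>I\<in>{I \<in> \<K>. card I \<noteq> 1}. I \<inter> U \<noteq> {} \<longrightarrow> I \<subseteq> U)"
    for \<K> :: "'a set set" and U
    by (auto simp: card_1_singleton_iff)
  show ?thesis unfolding hyper_connected_def *[of \<I>] *[of \<J>] assms ..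
qed

text \<open>Start from one vertex. While the set is not all of \<open>V\<close>, some hyperedge
  meets it and leaves it; adding that hyperedge brings at most \<open>card (F j) - 1\<close> new
  vertices. The hyperedges form an indexed family because repetitions have to be counted.\<close>

lemma hyper_connected_bound:
  fixes F :: "'j \<Rightarrow> 'v set"
  assumes V: "finite V" "V \<noteq> {}" and J: "finite J" "\<And>j. j \<in> J \<Longrightarrow> F j \<subseteq> V"
    and conn: "hyper_connected V (F ` J)"
  shows "card V \<le> 1 + (\<Sum>j\<in>J. card (F j) - 1)"
proof -
  have grow: "card V \<le> 1 + (\<Sum>j\<in>J. card (F j) - 1)"
    if "U \<subseteq> V" "U \<noteq> {}" "K \<subseteq> J" "\<And>j. j \<in> K \<Longrightarrow> F j \<subseteq> U" "card U \<le> 1 + (\<Sum>j\<in>K. card (F j) - 1)" for U K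
    using that
  proof (induction "card (V - U)" arbitrary: U K rule: less_induct)
    case less
    show ?case
    proof (cases "U = V")
      case True
      have "(\<Sum>j\<in>K. card (F j) - 1) \<le> (\<Sum>j\<in>J. card (F j) - 1)"
        using J(1) less.prems(3) by (intro sum_mono2) auto
      moreover have "card U = card V" using True by simp
      ultimately show ?thesis using less.prems(5) by linarith
    next
      case False
      then obtain j where j: "j \<in> J" "F j \<inter> U \<noteq> {}" "\<not> F j \<subseteq> U"
        using hyper_connectedD[OF conn less.prems(1,2)] by blast
      then have jK: "j \<notin> K" using less.prems(4) by blast
      have finF: "finite (F j)" using J(2)[OF j(1)] V(1) finite_subset by blast
      have finU: "finite U" using less.prems(1) V(1) finite_subset by blast
      have finK: "finite K" using less.prems(3) J(1) finite_subset by blast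
      have "card (F j \<inter> U) > 0" using j(2) finF by (simp add: card_gt_0_iff)
      moreover have "card (U \<union> F j) + card (F j \<inter> U) = card U + card (F j)"
        using card_Un_Int[OF finU finF] by (simp add: Int_commute)
      ultimately have "card (U \<union> F j) \<le> card U + (card (F j) - 1)" by linarith
      then have le: "card (U \<union> F j) \<le> 1 + (\<Sum>j\<in>insert j K. card (F j) - 1)"
        using less.prems(5) finK jK by simp
      have "V - (U \<union> F j) \<subset> V - U" using j J(2)[OF j(1)] by blast
      then have "card (V - (U \<union> F j)) < card (V - U)" using V(1) by (intro psubset_card_mono) auto
      then show ?thesis
        by (rule less.hyps) (use less.prems j J(2)[OF j(1)] le in auto)
    qed
  qed
  obtain v where "v \<in> V" using V(2) by blast
  then show ?thesis using grow[of "{v}" "{}"] by simp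
qed

text \<open>The white vertices reachable from \<open>1\<close> form a closed set. Conversely, a
  closed set together with the black vertices that meet it cannot be left along an edge.\<close>

lemma bip_connected_iff:
  assumes p: "p \<ge> 1" and T: "\<And>I. I \<in> T \<Longrightarrow> I \<subseteq> {1..p} \<and> I \<noteq> {}"
  shows "bip_connected p T \<longleftrightarrow> hyper_connected {1..p} T"
proof
  let ?R = "bip_edges T \<union> (bip_edges T)\<inverse>"
  assume c: "bip_connected p T"
  show "hyper_connected {1..p} T"
  proof (rule hyper_connectedI)
    fix U assume U: "U \<subseteq> {1..p}" "U \<noteq> {}" "\<And>I. I \<in> T \<Longrightarrow> I \<inter> U \<noteq> {} \<Longrightarrow> I \<subseteq> U"
    obtain u where u: "u \<in> U" using U(2) by blast
    let ?W = "Inl ` U \<union> Inr ` {I \<in> T. I \<inter> U \<noteq> {}}"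
    have closed: "y \<in> ?W" if "(Inl u, y) \<in> ?R\<^sup>*" for y
      using that
    proof (induction rule: rtrancl_induct)
      case (step y z)
      from step.hyps(2) obtain i I where iI: "I \<in> T" "i \<in> I"
        "(y = Inl i \<and> z = Inr I) \<or> (y = Inr I \<and> z = Inl i)"
        by (auto simp: bip_edges_def)
      then show ?case using step.IH U(3)[of I] by auto
    qed (use u in simp)
    show "U = {1..p}"
    proof (intro equalityI subsetI)
      fix v assume "v \<in> {1..p}"
      then have "(Inl u, Inl v) \<in> ?R\<^sup>*" using c u U(1) by (auto simp: bip_connected_def bip_vertices_def)
      then show "v \<in> U" using closed by auto
    qed (use U in auto)
  qed
next
  let ?R = "bip_edges T \<union> (bip_edges T)\<inverse>"
  assume c: "hyper_connected {1..p} T"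
  define U where "U = {i \<in> {1..p}. (Inl 1, Inl i) \<in> ?R\<^sup>*}"
  have up: "(Inl 1, Inr I) \<in> ?R\<^sup>*" if "I \<in> T" "i \<in> I" "i \<in> U" for I i
  proof -
    have "(Inl i, Inr I) \<in> ?R" using that by (auto simp: bip_edges_def)
    then show ?thesis using that(3) by (auto simp: U_def intro: rtrancl.rtrancl_into_rtrancl)
  qed
  have U: "U = {1..p}"
  proof (rule hyper_connectedD[OF c])
    show "U \<subseteq> {1..p}" by (auto simp: U_def)
    show "U \<noteq> {}" using p by (auto simp: U_def)
    fix I assume I: "I \<in> T" "I \<inter> U \<noteq> {}"
    then have r: "(Inl 1, Inr I) \<in> ?R\<^sup>*" using up by blast
    show "I \<subseteq> U"
    proof
      fix i assume i: "i \<in> I"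
      then have "(Inr I, Inl i) \<in> ?R" using I by (auto simp: bip_edges_def)
      then have "(Inl 1, Inl i) \<in> ?R\<^sup>*" using r by (rule rtrancl.rtrancl_into_rtrancl[rotated])
      then show "i \<in> U" using T[OF I(1)] i by (auto simp: U_def)
    qed
  qed
  have "(Inl 1, v) \<in> ?R\<^sup>*" if v: "v \<in> bip_vertices p T" for v
  proof -
    from v consider i where "v = Inl i" "i \<in> {1..p}" | I where "v = Inr I" "I \<in> T"
      by (auto simp: bip_vertices_def)
    then show ?thesis
    proof cases
      case 1
      then have "i \<in> U" unfolding U by simp
      then show ?thesis using 1(1) by (simp add: U_def)
    next
      case 2
      then obtain i where "i \<in> I" "i \<in> {1..p}" using T by blast
      then have "i \<in> U" unfolding U by simp
      then show ?thesis using up[OF 2(2) \<open>i \<in> I\<close>] 2(1) by simp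
    qed
  qed
  moreover have "sym (?R\<^sup>*)" by (intro sym_rtrancl) (auto simp: sym_def)
  ultimately show "bip_connected p T"
    unfolding bip_connected_def by (metis rtrancl_trans symD)
qed

lemma bip_trees_iff:
  assumes "p \<ge> 1"
  shows "T \<in> bip_trees p \<longleftrightarrow> (\<forall>I\<in>T. I \<subseteq> {1..p} \<and> card I \<ge> 2) \<and> hyper_connected {1..p} T \<and>
    (\<Sum>I\<in>T. card I - 1) = p - 1"
proof -
  have "bip_connected p T \<longleftrightarrow> hyper_connected {1..p} T" if "\<forall>I\<in>T. I \<subseteq> {1..p} \<and> card I \<ge> 2"
    using that by (intro bip_connected_iff[OF assms]) force
  then show ?thesis unfolding bip_trees_def by blast
qed

lemma finite_bip_trees: "finite (bip_trees p)"
  by (rule finite_subset[of _ "Pow (Pow {1..p})"]) (auto simp: bip_trees_def)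

lemma bip_trees_finite: "T \<in> bip_trees p \<Longrightarrow> finite T"
  by (rule finite_subset[of _ "Pow {1..p}"]) (auto simp: bip_trees_def)

text \<open>Otherwise \<open>{i}\<close> would be closed. So for \<open>p \<ge> 2\<close> every
  white vertex has a mark to place, and no antiderivative occurs.\<close>

lemma bip_trees_degree_pos:
  assumes T: "T \<in> bip_trees p" and p: "p \<ge> 2" and i: "i \<in> {1..p}"
  shows "{I \<in> T. i \<in> I} \<noteq> {}"
proof
  assume e: "{I \<in> T. i \<in> I} = {}"
  have "hyper_connected {1..p} T" using T p by (simp add: bip_trees_iff)
  then have "{i} = {1..p}" by (rule hyper_connectedD) (use i e in auto)
  then have "card {1..p} = 1" by (metis card_1_singleton_iff One_nat_def)
  then show False using p by simp
qed

lemma bip_trees_1: "bip_trees 1 = {{}}"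
proof (intro equalityI subsetI)
  fix T assume "T \<in> bip_trees 1"
  then have T: "\<And>I. I \<in> T \<Longrightarrow> I \<subseteq> {1} \<and> card I \<ge> 2" by (simp add: bip_trees_def)
  have "I \<notin> T" for I
  proof
    assume "I \<in> T"
    then have "card I \<le> card {1::nat}" using T by (intro card_mono) auto
    then show False using T[OF \<open>I \<in> T\<close>] by simp
  qed
  then show "T \<in> {{}}" by blast
next
  fix T :: "nat set set" assume "T \<in> {{}}"
  moreover have "hyper_connected {1..1::nat} {}" by (rule hyper_connectedI) auto
  ultimately show "T \<in> bip_trees 1" unfolding bip_trees_iff[OF order_refl] by simp
qed

section \<open>Partitions of a set of coloured edges and bipartite trees\<close>

lemma inj_singleton: "inj_on (\<lambda>e. {e}) S"
  by (simp add: inj_on_def)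

text \<open>An edge \<open>e\<close> joins the white vertex \<open>col e\<close> with a black vertex, which is the block of a partition
  of \<open>E\<close> that contains \<open>e\<close>.\<close>

locale coloured_edges =
  fixes E :: "'e set" and col :: "'e \<Rightarrow> nat" and p :: nat
  assumes finE: "finite E" and p: "p \<ge> 1" and col: "\<And>e. e \<in> E \<Longrightarrow> col e \<in> {1..p}"
begin

text \<open>The last equation says that the number of edges is one less than the number
  \<open>card P + p\<close> of vertices.\<close>

definition tree_partitions :: "'e set set set" where
  "tree_partitions = {P. partition_on E P \<and> hyper_connected {1..p} ((`) col ` P) \<and> card E = card P + (p - 1)}"

text \<open>\<open>c i I\<close> is the edge joining the white vertex \<open>i\<close> with the
  black vertex \<open>I\<close>; it is injective in \<open>I\<close>, as an edge has only one black
  end.\<close>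

definition tree_choices :: "nat set set \<Rightarrow> (nat \<Rightarrow> nat set \<Rightarrow> 'e) set" where
  "tree_choices T = PiE {1..p}
    (\<lambda>i. {f \<in> {I \<in> T. i \<in> I} \<rightarrow>\<^sub>E {e \<in> E. col e = i}. inj_on f {I \<in> T. i \<in> I}})"

definition block :: "(nat \<Rightarrow> nat set \<Rightarrow> 'e) \<Rightarrow> nat set \<Rightarrow> 'e set" where
  "block c I = (\<lambda>i. c i I) ` I"

definition chosen :: "nat set set \<Rightarrow> (nat \<Rightarrow> nat set \<Rightarrow> 'e) \<Rightarrow> 'e set" where
  "chosen T c = (\<Union>I\<in>T. block c I)"

text \<open>The edges that \<open>T\<close> does not use end in black leaves.\<close>

definition glue :: "nat set set \<Rightarrow> (nat \<Rightarrow> nat set \<Rightarrow> 'e) \<Rightarrow> 'e set set" where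
  "glue T c = block c ` T \<union> (\<lambda>e. {e}) ` (E - chosen T c)"

context
  fixes T c assumes T: "T \<in> bip_trees p" and c: "c \<in> tree_choices T"
begin

lemma tree_block_subset: "I \<in> T \<Longrightarrow> I \<subseteq> {1..p}" and tree_block_card: "I \<in> T \<Longrightarrow> card I \<ge> 2"
  using T by (auto simp: bip_trees_def)

lemma choice_mem: "I \<in> T \<Longrightarrow> i \<in> I \<Longrightarrow> c i I \<in> E \<and> col (c i I) = i"
proof -
  assume I: "I \<in> T" "i \<in> I"
  then have "i \<in> {1..p}" using tree_block_subset by blast
  then have "c i \<in> {I \<in> T. i \<in> I} \<rightarrow>\<^sub>E {e \<in> E. col e = i}"
    using PiE_mem[OF c[unfolded tree_choices_def]] by blast
  from PiE_mem[OF this, of I] I show "c i I \<in> E \<and> col (c i I) = i" by simp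
qed

lemma choice_inj:
  assumes "I \<in> T" "i \<in> I" "I' \<in> T" "i' \<in> I'" "c i I = c i' I'" shows "i = i'" "I = I'"
proof -
  show "i = i'" using choice_mem[OF assms(1,2)] choice_mem[OF assms(3,4)] assms(5) by metis
  moreover have "inj_on (c i) {I \<in> T. i \<in> I}"
    using PiE_mem[OF c[unfolded tree_choices_def], of i] tree_block_subset[OF assms(1)] assms(2) by blast
  ultimately show "I = I'" using inj_onD[of "c i" _ I I'] assms by simp
qed

lemma col_block: "I \<in> T \<Longrightarrow> col ` block c I = I"
proof -
  assume "I \<in> T"
  then have "(\<lambda>i. col (c i I)) ` I = (\<lambda>i. i) ` I"
    by (intro image_cong) (auto simp: choice_mem)
  then show ?thesis by (simp add: block_def image_image)
qed

lemma inj_block: "inj_on (block c) T"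
  by (rule inj_on_inverseI[of _ "\<lambda>Q. col ` Q"]) (rule col_block)

lemma card_block: "I \<in> T \<Longrightarrow> card (block c I) = card I"
  unfolding block_def by (intro card_image inj_onI) (rule choice_inj(1))

lemma block_disjoint: "I \<in> T \<Longrightarrow> I' \<in> T \<Longrightarrow> I \<noteq> I' \<Longrightarrow> block c I \<inter> block c I' = {}"
proof (rule equals0I)
  fix e assume I: "I \<in> T" "I' \<in> T" "I \<noteq> I'" and "e \<in> block c I \<inter> block c I'"
  then obtain i i' where "i \<in> I" "i' \<in> I'" "c i I = c i' I'" by (auto simp: block_def)
  then show False using choice_inj(2)[of I i I' i'] I by blast
qed

lemma block_sub: "I \<in> T \<Longrightarrow> block c I \<subseteq> E"
  using choice_mem by (auto simp: block_def)

lemma finT: "finite T" using T by (rule bip_trees_finite)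

lemma finite_block: "I \<in> T \<Longrightarrow> finite (block c I)"
  by (rule finite_subset[OF block_sub finE])

lemma chosen_sub: "chosen T c \<subseteq> E" using block_sub by (auto simp: chosen_def)

lemma card_chosen: "card (chosen T c) = (\<Sum>I\<in>T. card I)"
proof -
  have "card (chosen T c) = (\<Sum>I\<in>T. card (block c I))"
    unfolding chosen_def
    by (rule card_UN_disjoint[OF finT]) (use finite_block block_disjoint in blast)+
  then show ?thesis by (simp add: card_block)
qed

lemma glue_disjoint: "block c ` T \<inter> (\<lambda>e. {e}) ` (E - chosen T c) = {}"
proof -
  have "block c I \<noteq> {e}" if "I \<in> T" for I e
    using tree_block_card[OF that] card_block[OF that] by auto
  then show ?thesis by blast
qed

lemma partition_on_glue: "partition_on E (glue T c)"
proof (rule partition_onI)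
  show "\<Union> (glue T c) = E" using chosen_sub by (auto simp: glue_def chosen_def)
next
  fix q r assume "q \<in> glue T c" "r \<in> glue T c" "q \<noteq> r"
  then show "disjnt q r" using block_disjoint unfolding glue_def disjnt_def chosen_def by blast
next
  have "block c I \<noteq> {}" if "I \<in> T" for I using tree_block_card[OF that] card_block[OF that] by auto
  then show "{} \<notin> glue T c" by (auto simp: glue_def)
qed

lemma glue_tree_partition: "glue T c \<in> tree_partitions"
proof -
  have conn: "hyper_connected {1..p} T" and sum: "(\<Sum>I\<in>T. card I - 1) = p - 1"
    using T by (auto simp: bip_trees_iff[OF p])
  have "{I \<in> (`) col ` glue T c. card I \<noteq> 1} = {I \<in> T. card I \<noteq> 1}"
  proof (intro equalityI subsetI)
    fix I assume "I \<in> {I \<in> (`) col ` glue T c. card I \<noteq> 1}"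
    then show "I \<in> {I \<in> T. card I \<noteq> 1}" using col_block by (auto simp: glue_def)
  next
    fix I assume "I \<in> {I \<in> T. card I \<noteq> 1}"
    then show "I \<in> {I \<in> (`) col ` glue T c. card I \<noteq> 1}"
      using col_block[of I] by (auto simp: glue_def intro!: image_eqI[of _ _ "block c I"])
  qed
  then have "hyper_connected {1..p} ((`) col ` glue T c) \<longleftrightarrow> hyper_connected {1..p} T"
    by (rule hyper_connected_cong)
  then have "hyper_connected {1..p} ((`) col ` glue T c)" using conn by (rule iffD2)
  moreover have "card E = card (glue T c) + (p - 1)"
  proof -
    have "card (glue T c) = card T + card (E - chosen T c)"
      unfolding glue_def card_Un_disjoint[OF finite_imageI[OF finT] finite_imageI[OF finite_Diff[OF finE]] glue_disjoint]
        card_image[OF inj_block] card_image[OF inj_singleton] ..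
    moreover have "card (E - chosen T c) + card (chosen T c) = card E"
      using card_Diff_subset[OF finite_subset[OF chosen_sub finE] chosen_sub] card_mono[OF finE chosen_sub]
      by simp
    moreover have "(\<Sum>I\<in>T. card I) = (\<Sum>I\<in>T. card I - 1) + card T"
    proof -
      have "(\<Sum>I\<in>T. card I) = (\<Sum>I\<in>T. (card I - 1) + 1)"
      proof (rule sum.cong)
        fix I assume "I \<in> T"
        then show "card I = (card I - 1) + 1" using tree_block_card[of I] by linarith
      qed simp
      also have "\<dots> = (\<Sum>I\<in>T. card I - 1) + card T" by (simp only: sum.distrib) simp
      finally show ?thesis .
    qed
    ultimately show ?thesis using sum card_chosen by linarith
  qed
  ultimately show ?thesis using partition_on_glue by (simp add: tree_partitions_def)
qed

lemma prod_glue: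
  fixes \<phi> :: "'e set \<Rightarrow> 'c::comm_monoid_mult"
  shows "(\<Prod>Q\<in>glue T c. \<phi> Q) = (\<Prod>I\<in>T. \<phi> (block c I)) * (\<Prod>e\<in>E - chosen T c. \<phi> {e})"
  unfolding glue_def prod.union_disjoint[OF finite_imageI[OF finT] finite_imageI[OF finite_Diff[OF finE]] glue_disjoint]
    prod.reindex[OF inj_block] prod.reindex[OF inj_singleton] comp_def ..

lemma glue_block_unique:
  assumes "Q \<in> glue T c" "card (col ` Q) \<noteq> 1" shows "col ` Q \<in> T" "Q = block c (col ` Q)"
proof -
  from assms obtain I where "I \<in> T" "Q = block c I" by (auto simp: glue_def)
  then show "col ` Q \<in> T" "Q = block c (col ` Q)" using col_block by auto
qed

end

text \<open>\<open>T\<close> can be read off as the colour sets of blocks that have more than one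
  element, and \<open>c i I\<close> as the element of colour \<open>i\<close> in the block with
  colour set \<open>I\<close>.\<close>

lemma inj_glue: "inj_on (\<lambda>(T, c). glue T c) (SIGMA T:bip_trees p. tree_choices T)"
proof (rule inj_onI, clarify)
  fix T c T' c'
  assume T: "T \<in> bip_trees p" "c \<in> tree_choices T" and T': "T' \<in> bip_trees p" "c' \<in> tree_choices T'"
    and e: "glue T c = glue T' c'"
  have "I \<in> T2 \<and> block c1 I = block c2 I" if "T1 \<in> bip_trees p" "c1 \<in> tree_choices T1"
    "T2 \<in> bip_trees p" "c2 \<in> tree_choices T2" "glue T1 c1 = glue T2 c2" "I \<in> T1" for T1 c1 T2 c2 I
  proof -
    have "block c1 I \<in> glue T1 c1" using that(6) by (simp add: glue_def)
    then have "block c1 I \<in> glue T2 c2" unfolding that(5) .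
    moreover have cb: "col ` block c1 I = I" using col_block that by blast
    moreover have "card I \<noteq> 1" using tree_block_card[OF that(1,2,6)] by simp
    ultimately show ?thesis using glue_block_unique[OF that(3,4), of "block c1 I"] by simp
  qed
  note sub = this
  have TT: "T = T'" using sub[OF T T' e] sub[OF T' T e[symmetric]] by blast
  have "c i I = c' i I" if "I \<in> T" "i \<in> I" for i I
  proof -
    have "c i I \<in> block c' I" using sub[OF T T' e that(1)] that by (auto simp: block_def)
    then obtain i' where "i' \<in> I" "c i I = c' i' I" by (auto simp: block_def)
    then show ?thesis using choice_mem[OF T that] choice_mem[OF T', of I i'] that TT by metis
  qed
  note val = this
  have "c = c'"
  proof (rule PiE_ext[OF T(2)[unfolded tree_choices_def] T'(2)[unfolded tree_choices_def TT[symmetric]]])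
    fix i assume i: "i \<in> {1..p}"
    have ci: "c i \<in> {I \<in> T. i \<in> I} \<rightarrow>\<^sub>E {e \<in> E. col e = i}" "c' i \<in> {I \<in> T. i \<in> I} \<rightarrow>\<^sub>E {e \<in> E. col e = i}"
      using T(2) T'(2) i TT unfolding tree_choices_def by (auto simp: PiE_iff)
    show "c i = c' i" by (rule PiE_ext[OF ci]) (use val in auto)
  qed
  then show "T = T' \<and> c = c'" using TT by simp
qed

text \<open>The bound in \<open>hyper_connected_bound\<close> is attained. So colours do not repeat in a block, and two
  blocks cannot have the same set of at least two colours, as one of them could be omitted.\<close>

lemma tree_partition_rigid:
  assumes P: "P \<in> tree_partitions"
  shows "\<And>Q. Q \<in> P \<Longrightarrow> inj_on col Q"
    and "\<And>Q R. Q \<in> P \<Longrightarrow> R \<in> P \<Longrightarrow> card (col ` Q) \<noteq> 1 \<Longrightarrow> col ` Q = col ` R \<Longrightarrow> Q = R"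
    and "(\<Sum>Q\<in>P. card (col ` Q) - 1) = p - 1"
proof -
  have part: "partition_on E P" and conn: "hyper_connected {1..p} ((`) col ` P)" and card: "card E = card P + (p - 1)"
    using P by (auto simp: tree_partitions_def)
  have sub: "Q \<subseteq> E" "Q \<noteq> {}" "finite Q" if "Q \<in> P" for Q
    using part that finE by (auto simp: partition_on_def intro: finite_subset)
  have finP: "finite P" using finite_elements[OF finE part] .
  have colV: "col ` Q \<subseteq> {1..p}" if "Q \<in> P" for Q using sub(1)[OF that] col by blast
  have pos: "card Q \<ge> 1" "card (col ` Q) \<ge> 1" if "Q \<in> P" for Q
    using sub[OF that] by (auto simp: Suc_le_eq card_gt_0_iff)
  have le: "card (col ` Q) - 1 \<le> card Q - 1" if "Q \<in> P" for Q
    using card_image_le[OF sub(3)[OF that], of col] by simp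
  have "(\<Sum>Q\<in>P. card Q) = (\<Sum>Q\<in>P. (card Q - 1) + 1)"
  proof (rule sum.cong)
    fix Q assume "Q \<in> P"
    then show "card Q = (card Q - 1) + 1" using pos(1)[of Q] by linarith
  qed simp
  then have "(\<Sum>Q\<in>P. card Q) = (\<Sum>Q\<in>P. card Q - 1) + card P" by (simp only: sum.distrib) simp
  moreover have "card E = (\<Sum>Q\<in>P. card Q)"
    using card_Union_disjoint[of P] partition_onD1[OF part] partition_onD2[OF part] sub(3)
    by (simp add: disjoint_def pairwise_def disjnt_def)
  ultimately have tot: "(\<Sum>Q\<in>P. card Q - 1) = p - 1" using card by linarith
  have bound: "p - 1 \<le> (\<Sum>Q\<in>P. card (col ` Q) - 1)"
    using hyper_connected_bound[of "{1..p}" P "(`) col"] finP colV conn p by simp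
  have "(\<Sum>Q\<in>P. card (col ` Q) - 1) \<le> (\<Sum>Q\<in>P. card Q - 1)" using le by (rule sum_mono)
  \<comment> \<open>The sum is squeezed between two values \<open>p - 1\<close>: from below by
    \<open>hyper_connected_bound\<close>, from above by the number of edges.\<close>
  then have eq: "(\<Sum>Q\<in>P. card (col ` Q) - 1) = (\<Sum>Q\<in>P. card Q - 1)" using tot bound by linarith
  then show "(\<Sum>Q\<in>P. card (col ` Q) - 1) = p - 1" using tot by simp
  fix Q assume Q: "Q \<in> P"
  have "card (col ` Q) - 1 = card Q - 1"
  proof (rule ccontr)
    assume "\<not> ?thesis"
    then have "card (col ` Q) - 1 < card Q - 1" using le[OF Q] by simp
    then have "(\<Sum>Q\<in>P. card (col ` Q) - 1) < (\<Sum>Q\<in>P. card Q - 1)"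
      using le Q finP by (intro sum_strict_mono_ex1) auto
    then show False using eq by simp
  qed
  then have "card (col ` Q) = card Q" using pos[OF Q] by linarith
  then show "inj_on col Q" using sub(3)[OF Q] by (simp add: eq_card_imp_inj_on)
  fix R assume R: "R \<in> P" "card (col ` Q) \<noteq> 1" "col ` Q = col ` R"
  show "Q = R"
  proof (rule ccontr)
    assume "Q \<noteq> R"
    then have "(`) col ` P = (`) col ` (P - {Q})" using R by blast
    then have "p \<le> 1 + (\<Sum>Q\<in>P - {Q}. card (col ` Q) - 1)"
      using hyper_connected_bound[of "{1..p}" "P - {Q}" "(`) col"] finP colV conn p by simp
    moreover have "(\<Sum>Q\<in>P. card (col ` Q) - 1) = (card (col ` Q) - 1) + (\<Sum>Q\<in>P - {Q}. card (col ` Q) - 1)"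
      using finP Q by (rule sum.remove)
    moreover have "card (col ` Q) - 1 > 0" using R(2) pos[OF Q] by linarith
    ultimately show False using eq tot by linarith
  qed
qed

lemma glue_surj:
  assumes P: "P \<in> tree_partitions"
  shows "\<exists>T\<in>bip_trees p. \<exists>c\<in>tree_choices T. glue T c = P"
proof -
  note rigid = tree_partition_rigid[OF P]
  have part: "partition_on E P" and conn: "hyper_connected {1..p} ((`) col ` P)"
    using P by (auto simp: tree_partitions_def)
  have sub: "Q \<subseteq> E" "Q \<noteq> {}" "finite Q" if "Q \<in> P" for Q
    using part that finE by (auto simp: partition_on_def intro: finite_subset)
  have finP: "finite P" using finite_elements[OF finE part] .
  have colV: "col ` Q \<subseteq> {1..p}" if "Q \<in> P" for Q using sub(1)[OF that] col by blast
  \<comment> \<open>The blocks with at least two colours are the black vertices that are not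
    leaves.\<close>
  define big where "big = {Q \<in> P. card (col ` Q) \<noteq> 1}"
  define T where "T = (`) col ` big"
  have inj: "inj_on ((`) col) big" using rigid(2) by (auto simp: big_def intro!: inj_onI)
  have T: "T \<in> bip_trees p"
    unfolding bip_trees_iff[OF p]
  proof (intro conjI ballI)
    fix I assume "I \<in> T"
    then obtain Q where Q: "Q \<in> P" "I = col ` Q" "card I \<noteq> 1" by (auto simp: T_def big_def)
    then show "I \<subseteq> {1..p}" using colV by blast
    have "card I > 0" using Q sub[OF Q(1)] by (simp add: card_gt_0_iff)
    then show "2 \<le> card I" using Q(3) by linarith
  next
    show "hyper_connected {1..p} T"
    proof (rule iffD1[OF hyper_connected_cong conn])
      show "{I \<in> (`) col ` P. card I \<noteq> 1} = {I \<in> T. card I \<noteq> 1}" by (auto simp: T_def big_def)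
    qed
    have "(\<Sum>I\<in>T. card I - 1) = (\<Sum>Q\<in>big. card (col ` Q) - 1)"
      unfolding T_def by (simp add: sum.reindex[OF inj])
    also have "\<dots> = (\<Sum>Q\<in>P. card (col ` Q) - 1)"
      using finP by (intro sum.mono_neutral_left) (auto simp: big_def)
    finally show "(\<Sum>I\<in>T. card I - 1) = p - 1" using rigid(3) by simp
  qed
  define q where "q = inv_into big ((`) col)"
  have q: "q I \<in> big" "col ` q I = I" if "I \<in> T" for I
    using inv_into_into[OF that[unfolded T_def]] f_inv_into_f[OF that[unfolded T_def]]
    by (simp_all add: q_def)
  have qP: "q I \<in> P" if "I \<in> T" for I using q(1)[OF that] by (simp add: big_def)
  have q_col: "q (col ` Q) = Q" if "Q \<in> big" for Q
    using inj that by (simp add: q_def)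
  \<comment> \<open>As \<open>col\<close> is injective on blocks, the block with colour set
    \<open>I\<close> has exactly one edge of each colour in \<open>I\<close>.\<close>
  define c where "c = (\<lambda>i\<in>{1..p}. \<lambda>I\<in>{I \<in> T. i \<in> I}. the_inv_into (q I) col i)"
  have cval: "c i I = the_inv_into (q I) col i" "c i I \<in> q I" "col (c i I) = i" if "I \<in> T" "i \<in> I" for i I
  proof -
    have "I \<subseteq> {1..p}" using that(1) T unfolding bip_trees_def by blast
    then have "i \<in> {1..p}" using that(2) by blast
    then show 1: "c i I = the_inv_into (q I) col i" using that by (simp add: c_def)
    have i: "i \<in> col ` q I" using q(2)[OF that(1)] that(2) by simp
    show "c i I \<in> q I" unfolding 1 by (rule the_inv_into_into[OF rigid(1)[OF qP[OF that(1)]] i order_refl])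
    show "col (c i I) = i" unfolding 1 by (rule f_the_inv_into_f[OF rigid(1)[OF qP[OF that(1)]] i])
  qed
  have blk: "block c I = q I" if "I \<in> T" for I
  proof (intro equalityI subsetI)
    fix e assume e: "e \<in> q I"
    then have i: "col e \<in> I" using q(2)[OF that] by (metis imageI)
    have "c (col e) I = e"
      using cval(1)[OF that i] the_inv_into_f_f[OF rigid(1)[OF qP[OF that]] e] by simp
    then show "e \<in> block c I" using i unfolding block_def by force
  qed (use cval(2) that in \<open>auto simp: block_def\<close>)
  have c: "c \<in> tree_choices T"
    unfolding tree_choices_def
  proof (rule PiE_I)
    fix i assume i: "i \<in> {1..p}"
    have "inj_on (c i) {I \<in> T. i \<in> I}"
    proof (rule inj_onI)
      fix I J assume IJ: "I \<in> {I \<in> T. i \<in> I}" "J \<in> {I \<in> T. i \<in> I}" "c i I = c i J"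
      then have "c i I \<in> q I \<inter> q J" using cval(2)[of I i] cval(2)[of J i] by auto
      then have "q I = q J"
        using partition_onD2[OF part] qP[of I] qP[of J] IJ by (auto simp: disjoint_def)
      then show "I = J" using q(2) IJ by (metis mem_Collect_eq)
    qed
    moreover have "c i \<in> {I \<in> T. i \<in> I} \<rightarrow>\<^sub>E {e \<in> E. col e = i}"
    proof (rule PiE_I)
      fix I assume "I \<in> {I \<in> T. i \<in> I}"
      then show "c i I \<in> {e \<in> E. col e = i}" using cval(2,3)[of I i] sub(1)[OF qP, of I] by auto
    qed (use i in \<open>auto simp: c_def\<close>)
    ultimately show "c i \<in> {f \<in> {I \<in> T. i \<in> I} \<rightarrow>\<^sub>E {e \<in> E. col e = i}. inj_on f {I \<in> T. i \<in> I}}" by simp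
  qed (auto simp: c_def)
  have "block c ` T = q ` T" using blk by (intro image_cong) auto
  also have "\<dots> = (\<lambda>Q. Q) ` big" unfolding T_def image_image using q_col by (intro image_cong) auto
  finally have "block c ` T = big" by simp
  moreover from this have ch: "chosen T c = \<Union> big" by (auto simp: chosen_def)
  moreover have "(\<lambda>e. {e}) ` (E - \<Union> big) = P - big"
  proof (intro equalityI subsetI)
    fix Q assume "Q \<in> P - big"
    then have Q: "Q \<in> P" "card (col ` Q) = 1" by (auto simp: big_def)
    then have "card Q = 1" using card_image[OF rigid(1)[OF Q(1)]] by simp
    then obtain e where e: "Q = {e}" by (auto simp: card_1_singleton_iff)
    have "e \<notin> \<Union> big"
    proof
      assume "e \<in> \<Union> big"
      then obtain R where "R \<in> big" "e \<in> R" by blast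
      moreover from this have "R \<in> P" by (simp add: big_def)
      ultimately have "R = Q" using disjointD[OF partition_onD2[OF part], of R Q] Q(1) e by auto
      then show False using \<open>R \<in> big\<close> \<open>Q \<in> P - big\<close> by simp
    qed
    then show "Q \<in> (\<lambda>e. {e}) ` (E - \<Union> big)" using e sub(1)[OF Q(1)] by auto
  next
    fix Q assume "Q \<in> (\<lambda>e. {e}) ` (E - \<Union> big)"
    then obtain e where e: "Q = {e}" "e \<in> E" "e \<notin> \<Union> big" by blast
    then obtain R where R: "R \<in> P" "e \<in> R" using partition_onD1[OF part] by blast
    then have "R \<notin> big" using e(3) by blast
    then have "card (col ` R) = 1" using R(1) by (auto simp: big_def)
    then have "card R = 1" using card_image[OF rigid(1)[OF R(1)]] by simp
    then have "R = Q" using R(2) e(1) by (auto simp: card_1_singleton_iff)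
    then show "Q \<in> P - big" using R \<open>R \<notin> big\<close> by simp
  qed
  moreover have "big \<subseteq> P" by (auto simp: big_def)
  ultimately have "glue T c = P" by (auto simp: glue_def)
  then show ?thesis using T c by blast
qed

lemma bij_betw_glue: "bij_betw (\<lambda>(T, c). glue T c) (SIGMA T:bip_trees p. tree_choices T) tree_partitions"
proof (rule bij_betw_imageI[OF inj_glue], intro equalityI subsetI)
  fix P assume "P \<in> tree_partitions"
  from glue_surj[OF this] obtain T c where "T \<in> bip_trees p" "c \<in> tree_choices T" "P = glue T c" by blast
  then show "P \<in> (\<lambda>(T, c). glue T c) ` (SIGMA T:bip_trees p. tree_choices T)"
    by (intro image_eqI[of _ _ "(T, c)"]) auto
qed (use glue_tree_partition in auto)

lemma finite_tree_choices: "T \<in> bip_trees p \<Longrightarrow> finite (tree_choices T)"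
  unfolding tree_choices_def
proof (rule finite_PiE)
  fix i assume "T \<in> bip_trees p"
  then show "finite {f \<in> {I \<in> T. i \<in> I} \<rightarrow>\<^sub>E {e \<in> E. col e = i}. inj_on f {I \<in> T. i \<in> I}}"
    using finE bip_trees_finite
    by (intro finite_subset[OF _ finite_PiE[of "{I \<in> T. i \<in> I}" "\<lambda>_. {e \<in> E. col e = i}"]]) auto
qed simp

theorem sum_tree_partitions:
  fixes \<phi> :: "'e set \<Rightarrow> 'c::comm_semiring_1"
  shows "(\<Sum>P\<in>tree_partitions. \<Prod>Q\<in>P. \<phi> Q) =
    (\<Sum>T\<in>bip_trees p. \<Sum>c\<in>tree_choices T. (\<Prod>I\<in>T. \<phi> (block c I)) * (\<Prod>e\<in>E - chosen T c. \<phi> {e}))"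
proof -
  have "(\<Sum>P\<in>tree_partitions. \<Prod>Q\<in>P. \<phi> Q) =
      (\<Sum>(T, c)\<in>(SIGMA T:bip_trees p. tree_choices T). \<Prod>Q\<in>glue T c. \<phi> Q)"
    by (subst sum.reindex_bij_betw[OF bij_betw_glue, symmetric]) (simp add: split_def)
  also have "\<dots> = (\<Sum>(T, c)\<in>(SIGMA T:bip_trees p. tree_choices T).
      (\<Prod>I\<in>T. \<phi> (block c I)) * (\<Prod>e\<in>E - chosen T c. \<phi> {e}))"
    by (intro sum.cong) (auto simp: prod_glue)
  also have "\<dots> = (\<Sum>T\<in>bip_trees p. \<Sum>c\<in>tree_choices T. (\<Prod>I\<in>T. \<phi> (block c I)) * (\<Prod>e\<in>E - chosen T c. \<phi> {e}))"
    by (rule sum.Sigma[symmetric]) (use finite_bip_trees finite_tree_choices in auto)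
  finally show ?thesis .
qed

end

section \<open>The noncrossing permutations of a list of cycle lengths\<close>

lemma cycle_of_list_nth:
  assumes "distinct cs" "k < length cs"
  shows "cycle_of_list cs (cs ! k) = cs ! (Suc k mod length cs)"
proof -
  have "map (cycle_of_list cs) cs = rotate 1 cs" using cyclic_rotation[OF assms(1), of 1] by simp
  then have "map (cycle_of_list cs) cs ! k = rotate 1 cs ! k" by simp
  then show ?thesis using assms by (simp add: nth_rotate del: rotate_Suc)
qed

lemma orbit_cycle_of_list:
  assumes "distinct cs" "x \<in> set cs"
  shows "orbit (cycle_of_list cs) x = set cs"
proof -
  let ?n = "length cs" and ?f = "cycle_of_list cs"
  obtain k where k: "k < ?n" "x = cs ! k" using assms(2) by (auto simp: in_set_conv_nth)
  have pow: "(?f ^^ m) x = cs ! ((k + m) mod ?n)" for m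
  proof (induction m)
    case (Suc m)
    have "(k + m) mod ?n < ?n" using k(1) by (intro mod_less_divisor) linarith
    then show ?case using Suc cycle_of_list_nth[OF assms(1)] by (simp add: mod_Suc_eq)
  qed (use k in simp)
  have "orbit ?f x = {(?f ^^ m) x | m. True}"
    using permutation_of_cycle by (rule orbit_altdef_permutation)
  also have "\<dots> = set cs"
  proof (intro equalityI subsetI)
    fix y assume "y \<in> {(?f ^^ m) x | m. True}"
    then obtain m where "y = cs ! ((k + m) mod ?n)" using pow by auto
    moreover have "(k + m) mod ?n < ?n" using k(1) by (intro mod_less_divisor) linarith
    ultimately show "y \<in> set cs" by simp
  next
    fix y assume "y \<in> set cs"
    then obtain l where l: "l < ?n" "y = cs ! l" by (auto simp: in_set_conv_nth)
    have "(k + (?n - k + l)) mod ?n = l" using k l by (simp add: add.assoc[symmetric])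
    then have "(?f ^^ (?n - k + l)) x = y" unfolding pow using l by simp
    then show "y \<in> {(?f ^^ m) x | m. True}" by blast
  qed
  finally show ?thesis .
qed

lemma cycle_support_disjoint:
  assumes "i < j" shows "cycle_support ls i \<inter> cycle_support ls j = {}"
proof -
  have "sum_list (take (Suc i) ls) \<le> sum_list (take j ls)"
  proof -
    have "take (Suc i) ls = take (Suc i) (take j ls)" using assms by (simp add: min_def)
    then have "sum_list (take j ls) = sum_list (take (Suc i) ls) + sum_list (drop (Suc i) (take j ls))"
      by (metis append_take_drop_id sum_list_append)
    then show ?thesis by simp
  qed
  then show ?thesis by (auto simp: cycle_support_def)
qed

lemma card_cycle_support: "i < length ls \<Longrightarrow> card (cycle_support ls i) = ls ! i"
  by (simp add: cycle_support_def take_Suc_conv_app_nth)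

lemma cycle_support_UN:
  "k \<le> length ls \<Longrightarrow> (\<Union>i<k. cycle_support ls i) = {1..sum_list (take k ls)}"
proof (induction k)
  case (Suc k)
  then have "(\<Union>i<Suc k. cycle_support ls i) = {1..sum_list (take k ls)} \<union> cycle_support ls k"
    by (auto simp: lessThan_Suc)
  then show ?case using Suc.prems by (auto simp: cycle_support_def take_Suc_conv_app_nth)
qed simp

text \<open>The cycles composed in \<open>gamma_perm\<close> have disjoint supports, so all but one
  of them fix \<open>x\<close> and its image.\<close>

lemma gamma_perm_apply:
  assumes "i < length ls" "x \<in> cycle_support ls i"
  shows "gamma_perm ls x = cycle_of_list (sorted_list_of_set (cycle_support ls i)) x"
proof -
  let ?c = "\<lambda>i. cycle_of_list (sorted_list_of_set (cycle_support ls i))"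
  have fin: "finite (cycle_support ls j)" for j by (simp add: cycle_support_def)
  have out: "?c j y = y" if "y \<notin> cycle_support ls j" for j y
    using that fin by (intro id_outside_supp) simp
  have perm: "?c j permutes cycle_support ls j" for j
    using cycle_permutes[of "sorted_list_of_set (cycle_support ls j)"] fin by simp
  have disj: "y \<notin> cycle_support ls j" if "y \<in> cycle_support ls i" "j \<noteq> i" for j y
    using that cycle_support_disjoint[of i j] cycle_support_disjoint[of j i] by (metis disjoint_iff nat_neq_iff)
  have *: "foldr (\<lambda>i \<sigma>. ?c i \<circ> \<sigma>) xs id x = (if i \<in> set xs then ?c i x else x)" if "distinct xs" for xs
    using that
  proof (induction xs)
    case (Cons j xs)
    have "?c i x \<in> cycle_support ls i" using perm assms(2) by (simp add: permutes_in_image)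
    then have "j \<noteq> i \<Longrightarrow> ?c j x = x" "j \<noteq> i \<Longrightarrow> ?c j (?c i x) = ?c i x"
      using out disj[OF assms(2)] disj[of "?c i x"] by blast+
    then show ?case using Cons by auto
  qed simp
  show ?thesis unfolding gamma_perm_def by (subst *) (use assms(1) in auto)
qed

lemma gamma_perm_outside:
  assumes "\<And>i. i < length ls \<Longrightarrow> x \<notin> cycle_support ls i" shows "gamma_perm ls x = x"
proof -
  let ?c = "\<lambda>i. cycle_of_list (sorted_list_of_set (cycle_support ls i))"
  have "foldr (\<lambda>i \<sigma>. ?c i \<circ> \<sigma>) xs id x = x" if "set xs \<subseteq> {..<length ls}" for xs
    using that
  proof (induction xs)
    case (Cons j xs)
    then have "x \<notin> cycle_support ls j" using assms by simp
    then have "?c j x = x" by (intro id_outside_supp) (simp add: cycle_support_def)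
    then show ?case using Cons by simp
  qed simp
  then show ?thesis unfolding gamma_perm_def by (simp add: atLeast0LessThan)
qed

locale cycle_lengths =
  fixes ls :: "nat list"
  assumes nonempty: "ls \<noteq> []" and pos: "\<And>l. l \<in> set ls \<Longrightarrow> l \<ge> 1"
begin

abbreviation "p \<equiv> length ls"
abbreviation "n \<equiv> sum_list ls"
abbreviation "\<gamma> \<equiv> gamma_perm ls"

text \<open>The supports indexed from \<open>1\<close>, like the variables of the series.\<close>

definition supp :: "nat \<Rightarrow> nat set" where "supp i = cycle_support ls (i - 1)"

lemma finite_supp: "finite (supp i)" by (simp add: supp_def cycle_support_def)

lemma supp_disjoint: "i \<in> {1..p} \<Longrightarrow> j \<in> {1..p} \<Longrightarrow> i \<noteq> j \<Longrightarrow> supp i \<inter> supp j = {}"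
  using cycle_support_disjoint[of "i - 1" "j - 1" ls] cycle_support_disjoint[of "j - 1" "i - 1" ls]
  unfolding supp_def by (metis Int_commute One_nat_def Suc_pred atLeastAtMost_iff linorder_neqE_nat less_eq_Suc_le)

lemma card_supp: "i \<in> {1..p} \<Longrightarrow> card (supp i) = ls ! (i - 1)"
  using card_cycle_support[of "i - 1" ls] by (auto simp: supp_def)

lemma card_supp_pos: "i \<in> {1..p} \<Longrightarrow> card (supp i) \<ge> 1"
  using card_supp[of i] pos[of "ls ! (i - 1)"] by fastforce

lemma supp_nonempty: "i \<in> {1..p} \<Longrightarrow> supp i \<noteq> {}"
  using card_supp_pos[of i] by auto

lemma UN_supp: "(\<Union>i\<in>{1..p}. supp i) = {1..n}"
proof -
  have "(\<Union>i\<in>{1..p}. supp i) = (\<Union>i<p. cycle_support ls i)"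
    unfolding supp_def by (rule SUP_eq) force+
  then show ?thesis using cycle_support_UN[of p ls] by simp
qed

sublocale perm_family "{1..p}" supp
  by unfold_locales (use finite_supp supp_disjoint in auto)

lemma gamma_supp:
  assumes "i \<in> {1..p}" "x \<in> supp i"
  shows "\<gamma> x \<in> supp i" "orbit \<gamma> x = supp i"
proof -
  let ?cs = "sorted_list_of_set (supp i)"
  have i: "i - 1 < p" using assms(1) by auto
  have eq: "\<gamma> y = cycle_of_list ?cs y" if "y \<in> supp i" for y
    using gamma_perm_apply[OF i] that by (simp add: supp_def)
  have set: "set ?cs = supp i" using finite_supp by simp
  have perm: "cycle_of_list ?cs permutes supp i" using cycle_permutes[of ?cs] set by simp
  show "\<gamma> x \<in> supp i" using eq[OF assms(2)] perm assms(2) by (simp add: permutes_in_image)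
  have "orbit \<gamma> x = orbit (cycle_of_list ?cs) x"
    by (rule orbit_cong0[of x "supp i"]) (use assms eq perm in \<open>auto simp: permutes_in_image\<close>)
  then show "orbit \<gamma> x = supp i" using orbit_cycle_of_list[of ?cs x] assms(2) set by simp
qed

lemma gamma_preserves: "preserves \<gamma>"
  unfolding preserves_def using gamma_supp(1) by blast

lemma gamma_permutes: "\<gamma> permutes {1..n}"
proof (rule bij_imp_permutes)
  fix x assume "x \<notin> {1..n}"
  then have x: "x \<notin> (\<Union>i\<in>{1..p}. supp i)" by (simp only: UN_supp) simp
  show "\<gamma> x = x"
  proof (rule gamma_perm_outside)
    fix i assume "i < p"
    then have "Suc i \<in> {1..p}" by simp
    moreover have "supp (Suc i) = cycle_support ls i" by (simp add: supp_def)
    ultimately show "x \<notin> cycle_support ls i" using x by blast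
  qed
next
  have "\<gamma> ` {1..n} = {1..n}"
    unfolding UN_supp[symmetric]
  proof (intro equalityI subsetI)
    fix y assume "y \<in> (\<Union>i\<in>{1..p}. supp i)"
    then obtain i where i: "i \<in> {1..p}" "y \<in> supp i" by blast
    then have "y \<in> orbit \<gamma> y" using gamma_supp(2) by blast
    then obtain z where "z \<in> supp i" "y = \<gamma> z"
      using i gamma_supp(2)[OF i] by cases auto
    then show "y \<in> \<gamma> ` (\<Union>i\<in>{1..p}. supp i)" using i by blast
  qed (use gamma_supp(1) in blast)
  then show "bij_betw \<gamma> {1..n} {1..n}" by (simp add: bij_betw_def endo_inj_surj finite_surj_inj eq_card_imp_inj_on)
qed

lemma cycle_partition_gamma: "cycle_partition {1..n} \<gamma> = supp ` {1..p}"
proof -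
  have "cycle_partition (supp i) \<gamma> = {supp i}" if "i \<in> {1..p}" for i
    using gamma_supp(2)[OF that] supp_nonempty[OF that] by (auto simp: cycle_partition_def)
  then show ?thesis unfolding UN_supp[symmetric] cycle_partition_U by auto
qed

lemma inj_supp: "inj_on supp {1..p}"
  using supp_disjoint supp_nonempty by (intro inj_onI) (metis inf.idem)

lemma cycle_type_gamma: "cycle_type {1..n} \<gamma> = mset ls"
proof -
  have "cycle_type {1..n} \<gamma> = image_mset card (image_mset supp (mset_set {1..p}))"
    unfolding cycle_type_def cycle_partition_gamma image_mset_mset_set[OF inj_supp] ..
  also have "\<dots> = image_mset (\<lambda>i. ls ! (i - 1)) (mset_set {1..p})"
    unfolding image_mset.compositionality by (intro image_mset_cong) (use card_supp in auto)
  also have "{1..p} = Suc ` {..<p}" by (simp add: image_Suc_lessThan)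
  also have "image_mset (\<lambda>i. ls ! (i - 1)) (mset_set (Suc ` {..<p})) = image_mset (\<lambda>i. ls ! i) (mset_set {..<p})"
    by (subst image_mset_mset_set[symmetric]) (simp_all add: image_mset.compositionality comp_def)
  also have "\<dots> = mset (map (\<lambda>i. ls ! i) [0..<p])" by (simp add: mset_upt atLeast0LessThan)
  also have "\<dots> = mset ls" by (simp only: map_nth)
  finally show ?thesis .
qed

lemma single_cycle_gamma: "i \<in> {1..p} \<Longrightarrow> single_cycle (supp i) (perm_restrict \<gamma> (supp i))"
  using perm_restrict_block_permutes[of \<gamma> \<gamma> i] gamma_permutes gamma_preserves
    orbit_perm_restrict[of "supp i" \<gamma>] gamma_supp
  unfolding UN_supp single_cycle_def by auto

lemma part_join_top:
  assumes "finite B" "f permutes B" "B \<noteq> {}"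
  shows "part_join (cycle_partition B f) {B} = {B}"
proof -
  have P: "partition_on B (cycle_partition B f)" using partition_on_cycle_partition[OF assms(1,2)] .
  have Q: "partition_on B {B}" using assms(3) by (rule partition_on_space)
  have r: "refines B (cycle_partition B f) {B}"
    using P Q partition_onD1[OF P] by (auto simp: refines_def)
  have 1: "refines B (part_join (cycle_partition B f) {B}) {B}"
    by (rule part_join_least(3)[OF P Q r refines_refl[OF Q]])
  show ?thesis by (rule refines_asym[OF 1 part_join_least(2)[OF P Q]])
qed

text \<open>On the support \<open>\<gamma>\<close> is one cycle, so the join has one block and the
  inverse has one cycle. Genus zero then says that the two remaining cycle counts add up to
  \<open>card (supp i) + 1\<close>.\<close>

lemma genus_0_iff:
  assumes "i \<in> {1..p}" "\<tau> permutes supp i"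
  shows "genus (supp i) \<tau> (inv (perm_restrict \<gamma> (supp i))) = 0 \<longleftrightarrow>
    \<tau> \<in> geodesic (supp i) (perm_restrict \<gamma> (supp i))"
proof -
  let ?g = "perm_restrict \<gamma> (supp i)"
  have sc: "single_cycle (supp i) ?g" by (rule single_cycle_gamma[OF assms(1)])
  then have gp: "?g permutes supp i" by (simp add: single_cycle_def)
  have cg: "cycle_partition (supp i) ?g = {supp i}"
    using sc supp_nonempty[OF assms(1)] by (auto simp: single_cycle_def cycle_partition_def)
  then have ci: "cycle_partition (supp i) (inv ?g) = {supp i}"
    using cycle_partition_inv[OF finite_supp gp] by simp
  have "genus (supp i) \<tau> (inv ?g) = 0 \<longleftrightarrow>
    (of_nat (ncyc (supp i) \<tau> + ncyc (supp i) (\<tau> \<circ> inv ?g)) :: rat) = of_nat (card (supp i) + 1)"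
    unfolding genus_def ci part_join_top[OF finite_supp assms(2) supp_nonempty[OF assms(1)]]
    by (auto simp: field_simps)
  also have "\<dots> \<longleftrightarrow> \<tau> \<in> geodesic (supp i) ?g"
    unfolding of_nat_eq_iff by (simp add: geodesic_def assms(2) cg)
  finally show ?thesis .
qed

lemma refines_gamma_iff:
  assumes "\<tau> permutes {1..n}"
  shows "refines {1..n} (cycle_partition {1..n} \<tau>) (cycle_partition {1..n} \<gamma>) \<longleftrightarrow> preserves \<tau>"
proof
  assume r: "refines {1..n} (cycle_partition {1..n} \<tau>) (cycle_partition {1..n} \<gamma>)"
  show "preserves \<tau>"
    unfolding preserves_def
  proof (intro ballI)
    fix i x assume i: "i \<in> {1..p}" "x \<in> supp i"
    then have x: "x \<in> {1..n}" unfolding UN_supp[symmetric] by blast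
    then have "orbit \<tau> x \<in> cycle_partition {1..n} \<tau>" by (simp add: cycle_partition_def)
    then obtain j where j: "j \<in> {1..p}" "orbit \<tau> x \<subseteq> supp j"
      using r unfolding refines_def cycle_partition_gamma by blast
    then have "x \<in> supp j" using orbit_self[OF _ assms, of x] by auto
    then have "i = j" using supp_disjoint[OF i(1) j(1)] i(2) by blast
    then show "\<tau> x \<in> supp i" using j(2) orbit.base[of \<tau> x] by blast
  qed
next
  assume pr: "preserves \<tau>"
  have "\<exists>Y\<in>supp ` {1..p}. X \<subseteq> Y" if X: "X \<in> cycle_partition {1..n} \<tau>" for X
  proof -
    obtain x where x: "x \<in> {1..n}" "X = orbit \<tau> x" using X by (auto simp: cycle_partition_def)
    then obtain i where "i \<in> {1..p}" "x \<in> supp i" unfolding UN_supp[symmetric] by blast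
    then show ?thesis using orbit_preserves[OF pr] x by blast
  qed
  then show "refines {1..n} (cycle_partition {1..n} \<tau>) (cycle_partition {1..n} \<gamma>)"
    using partition_on_cycle_partition[OF _ assms] partition_on_cycle_partition[OF _ gamma_permutes]
    unfolding refines_def cycle_partition_gamma by simp
qed

text \<open>The conditions on the single supports combine by \<open>geodesic_U_iff\<close>. This
  opens the way to \<open>sum_geodesic_prod\<close> for sums over \<open>NC ls\<close>.\<close>

lemma NC_eq_geodesic: "NC ls = geodesic {1..n} \<gamma>"
proof (intro set_eqI)
  fix \<tau>
  have index: "(\<forall>i<p. Q (cycle_support ls i)) \<longleftrightarrow> (\<forall>i\<in>{1..p}. Q (supp i))" for Q
    unfolding supp_def by (metis One_nat_def Suc_le_eq Suc_pred atLeastAtMost_iff diff_Suc_1 le_add1 plus_1_eq_Suc)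
  show "\<tau> \<in> NC ls \<longleftrightarrow> \<tau> \<in> geodesic {1..n} \<gamma>"
  proof (cases "\<tau> permutes {1..n}")
    case True
    have "\<tau> \<in> NC ls \<longleftrightarrow> preserves \<tau> \<and>
      (\<forall>i\<in>{1..p}. genus (supp i) (perm_restrict \<tau> (supp i)) (inv (perm_restrict \<gamma> (supp i))) = 0)"
      using True refines_gamma_iff[OF True]
        index[of "\<lambda>s. genus s (perm_restrict \<tau> s) (inv (perm_restrict \<gamma> s)) = 0"]
      by (simp add: NC_def)
    also have "\<dots> \<longleftrightarrow> preserves \<tau> \<and>
      (\<forall>i\<in>{1..p}. perm_restrict \<tau> (supp i) \<in> geodesic (supp i) (perm_restrict \<gamma> (supp i)))"
      using genus_0_iff perm_restrict_block_permutes[of \<gamma> \<tau>] gamma_permutes gamma_preserves True unfolding UN_supp by blast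
    also have "\<dots> \<longleftrightarrow> \<tau> \<in> geodesic {1..n} \<gamma>"
      using geodesic_U_iff[of \<gamma> \<tau>] gamma_permutes gamma_preserves True unfolding UN_supp by blast
    finally show ?thesis .
  qed (auto simp: NC_def geodesic_def)
qed

end

section \<open>Coarsenings of the partition into cycles\<close>

lemma partition_on_overlap:
  assumes "partition_on A P" "X \<in> P" "Y \<in> P" "x \<in> X" "x \<in> Y" shows "X = Y"
  using disjointD[OF partition_onD2[OF assms(1)] assms(2,3)] assms(4,5) by blast

lemma part_join_eq_right:
  assumes "refines A P Q" shows "part_join Q P = Q" "part_join P Q = Q"
proof -
  have P: "partition_on A P" and Q: "partition_on A Q" using assms by (auto simp: refines_def)
  have "refines A (part_join Q P) Q" by (rule part_join_least(3)[OF Q P refines_refl[OF Q] assms])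
  then show "part_join Q P = Q" by (rule refines_asym) (rule part_join_least(1)[OF Q P])
  have "refines A (part_join P Q) Q" by (rule part_join_least(3)[OF P Q assms refines_refl[OF Q]])
  then show "part_join P Q = Q" by (rule refines_asym) (rule part_join_least(2)[OF P Q])
qed

text \<open>The edges are now sets themselves, to be taken as the cycles of \<open>\<tau>\<close>,
  and the white vertices are the sets \<open>S i\<close>. A coarsening of \<open>E\<close> is a
  partition of the set of edges, seen through unions.\<close>

locale coloured_partition = coloured_edges E col p for E :: "'a set set" and col p +
  fixes S :: "nat \<Rightarrow> 'a set" and A :: "'a set"
  assumes partE: "partition_on A E" and col_S: "\<And>e. e \<in> E \<Longrightarrow> e \<subseteq> S (col e)"
    and partS: "partition_on A (S ` {1..p})" and inj_S: "inj_on S {1..p}"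
begin

abbreviation "\<Gamma> \<equiv> S ` {1..p}"

lemma edge_nonempty: "e \<in> E \<Longrightarrow> e \<noteq> {}"
  using partition_onD3[OF partE] by blast

lemma S_nonempty: "i \<in> {1..p} \<Longrightarrow> S i \<noteq> {}"
  using partition_onD3[OF partS] by blast

lemma S_overlap: "i \<in> {1..p} \<Longrightarrow> j \<in> {1..p} \<Longrightarrow> x \<in> S i \<Longrightarrow> x \<in> S j \<Longrightarrow> i = j"
  using partition_on_overlap[OF partS, of "S i" "S j" x] inj_onD[OF inj_S, of i j] by blast

lemma UN_S: "A = (\<Union>i\<in>{1..p}. S i)"
  using partition_onD1[OF partS] by simp

lemma refines_edges: "refines A E \<Gamma>"
  using partE partS col_S col unfolding refines_def by blast

lemma edges_below_Union:
  assumes "Q \<subseteq> E" shows "{e \<in> E. e \<subseteq> \<Union>Q} = Q"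
proof (intro equalityI subsetI)
  fix e assume e: "e \<in> {e \<in> E. e \<subseteq> \<Union>Q}"
  then obtain x where x: "x \<in> e" using edge_nonempty by blast
  then obtain e' where "e' \<in> Q" "x \<in> e'" using e by blast
  then have "e = e'" using partition_on_overlap[OF partE, of e e' x] e x assms by blast
  then show "e \<in> Q" using \<open>e' \<in> Q\<close> by simp
qed (use assms in auto)

lemma part_sub: "partition_on E P \<Longrightarrow> Q \<in> P \<Longrightarrow> Q \<subseteq> E"
  by (auto simp: partition_on_def)

lemma inj_on_Union:
  assumes "partition_on E P" shows "inj_on Union P"
proof (rule inj_on_inverseI[of _ "\<lambda>G. {e \<in> E. e \<subseteq> G}"])
  fix Q assume "Q \<in> P"
  then show "{e \<in> E. e \<subseteq> \<Union>Q} = Q" using edges_below_Union part_sub[OF assms] by blast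
qed

lemma refines_Union:
  assumes P: "partition_on E P" shows "refines A E (Union ` P)"
proof -
  have part: "partition_on A (Union ` P)"
  proof (rule partition_onI)
    show "\<Union> (Union ` P) = A"
      using partition_onD1[OF P] partition_onD1[OF partE] by auto
  next
    fix G H assume "G \<in> Union ` P" "H \<in> Union ` P" "G \<noteq> H"
    then obtain Q R where QR: "Q \<in> P" "R \<in> P" "G = \<Union>Q" "H = \<Union>R" "Q \<noteq> R" by blast
    show "disjnt G H"
      unfolding disjnt_def
    proof (rule equals0I)
      fix x assume "x \<in> G \<inter> H"
      then obtain e e' where "e \<in> Q" "e' \<in> R" "x \<in> e" "x \<in> e'" using QR by blast
      then have "e = e'" using partition_on_overlap[OF partE] part_sub[OF P] QR by blast
      then show False using partition_on_overlap[OF P QR(1,2)] \<open>e \<in> Q\<close> \<open>e' \<in> R\<close> QR(5) by blast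
    qed
  next
    have "\<Union>Q \<noteq> {}" if Q: "Q \<in> P" for Q
    proof -
      have "Q \<noteq> {}" using Q partition_onD3[OF P] by auto
      then obtain e where "e \<in> Q" by blast
      then show ?thesis using edge_nonempty[of e] part_sub[OF P Q] by blast
    qed
    then show "{} \<notin> Union ` P" by blast
  qed
  have "\<exists>Y\<in>Union ` P. e \<subseteq> Y" if e: "e \<in> E" for e
  proof -
    obtain Q where "Q \<in> P" "e \<in> Q" using e partition_onD1[OF P] by blast
    then show ?thesis by blast
  qed
  then show ?thesis using partE part by (simp add: refines_def)
qed

text \<open>The inverse sends a block \<open>G\<close> to the set of edges inside \<open>G\<close>;
  they exhaust \<open>G\<close> because \<open>E\<close> refines the partition.\<close>

lemma bij_betw_Union: "bij_betw (\<lambda>P. Union ` P) {P. partition_on E P} {\<pi>. refines A E \<pi>}"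
proof (rule bij_betw_byWitness[where f' = "\<lambda>\<pi>. (\<lambda>G. {e \<in> E. e \<subseteq> G}) ` \<pi>"])
  show "\<forall>P\<in>{P. partition_on E P}. (\<lambda>G. {e \<in> E. e \<subseteq> G}) ` Union ` P = P"
  proof
    fix P assume "P \<in> {P. partition_on E P}"
    then have "(\<lambda>G. {e \<in> E. e \<subseteq> G}) ` Union ` P = (\<lambda>Q. Q) ` P"
      unfolding image_image using edges_below_Union part_sub by (intro image_cong) auto
    then show "(\<lambda>G. {e \<in> E. e \<subseteq> G}) ` Union ` P = P" by simp
  qed
next
  show "\<forall>\<pi>\<in>{\<pi>. refines A E \<pi>}. Union ` (\<lambda>G. {e \<in> E. e \<subseteq> G}) ` \<pi> = \<pi>"
  proof
    fix \<pi> assume r: "\<pi> \<in> {\<pi>. refines A E \<pi>}"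
    have "\<Union>{e \<in> E. e \<subseteq> G} = G" if "G \<in> \<pi>" for G
      using partition_onD1[OF refines_obtains_subset[OF _ that]] r by blast
    then have "Union ` (\<lambda>G. {e \<in> E. e \<subseteq> G}) ` \<pi> = (\<lambda>G. G) ` \<pi>"
      unfolding image_image by (intro image_cong) auto
    then show "Union ` (\<lambda>G. {e \<in> E. e \<subseteq> G}) ` \<pi> = \<pi>" by simp
  qed
next
  show "(\<lambda>P. Union ` P) ` {P. partition_on E P} \<subseteq> {\<pi>. refines A E \<pi>}" using refines_Union by blast
next
  have "partition_on E ((\<lambda>G. {e \<in> E. e \<subseteq> G}) ` \<pi>)" if r: "refines A E \<pi>" for \<pi>
  proof (rule partition_onI)
    have \<pi>: "partition_on A \<pi>" using r by (simp add: refines_def)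
    show "\<Union> ((\<lambda>G. {e \<in> E. e \<subseteq> G}) ` \<pi>) = E" using r unfolding refines_def by blast
    fix q s assume "q \<in> (\<lambda>G. {e \<in> E. e \<subseteq> G}) ` \<pi>" "s \<in> (\<lambda>G. {e \<in> E. e \<subseteq> G}) ` \<pi>" "q \<noteq> s"
    then obtain G H where GH: "G \<in> \<pi>" "H \<in> \<pi>" "q = {e \<in> E. e \<subseteq> G}" "s = {e \<in> E. e \<subseteq> H}" "G \<noteq> H" by blast
    show "disjnt q s"
      unfolding disjnt_def
    proof (rule equals0I)
      fix e assume e: "e \<in> q \<inter> s"
      then obtain x where "x \<in> e" using edge_nonempty GH by blast
      then show False using partition_on_overlap[OF \<pi> GH(1,2), of x] e GH by blast
    qed
  next
    have "{e \<in> E. e \<subseteq> G} \<noteq> {}" if "G \<in> \<pi>" for G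
    proof -
      have "G = \<Union>{e \<in> E. e \<subseteq> G}" by (rule partition_onD1[OF refines_obtains_subset[OF r that]])
      moreover have "G \<noteq> {}" using r that by (auto simp: refines_def partition_on_def)
      ultimately show ?thesis by force
    qed
    then show "{} \<notin> (\<lambda>G. {e \<in> E. e \<subseteq> G}) ` \<pi>" by force
  qed
  then show "(\<lambda>\<pi>. (\<lambda>G. {e \<in> E. e \<subseteq> G}) ` \<pi>) ` {\<pi>. refines A E \<pi>} \<subseteq> {P. partition_on E P}" by blast
qed

text \<open>A proper closed set of colours gives a partition of \<open>A\<close> into two blocks
  that lies above both partitions, so their join is not \<open>{A}\<close>. Conversely, the colours
  \<open>i\<close> with \<open>S i\<close> inside a given block of the join form a nonempty closed
  set.\<close>

lemma part_join_top_iff: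
  assumes P: "partition_on E P"
  shows "part_join (Union ` P) \<Gamma> = {A} \<longleftrightarrow> hyper_connected {1..p} ((`) col ` P)"
proof
  have \<pi>: "partition_on A (Union ` P)" using refines_Union[OF P] by (simp add: refines_def)
  note least = part_join_least[OF \<pi> partS]
  have elem: "e \<in> E" "e \<subseteq> S (col e)" "col e \<in> {1..p}" "e \<noteq> {}" if "e \<in> Q" "Q \<in> P" for e Q
    using part_sub[OF P that(2)] that(1) col_S col edge_nonempty by blast+
  {
    assume J: "part_join (Union ` P) \<Gamma> = {A}"
    show "hyper_connected {1..p} ((`) col ` P)"
    proof (rule hyper_connectedI)
      fix U assume U: "U \<subseteq> {1..p}" "U \<noteq> {}" and
        closed: "\<And>I. I \<in> (`) col ` P \<Longrightarrow> I \<inter> U \<noteq> {} \<Longrightarrow> I \<subseteq> U"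
      show "U = {1..p}"
      proof (rule ccontr)
        assume "U \<noteq> {1..p}"
        then obtain j where j: "j \<in> {1..p}" "j \<notin> U" using U by blast
        define X where "X = (\<Union>i\<in>U. S i)"
        have SX: "S i \<subseteq> A - X" if "i \<in> {1..p}" "i \<notin> U" for i
          using that S_overlap U(1) unfolding UN_S X_def by blast
        have ne: "X \<noteq> {}" "A - X \<noteq> {}"
          using U S_nonempty SX[OF j] S_nonempty[OF j(1)] unfolding X_def by blast+
        have XA: "X \<subseteq> A" using U(1) unfolding UN_S X_def by blast
        have R: "partition_on A {X, A - X}"
          using ne XA by (auto simp: partition_on_def disjoint_def)
        have r1: "refines A \<Gamma> {X, A - X}"
          unfolding refines_def
        proof (intro conjI ballI partS R)
          fix Y assume "Y \<in> \<Gamma>"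
          then obtain i where i: "i \<in> {1..p}" "Y = S i" by blast
          show "\<exists>Z\<in>{X, A - X}. Y \<subseteq> Z"
          proof (cases "i \<in> U")
            case True
            then have "Y \<subseteq> X" using i by (auto simp: X_def)
            then show ?thesis by simp
          next
            case False
            then show ?thesis using SX[OF i(1)] i(2) by simp
          qed
        qed
        have r2: "refines A (Union ` P) {X, A - X}"
        proof -
          have below: "\<Union>Q \<subseteq> X \<or> \<Union>Q \<subseteq> A - X" if Q: "Q \<in> P" for Q
          proof (cases "col ` Q \<inter> U = {}")
            case True
            have "e \<subseteq> A - X" if "e \<in> Q" for e
              using elem[OF that Q] SX[of "col e"] True that by blast
            then show ?thesis by blast
          next
            case False
            then have "col ` Q \<subseteq> U" using closed Q by blast
            then have "e \<subseteq> X" if "e \<in> Q" for e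
              using elem(2)[OF that Q] that unfolding X_def by blast
            then show ?thesis by blast
          qed
          show ?thesis
            unfolding refines_def
          proof (intro conjI ballI \<pi> R)
            fix Y assume "Y \<in> Union ` P"
            then obtain Q where "Q \<in> P" "Y = \<Union>Q" by blast
            then show "\<exists>Z\<in>{X, A - X}. Y \<subseteq> Z" using below[of Q] by simp
          qed
        qed
        have "refines A {A} {X, A - X}" using least(3)[OF r2 r1] unfolding J .
        then have "A \<subseteq> X \<or> A \<subseteq> A - X" by (auto simp: refines_def)
        then show False using ne XA by blast
      qed
    qed
  }
  assume conn: "hyper_connected {1..p} ((`) col ` P)"
  define J where "J = part_join (Union ` P) \<Gamma>"
  have J: "partition_on A J" using least(1) by (simp add: refines_def J_def)
  have SJ: "S i \<subseteq> B" if i: "i \<in> {1..p}" "x \<in> S i" and B: "B \<in> J" "x \<in> B" for i x B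
  proof -
    obtain C where "C \<in> J" "S i \<subseteq> C" using least(2) i(1) unfolding refines_def J_def[symmetric] by blast
    then show ?thesis using partition_on_overlap[OF J B(1), of C x] i B by blast
  qed
  have "B = A" if B: "B \<in> J" for B
  proof -
    define U where "U = {i \<in> {1..p}. S i \<subseteq> B}"
    have BA: "B \<subseteq> A" using B partition_onD1[OF J] by blast
    have "U = {1..p}"
    proof (rule hyper_connectedD[OF conn])
      have "B \<noteq> {}" using B partition_onD3[OF J] by auto
      then obtain x where x: "x \<in> B" by blast
      then obtain i where "i \<in> {1..p}" "x \<in> S i" using BA unfolding UN_S by blast
      then show "U \<noteq> {}" using SJ[OF _ _ B x] by (auto simp: U_def)
      fix I assume I: "I \<in> (`) col ` P" "I \<inter> U \<noteq> {}"
      then obtain Q e where Q: "Q \<in> P" "I = col ` Q" "e \<in> Q" "col e \<in> U" by blast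
      obtain C where C: "C \<in> J" "\<Union>Q \<subseteq> C"
        using least(1) Q(1) unfolding refines_def J_def[symmetric] by blast
      obtain x where "x \<in> e" using elem(4)[OF Q(3,1)] by blast
      then have "x \<in> B" "x \<in> C" using elem(2)[OF Q(3,1)] Q C by (auto simp: U_def)
      then have "C = B" using partition_on_overlap[OF J C(1) B] by blast
      have "col e' \<in> U" if e': "e' \<in> Q" for e'
      proof -
        obtain y where y: "y \<in> e'" using elem(4)[OF e' Q(1)] by blast
        then have "y \<in> B" using C(2) \<open>C = B\<close> e' by blast
        then have "S (col e') \<subseteq> B" using SJ[OF elem(3)[OF e' Q(1)] _ B] elem(2)[OF e' Q(1)] y by blast
        then show ?thesis using elem(3)[OF e' Q(1)] by (simp add: U_def)
      qed
      then show "I \<subseteq> U" using Q(2) by blast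
    qed (auto simp: U_def)
    then have "A \<subseteq> B" unfolding UN_S U_def by blast
    then show ?thesis using BA by blast
  qed
  moreover have "J \<noteq> {}" using partition_onD1[OF J] S_nonempty[of 1] p unfolding UN_S by auto
  ultimately show "part_join (Union ` P) \<Gamma> = {A}" unfolding J_def[symmetric] by blast
qed

text \<open>\<open>E\<close> refines \<open>\<Gamma>\<close>, so the join in the second argument of
  \<open>L_loops\<close> is \<open>\<Gamma>\<close>, with \<open>p\<close> blocks. Once the other
  join is \<open>{A}\<close>, the value is \<open>card E - card P - p + 1\<close>.\<close>

lemma tree_partitions_iff:
  assumes P: "partition_on E P"
  shows "P \<in> tree_partitions \<longleftrightarrow> part_join (Union ` P) \<Gamma> = {A} \<and> L_loops (Union ` P) (part_join \<Gamma> E) E = 0"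
proof (cases "part_join (Union ` P) \<Gamma> = {A}")
  case True
  have "card (Union ` P) = card P" by (rule card_image[OF inj_on_Union[OF P]])
  moreover have "card \<Gamma> = p" using card_image[OF inj_S] by simp
  ultimately have "L_loops (Union ` P) (part_join \<Gamma> E) E = int (card E) - int (card P) - int p + 1"
    unfolding L_loops_def part_join_eq_right(1)[OF refines_edges] True by simp
  moreover have "int (card E) - int (card P) - int p + 1 = 0 \<longleftrightarrow> card E = card P + (p - 1)"
    using p by linarith
  ultimately show ?thesis using True P part_join_top_iff[OF P] by (simp add: tree_partitions_def)
next
  case False
  then show ?thesis using part_join_top_iff[OF P] by (simp add: tree_partitions_def)
qed

lemma bij_betw_tree_partitions:
  "bij_betw (\<lambda>P. Union ` P) tree_partitions
    {\<pi>. refines A E \<pi> \<and> part_join \<pi> \<Gamma> = {A} \<and> L_loops \<pi> (part_join \<Gamma> E) E = 0}"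
proof -
  let ?R = "\<lambda>\<pi>. part_join \<pi> \<Gamma> = {A} \<and> L_loops \<pi> (part_join \<Gamma> E) E = 0"
  have eq: "tree_partitions = {P \<in> {P. partition_on E P}. ?R (Union ` P)}"
  proof (intro set_eqI)
    fix P show "P \<in> tree_partitions \<longleftrightarrow> P \<in> {P \<in> {P. partition_on E P}. ?R (Union ` P)}"
      using tree_partitions_iff[of P] by (cases "partition_on E P") (auto simp: tree_partitions_def)
  qed
  have im: "(\<lambda>P. Union ` P) ` {P. partition_on E P} = {\<pi>. refines A E \<pi>}"
    using bij_betw_Union by (simp add: bij_betw_def)
  have "(\<lambda>P. Union ` P) ` {P \<in> {P. partition_on E P}. ?R (Union ` P)} = {\<pi> \<in> {\<pi>. refines A E \<pi>}. ?R \<pi>}"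
    unfolding im[symmetric] by blast
  then show ?thesis
    unfolding bij_betw_def eq
    by (intro conjI inj_on_subset[OF bij_betw_imp_inj_on[OF bij_betw_Union]]) auto
qed

end

section \<open>The coefficients of the series\<close>

lemma sum_cycle_type:
  assumes "finite A" "\<sigma> permutes A" shows "sum_mset (cycle_type A \<sigma>) = card A"
proof -
  have part: "partition_on A (cycle_partition A \<sigma>)" by (rule partition_on_cycle_partition[OF assms])
  have "finite c" if "c \<in> cycle_partition A \<sigma>" for c
    using Union_upper[OF that] assms(1) unfolding partition_onD1[OF part, symmetric]
    by (rule finite_subset)
  then have "card A = (\<Sum>c\<in>cycle_partition A \<sigma>. card c)"
    using card_Union_disjoint[of "cycle_partition A \<sigma>"] partition_onD1[OF part] partition_onD2[OF part]
    by (simp add: disjoint_def pairwise_def disjnt_def)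
  then show ?thesis by (simp add: cycle_type_def sum_unfold_sum_mset)
qed

text \<open>\<open>gamma_perm ks\<close> represents its cycle type, so the lengths may be listed in
  any order; for a black vertex they will be listed along its sorted white neighbours.\<close>

lemma alpha_cycle_type:
  assumes g: "multiplicative g" and \<sigma>: "\<sigma> permutes {1..m}" "m \<ge> 1"
    and ks: "cycle_type {1..m} \<sigma> = mset ks"
  shows "g {{1..m}} \<sigma> = alpha g ks"
proof -
  have m: "sum_list ks = m" using sum_cycle_type[OF _ \<sigma>(1)] ks by (simp add: sum_mset_sum_list)
  have "k \<ge> 1" if "k \<in> set ks" for k
  proof -
    have "k \<in># cycle_type {1..m} \<sigma>" using that ks by simp
    then obtain c where c: "c \<in> cycle_partition {1..m} \<sigma>" "k = card c"
      using finite_cycle_partition[of "{1..m}" \<sigma>] by (auto simp: cycle_type_def)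
    have "c \<subseteq> {1..m}" "c \<noteq> {}"
      using c(1) partition_on_cycle_partition[OF _ \<sigma>(1)] by (auto simp: partition_on_def)
    then show ?thesis using c(2) finite_subset[of c "{1..m}"] by (simp add: Suc_le_eq card_gt_0_iff)
  qed
  moreover have "ks \<noteq> []" using m \<sigma>(2) by auto
  ultimately interpret cycle_lengths ks by unfold_locales auto
  have "cycle_type {1..m} (gamma_perm ks) = cycle_type {1..m} \<sigma>" "gamma_perm ks permutes {1..m}"
    using cycle_type_gamma gamma_permutes ks unfolding m by auto
  then show ?thesis using g \<sigma> unfolding multiplicative_def alpha_def m by metis
qed

text \<open>The relabelling sends an element to its rank in \<open>G\<close>, a bijection onto
  \<open>{1..card G}\<close>. It conjugates the restriction of \<open>\<tau>\<close>, and so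
  preserves cycle lengths.\<close>

lemma std_restrict_cycle_type:
  assumes \<tau>: "\<tau> permutes A" "finite A" and G: "G \<subseteq> A" "\<And>x. x \<in> G \<Longrightarrow> \<tau> x \<in> G"
  shows "std_restrict \<tau> G permutes {1..card G}"
    and "cycle_type {1..card G} (std_restrict \<tau> G) = image_mset card (mset_set (cycle_partition G \<tau>))"
proof -
  have finG: "finite G" using G(1) \<tau>(2) by (rule finite_subset)
  define f where "f x = card {y \<in> G. y \<le> x}" for x
  have less: "f x < f y" if "x \<in> G" "y \<in> G" "x < y" for x y
  proof -
    have "y \<in> {z \<in> G. z \<le> y}" "y \<notin> {z \<in> G. z \<le> x}" using that by auto
    moreover have "{z \<in> G. z \<le> x} \<subseteq> {z \<in> G. z \<le> y}" using that by auto
    ultimately show ?thesis unfolding f_def using finG by (intro psubset_card_mono) auto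
  qed
  have inj: "inj_on f G" using less by (intro inj_onI) (metis less_irrefl linorder_neqE_nat)
  have "f ` G \<subseteq> {1..card G}"
  proof
    fix z assume "z \<in> f ` G"
    then obtain x where x: "x \<in> G" "z = f x" by blast
    have "{y \<in> G. y \<le> x} \<noteq> {}" using x by auto
    then have "f x > 0" using finG by (simp add: f_def card_gt_0_iff)
    moreover have "f x \<le> card G" unfolding f_def using finG by (intro card_mono) auto
    ultimately show "z \<in> {1..card G}" using x by simp
  qed
  then have fG: "f ` G = {1..card G}"
    using card_image[OF inj] by (intro card_subset_eq) auto
  then have bij: "bij_betw f G {1..card G}" using inj by (simp add: bij_betw_def)
  have eq: "std_restrict \<tau> G = map_permutation G f \<tau>" by (simp add: std_restrict_def f_def[abs_def])
  have r: "perm_restrict \<tau> G permutes G"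
    using perm_restrict_permutes[OF finG permutes_inj[OF \<tau>(1)]] G(2) by blast
  have "map_permutation G f (perm_restrict \<tau> G) = map_permutation G f \<tau>"
    by (rule map_permutation_cong[OF inj r]) (auto simp: perm_restrict_def)
  then show "std_restrict \<tau> G permutes {1..card G}"
    unfolding eq using map_permutation_permutes[OF bij r] by simp
  have sub: "orbit \<tau> x \<subseteq> G" if "x \<in> G" for x using orbit_subset_closed[of G \<tau> x] G(2) that by blast
  have orb: "orbit (std_restrict \<tau> G) (f x) = f ` orbit \<tau> x" if "x \<in> G" for x
    unfolding eq
  proof (rule orbit_inverse[symmetric])
    show "x \<in> orbit \<tau> x" by (rule orbit_self[OF \<tau>(2,1)])
    show "map_permutation G f \<tau> (f y) = f (\<tau> y)" if "y \<in> orbit \<tau> x" for y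
      using that sub[OF \<open>x \<in> G\<close>] by (intro map_permutation_apply[OF inj]) auto
  qed
  let ?C = "cycle_partition G \<tau>"
  have "cycle_partition {1..card G} (std_restrict \<tau> G) = (`) f ` ?C"
    unfolding fG[symmetric] cycle_partition_def image_image using orb by (intro image_cong) auto
  moreover have "inj_on ((`) f) ?C"
    by (rule inj_on_image) (rule inj_on_subset[OF inj], use sub in \<open>auto simp: cycle_partition_def\<close>)
  ultimately have "cycle_type {1..card G} (std_restrict \<tau> G) = image_mset (\<lambda>c. card (f ` c)) (mset_set ?C)"
    by (simp add: cycle_type_def image_mset_mset_set[symmetric] image_mset.compositionality comp_def)
  also have "\<dots> = image_mset card (mset_set ?C)"
  proof (rule image_mset_cong)
    fix c assume "c \<in># mset_set ?C"
    then have "c \<subseteq> G" using finite_cycle_partition[OF finG, of \<tau>] sub by (auto simp: cycle_partition_def)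
    then show "card (f ` c) = card c" using inj by (intro card_image) (rule inj_on_subset)
  qed
  finally show "cycle_type {1..card G} (std_restrict \<tau> G) = image_mset card (mset_set ?C)" .
qed

lemma cycle_partition_Union:
  assumes "finite A" "\<tau> permutes A" "Q \<subseteq> cycle_partition A \<tau>"
  shows "cycle_partition (\<Union>Q) \<tau> = Q" "\<Union>Q \<subseteq> A" "\<And>x. x \<in> \<Union>Q \<Longrightarrow> \<tau> x \<in> \<Union>Q"
proof -
  have orb: "c = orbit \<tau> x" if "c \<in> Q" "x \<in> c" for c x
    using cycle_partition_eq_orbit[OF assms(1,2)] that assms(3) by blast
  have ne: "c \<noteq> {}" if "c \<in> Q" for c
    using that assms(3) partition_onD3[OF partition_on_cycle_partition[OF assms(1,2)]] by blast
  show "cycle_partition (\<Union>Q) \<tau> = Q"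
  proof (intro equalityI subsetI)
    fix c assume "c \<in> cycle_partition (\<Union>Q) \<tau>"
    then obtain x d where "d \<in> Q" "x \<in> d" "c = orbit \<tau> x" by (auto simp: cycle_partition_def)
    then show "c \<in> Q" using orb by metis
  next
    fix c assume c: "c \<in> Q"
    then obtain x where "x \<in> c" using ne by blast
    then show "c \<in> cycle_partition (\<Union>Q) \<tau>"
      using orb[OF c] c unfolding cycle_partition_def by blast
  qed
  show "\<Union>Q \<subseteq> A"
    using assms(3) partition_onD1[OF partition_on_cycle_partition[OF assms(1,2)]] by blast
  fix x assume "x \<in> \<Union>Q"
  then obtain c where c: "c \<in> Q" "x \<in> c" by blast
  then have "\<tau> x \<in> c" using orb[OF c] orbit.base[of \<tau> x] by simp
  then show "\<tau> x \<in> \<Union>Q" using c(1) by blast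
qed

lemma multiplicative_block:
  assumes g: "multiplicative g" and \<tau>: "\<tau> permutes {1..n}"
    and Q: "Q \<subseteq> cycle_partition {1..n} \<tau>" "Q \<noteq> {}"
    and ks: "mset ks = image_mset card (mset_set Q)"
  shows "g {{1..card (\<Union>Q)}} (std_restrict \<tau> (\<Union>Q)) = alpha g ks"
proof (rule alpha_cycle_type[OF g])
  have fin: "finite {1..n}" by simp
  note U = cycle_partition_Union[OF fin \<tau> Q(1)]
  note std = std_restrict_cycle_type[OF \<tau> fin U(2,3)]
  show "std_restrict \<tau> (\<Union>Q) permutes {1..card (\<Union>Q)}" using std(1) by simp
  show "cycle_type {1..card (\<Union>Q)} (std_restrict \<tau> (\<Union>Q)) = mset ks" using std(2) U(1) ks by simp
  obtain c where c: "c \<in> Q" using Q(2) by blast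
  moreover have "c \<noteq> {}"
    using c Q(1) partition_onD3[OF partition_on_cycle_partition[OF fin \<tau>]] by blast
  ultimately have "\<Union>Q \<noteq> {}" by blast
  then show "1 \<le> card (\<Union>Q)" using finite_subset[OF U(2)] by (simp add: Suc_le_eq card_gt_0_iff)
qed

locale coloured_cycles = coloured_partition "cycle_partition {1..n} \<tau>" col p S "{1..n}"
  for n :: nat and \<tau> and col p S +
  assumes n: "n \<ge> 1" and \<tau>: "\<tau> permutes {1..n}"
begin

abbreviation "E \<equiv> cycle_partition {1..n} \<tau>"
abbreviation "A \<equiv> {1..n}"

lemma sum_multiplicative:
  assumes g: "multiplicative g"
  shows "(\<Sum>\<pi> | refines A E \<pi> \<and> part_join \<pi> \<Gamma> = {A} \<and> L_loops \<pi> (part_join \<Gamma> E) E = 0. g \<pi> \<tau>) =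
    (\<Sum>T\<in>bip_trees p. \<Sum>c\<in>tree_choices T.
      (\<Prod>I\<in>T. alpha g (map (\<lambda>i. card (c i I)) (sorted_list_of_set I))) *
      (\<Prod>e\<in>E - chosen T c. alpha g [card e]))"
proof -
  let ?\<phi> = "\<lambda>Q. g {{1..card (\<Union>Q)}} (std_restrict \<tau> (\<Union>Q))"
  have "(\<Sum>\<pi> | refines A E \<pi> \<and> part_join \<pi> \<Gamma> = {A} \<and> L_loops \<pi> (part_join \<Gamma> E) E = 0. g \<pi> \<tau>) =
      (\<Sum>P\<in>tree_partitions. g (Union ` P) \<tau>)"
    by (rule sum.reindex_bij_betw[OF bij_betw_tree_partitions, symmetric])
  also have "\<dots> = (\<Sum>P\<in>tree_partitions. \<Prod>Q\<in>P. ?\<phi> Q)"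
  proof (rule sum.cong)
    fix P assume "P \<in> tree_partitions"
    then have P: "partition_on E P" unfolding tree_partitions_def by blast
    have "refines {1..n} (cycle_partition {1..n} \<tau>) (Union ` P)"
      by (rule refines_Union[OF P])
    then have "g (Union ` P) \<tau> = (\<Prod>G\<in>Union ` P. g {{1..card G}} (std_restrict \<tau> G))"
      using g \<tau> n unfolding multiplicative_def by blast
    also have "\<dots> = (\<Prod>Q\<in>P. ?\<phi> Q)" by (simp add: prod.reindex[OF inj_on_Union[OF P]])
    finally show "g (Union ` P) \<tau> = (\<Prod>Q\<in>P. ?\<phi> Q)" .
  qed simp
  also have "\<dots> = (\<Sum>T\<in>bip_trees p. \<Sum>c\<in>tree_choices T. (\<Prod>I\<in>T. ?\<phi> (block c I)) * (\<Prod>e\<in>E - chosen T c. ?\<phi> {e}))"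
    by (rule sum_tree_partitions)
  also have "\<dots> = (\<Sum>T\<in>bip_trees p. \<Sum>c\<in>tree_choices T.
      (\<Prod>I\<in>T. alpha g (map (\<lambda>i. card (c i I)) (sorted_list_of_set I))) *
      (\<Prod>e\<in>E - chosen T c. alpha g [card e]))"
  proof (intro sum.cong refl arg_cong2[where f = "(*)"] prod.cong)
    fix T c I assume T: "T \<in> bip_trees p" "c \<in> tree_choices T" and I: "I \<in> T"
    \<comment> \<open>Different colours give different cycles, so the cycle lengths of the block are
      listed, with multiplicity, by the elements of \<open>I\<close>.\<close>
    have inj: "inj_on (\<lambda>i. c i I) I" using choice_inj(1)[OF T I _ I] by (intro inj_onI)
    have finI: "finite I" using tree_block_subset[OF T I] by (rule finite_subset) simp
    have "I \<noteq> {}" using tree_block_card[OF T I] by auto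
    then have ne: "block c I \<noteq> {}" by (simp add: block_def)
    have "image_mset card (mset_set (block c I)) = image_mset (\<lambda>i. card (c i I)) (mset_set I)"
      unfolding block_def image_mset_mset_set[OF inj, symmetric] by (simp add: image_mset.compositionality comp_def)
    also have "mset_set I = mset (sorted_list_of_set I)"
      using mset_set_set[OF distinct_sorted_list_of_set, of I] finI by simp
    finally have "mset (map (\<lambda>i. card (c i I)) (sorted_list_of_set I)) = image_mset card (mset_set (block c I))"
      by (simp only: mset_map)
    then show "?\<phi> (block c I) = alpha g (map (\<lambda>i. card (c i I)) (sorted_list_of_set I))"
      using multiplicative_block[OF g \<tau> _ ne] block_sub[OF T I] by simp
  next
    fix T c e assume "e \<in> E - chosen T c"
    then show "?\<phi> {e} = alpha g [card e]" using multiplicative_block[OF g \<tau>, of "{e}" "[card e]"] by simp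
  qed
  finally show ?thesis .
qed

end

section \<open>The expansion of \<open>beta\<close> over trees\<close>

definition inj_choices :: "'i set \<Rightarrow> 'e set \<Rightarrow> ('i \<Rightarrow> 'e) set" where
  "inj_choices D C = {f \<in> D \<rightarrow>\<^sub>E C. inj_on f D}"

context cycle_lengths
begin

lemma sum_list_pos: "n \<ge> 1"
  using nonempty pos by (cases ls) force+

definition colour :: "nat set \<Rightarrow> nat" where
  "colour e = (THE i. i \<in> {1..p} \<and> e \<subseteq> supp i)"

lemma colour_eq:
  assumes "e \<noteq> {}" "i \<in> {1..p}" "e \<subseteq> supp i" shows "colour e = i"
  unfolding colour_def
proof (rule the_equality)
  fix j assume "j \<in> {1..p} \<and> e \<subseteq> supp j"
  then show "j = i" using supp_disjoint[of i j] assms by blast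
qed (use assms in simp)

abbreviation "marks T i \<equiv> {I \<in> T. i \<in> I}"

lemma sum_coarsenings:
  assumes g: "multiplicative g" and \<tau>: "\<tau> \<in> NC ls"
  shows "(\<Sum>\<pi> | refines {1..n} (cycle_partition {1..n} \<tau>) \<pi> \<and>
      part_join \<pi> (cycle_partition {1..n} \<gamma>) = {{1..n}} \<and>
      L_loops \<pi> (part_join (cycle_partition {1..n} \<gamma>) (cycle_partition {1..n} \<tau>)) (cycle_partition {1..n} \<tau>) = 0.
      g \<pi> \<tau>) =
    (\<Sum>T\<in>bip_trees p. \<Sum>c\<in>PiE {1..p} (\<lambda>i. inj_choices (marks T i) (cycle_partition (supp i) \<tau>)).
      (\<Prod>I\<in>T. alpha g (map (\<lambda>i. card (c i I)) (sorted_list_of_set I))) *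
      (\<Prod>i\<in>{1..p}. \<Prod>e\<in>cycle_partition (supp i) \<tau> - c i ` marks T i. alpha g [card e]))"
proof -
  let ?E = "cycle_partition {1..n} \<tau>"
  have t: "\<tau> \<in> geodesic {1..n} \<gamma>" using \<tau> NC_eq_geodesic by simp
  have tp: "\<tau> permutes {1..n}" by (rule geodesic_permutes[OF t])
  have pres: "preserves \<tau>"
    using geodesic_preserves[of \<gamma> \<tau>] gamma_permutes gamma_preserves t unfolding UN_supp by blast
  have EU: "?E = (\<Union>i\<in>{1..p}. cycle_partition (supp i) \<tau>)"
    unfolding UN_supp[symmetric] by (rule cycle_partition_U)
  have part: "partition_on {1..n} ?E" by (rule partition_on_cycle_partition[OF _ tp]) simp
  have sub: "c \<subseteq> supp i" if "i \<in> {1..p}" "c \<in> cycle_partition (supp i) \<tau>" for i c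
    using orbit_preserves[OF pres that(1)] that(2) by (auto simp: cycle_partition_def)
  have ne: "c \<noteq> {}" if "c \<in> ?E" for c using partition_onD3[OF part] that by blast
  have col: "colour c = i" if "i \<in> {1..p}" "c \<in> cycle_partition (supp i) \<tau>" for i c
    using colour_eq[OF ne that(1) sub[OF that]] that EU by blast
  have E_colour: "\<exists>i\<in>{1..p}. e \<in> cycle_partition (supp i) \<tau> \<and> colour e = i" if "e \<in> ?E" for e
    using that col unfolding EU by blast
  interpret C: coloured_cycles n \<tau> colour p supp
  proof
    show "finite ?E" by (simp add: finite_cycle_partition)
    show "1 \<le> p" using nonempty by (simp add: Suc_le_eq)
    show "colour e \<in> {1..p}" if "e \<in> ?E" for e using E_colour[OF that] by blast
    show "partition_on {1..n} ?E" by (rule part)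
    show "e \<subseteq> supp (colour e)" if "e \<in> ?E" for e using E_colour[OF that] sub by blast
    show "partition_on {1..n} (supp ` {1..p})"
      using partition_on_cycle_partition[OF _ gamma_permutes] cycle_partition_gamma by simp
    show "inj_on supp {1..p}" by (rule inj_supp)
    show "1 \<le> n" by (rule sum_list_pos)
    show "\<tau> permutes {1..n}" by (rule tp)
  qed
  have fibre: "{e \<in> ?E. colour e = i} = cycle_partition (supp i) \<tau>" if "i \<in> {1..p}" for i
    using E_colour col[OF that] that unfolding EU by blast
  have choices: "C.tree_choices T = PiE {1..p} (\<lambda>i. inj_choices (marks T i) (cycle_partition (supp i) \<tau>))" for T
    unfolding C.tree_choices_def inj_choices_def using fibre by (intro PiE_cong) simp
  have rest: "(\<Prod>e\<in>?E - C.chosen T c. alpha g [card e]) =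
      (\<Prod>i\<in>{1..p}. \<Prod>e\<in>cycle_partition (supp i) \<tau> - c i ` marks T i. alpha g [card e])"
    if T: "T \<in> bip_trees p" and c: "c \<in> C.tree_choices T" for T c
  proof -
    have eq: "?E - C.chosen T c = (\<Union>i\<in>{1..p}. cycle_partition (supp i) \<tau> - c i ` marks T i)"
    proof (intro equalityI subsetI)
      fix e assume e: "e \<in> ?E - C.chosen T c"
      then obtain i where i: "i \<in> {1..p}" "e \<in> cycle_partition (supp i) \<tau>" using EU by blast
      have "e \<notin> c i ` marks T i" using e unfolding C.chosen_def C.block_def by blast
      then show "e \<in> (\<Union>i\<in>{1..p}. cycle_partition (supp i) \<tau> - c i ` marks T i)" using i by blast
    next
      fix e assume "e \<in> (\<Union>i\<in>{1..p}. cycle_partition (supp i) \<tau> - c i ` marks T i)"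
      then obtain i where i: "i \<in> {1..p}" "e \<in> cycle_partition (supp i) \<tau>" "e \<notin> c i ` marks T i" by blast
      have "e \<notin> C.chosen T c"
      proof
        assume "e \<in> C.chosen T c"
        then obtain I j where I: "I \<in> T" "j \<in> I" "e = c j I" unfolding C.chosen_def C.block_def by blast
        then have "j = i" using C.choice_mem[OF T c I(1,2)] col[OF i(1,2)] by simp
        then show False using I i(3) by blast
      qed
      then show "e \<in> ?E - C.chosen T c" using i EU by blast
    qed
    show ?thesis
      unfolding eq
    proof (rule prod.UNION_disjoint)
      show "\<forall>i\<in>{1..p}. \<forall>j\<in>{1..p}. i \<noteq> j \<longrightarrow>
        (cycle_partition (supp i) \<tau> - c i ` marks T i) \<inter> (cycle_partition (supp j) \<tau> - c j ` marks T j) = {}"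
        using cycle_partition_disj[OF pres] by blast
    qed (simp_all add: finite_cycle_partition finite_supp)
  qed
  show ?thesis
    unfolding cycle_partition_gamma C.sum_multiplicative[OF g]
    by (intro sum.cong choices arg_cong2[where f = "(*)"] refl rest) (simp_all only: choices)
qed

text \<open>The choices are grouped by the lengths \<open>k I i\<close> of the chosen cycles. The
  factors of the black vertices depend on \<open>k\<close> only, and for fixed \<open>k\<close> the
  choices at different white vertices are independent.\<close>

lemma sum_choices_by_size:
  fixes w :: "nat \<Rightarrow> complex" and a :: "nat list \<Rightarrow> complex"
  assumes \<tau>: "\<tau> permutes {1..n}" "preserves \<tau>" and T: "T \<in> bip_trees p"
  shows "(\<Sum>c\<in>PiE {1..p} (\<lambda>i. inj_choices (marks T i) (cycle_partition (supp i) \<tau>)).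
      (\<Prod>I\<in>T. a (map (\<lambda>i. card (c i I)) (sorted_list_of_set I))) *
      (\<Prod>i\<in>{1..p}. \<Prod>e\<in>cycle_partition (supp i) \<tau> - c i ` marks T i. w (card e))) =
    (\<Sum>k\<in>PiE T (\<lambda>I. I \<rightarrow>\<^sub>E {1..n}). (\<Prod>I\<in>T. a (map (k I) (sorted_list_of_set I))) *
      (\<Prod>i\<in>{1..p}. marked_weight w (marks T i) (\<lambda>I. k I i) (cycle_partition (supp i) \<tau>)))"
proof -
  let ?C = "\<lambda>i. cycle_partition (supp i) \<tau>"
  let ?S = "PiE {1..p} (\<lambda>i. inj_choices (marks T i) (?C i))"
  let ?K = "PiE T (\<lambda>I. I \<rightarrow>\<^sub>E {1..n})"
  let ?k = "\<lambda>c. \<lambda>I\<in>T. \<lambda>i\<in>I. card (c i I)"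
  let ?a = "\<lambda>k. \<Prod>I\<in>T. a (map (k I) (sorted_list_of_set I))"
  let ?w = "\<lambda>c. \<Prod>i\<in>{1..p}. \<Prod>e\<in>?C i - c i ` marks T i. w (card e)"
  have finT: "finite T" using T by (rule bip_trees_finite)
  have TV: "I \<subseteq> {1..p}" if "I \<in> T" for I using T that unfolding bip_trees_def by blast
  then have finI: "finite I" if "I \<in> T" for I using that finite_subset by blast
  have finC: "finite (?C i)" for i by (rule finite_cycle_partition[OF finite_supp])
  have in_C: "c i I \<in> ?C i" if "c \<in> ?S" "I \<in> T" "i \<in> I" for c i I
  proof -
    have i: "i \<in> {1..p}" using TV that by blast
    have "c i \<in> marks T i \<rightarrow>\<^sub>E ?C i" using PiE_mem[OF that(1) i] by (simp add: inj_choices_def)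
    then show ?thesis using that by (auto dest: PiE_mem)
  qed
  have card_C: "card e \<in> {1..n}" if i: "i \<in> {1..p}" "e \<in> ?C i" for e i
  proof -
    obtain x where x: "x \<in> supp i" "e = orbit \<tau> x" using i(2) by (auto simp: cycle_partition_def)
    then have "x \<in> {1..n}" using i(1) unfolding UN_supp[symmetric] by blast
    then show ?thesis using orbit_card_bounds[OF _ \<tau>(1), of x] x(2) by simp
  qed
  have finS: "finite ?S"
  proof (rule finite_PiE)
    fix i
    have "finite (marks T i \<rightarrow>\<^sub>E ?C i)" using finT finC by (intro finite_PiE) auto
    then show "finite (inj_choices (marks T i) (?C i))" unfolding inj_choices_def by simp
  qed simp
  have finK: "finite ?K" using finT finI by (intro finite_PiE) auto
  have kK: "?k ` ?S \<subseteq> ?K"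
  proof
    fix k assume "k \<in> ?k ` ?S"
    then obtain c where c: "c \<in> ?S" "k = ?k c" by blast
    have "card (c i I) \<in> {1..n}" if "I \<in> T" "i \<in> I" for I i
      using card_C[OF _ in_C[OF c(1) that]] TV that by blast
    then show "k \<in> ?K" unfolding c(2) by (intro PiE_I) auto
  qed
  have fibre: "{c \<in> ?S. ?k c = k} = PiE {1..p} (\<lambda>i. marked_choices (marks T i) (\<lambda>I. k I i) (?C i))"
    if k: "k \<in> ?K" for k
  proof (intro equalityI subsetI)
    fix c assume "c \<in> {c \<in> ?S. ?k c = k}"
    then have c: "c \<in> ?S" "?k c = k" by simp_all
    show "c \<in> PiE {1..p} (\<lambda>i. marked_choices (marks T i) (\<lambda>I. k I i) (?C i))"
    proof (rule PiE_I)
      fix i assume i: "i \<in> {1..p}"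
      have "card (c i I) = k I i" if "I \<in> marks T i" for I
        using fun_cong[OF fun_cong[OF c(2), of I], of i] that by simp
      moreover have "c i \<in> inj_choices (marks T i) (?C i)"
        by (rule PiE_mem[OF c(1) i])
      ultimately show "c i \<in> marked_choices (marks T i) (\<lambda>I. k I i) (?C i)"
        by (simp add: marked_choices_def inj_choices_def)
    next
      fix i assume "i \<notin> {1..p}"
      then show "c i = undefined" by (rule PiE_arb[OF c(1)])
    qed
  next
    fix c assume c: "c \<in> PiE {1..p} (\<lambda>i. marked_choices (marks T i) (\<lambda>I. k I i) (?C i))"
    have ci: "c i \<in> marked_choices (marks T i) (\<lambda>I. k I i) (?C i)" if "i \<in> {1..p}" for i
      using PiE_mem[OF c that] .
    have "c \<in> ?S"
    proof (rule PiE_I)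
      fix i assume "i \<in> {1..p}"
      then show "c i \<in> inj_choices (marks T i) (?C i)"
        using ci by (simp add: marked_choices_def inj_choices_def)
    qed (rule PiE_arb[OF c])
    moreover have "?k c = k"
    proof (rule PiE_ext[of _ T "\<lambda>I. I \<rightarrow>\<^sub>E {1..n}"])
      show "?k c \<in> ?K" using kK \<open>c \<in> ?S\<close> by blast
      show "k \<in> ?K" by (rule k)
      fix I assume I: "I \<in> T"
      show "?k c I = k I"
      proof (rule PiE_ext[of _ I "\<lambda>_. {1..n}"])
        show "?k c I \<in> I \<rightarrow>\<^sub>E {1..n}" using PiE_mem[OF \<open>?k c \<in> ?K\<close> I] .
        show "k I \<in> I \<rightarrow>\<^sub>E {1..n}" using PiE_mem[OF k I] .
        fix i assume i: "i \<in> I"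
        then have "c i \<in> marked_choices (marks T i) (\<lambda>I. k I i) (?C i)" using ci TV[OF I] by blast
        then show "?k c I i = k I i" using I i by (simp add: marked_choices_def)
      qed
    qed
    ultimately show "c \<in> {c \<in> ?S. ?k c = k}" by simp
  qed
  have "(\<Sum>c\<in>?S. (\<Prod>I\<in>T. a (map (\<lambda>i. card (c i I)) (sorted_list_of_set I))) * ?w c) =
      (\<Sum>c\<in>?S. ?a (?k c) * ?w c)"
  proof (intro sum.cong refl arg_cong2[where f = "(*)"] prod.cong arg_cong[where f = a] map_cong)
    fix c I i assume "I \<in> T" "i \<in> set (sorted_list_of_set I)"
    then show "card (c i I) = ?k c I i" using finI by simp
  qed
  also have "\<dots> = (\<Sum>k\<in>?K. \<Sum>c | c \<in> ?S \<and> ?k c = k. ?a (?k c) * ?w c)"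
    by (rule sum.group[OF finS finK kK, symmetric])
  also have "\<dots> = (\<Sum>k\<in>?K. ?a k * (\<Sum>c | c \<in> ?S \<and> ?k c = k. ?w c))"
    unfolding sum_distrib_left by (intro sum.cong) auto
  also have "\<dots> = (\<Sum>k\<in>?K. ?a k * (\<Prod>i\<in>{1..p}. marked_weight w (marks T i) (\<lambda>I. k I i) (?C i)))"
  proof (intro sum.cong refl arg_cong2[where f = "(*)"])
    fix k assume k: "k \<in> ?K"
    have "(\<Prod>i\<in>{1..p}. marked_weight w (marks T i) (\<lambda>I. k I i) (?C i)) =
        (\<Sum>c\<in>PiE {1..p} (\<lambda>i. marked_choices (marks T i) (\<lambda>I. k I i) (?C i)). ?w c)"
      unfolding marked_weight_def
      by (rule prod_sum_PiE) (use finT finC in \<open>auto intro!: finite_marked_choices\<close>)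
    then show "(\<Sum>c | c \<in> ?S \<and> ?k c = k. ?w c) =
        (\<Prod>i\<in>{1..p}. marked_weight w (marks T i) (\<lambda>I. k I i) (?C i))"
      using fibre[OF k] by simp
  qed
  finally show ?thesis .
qed

text \<open>For fixed lengths \<open>k\<close>, each white vertex sees only the restriction of
  \<open>\<tau>\<close> to its support, so the sum over \<open>\<tau>\<close> factorises by
  \<open>sum_geodesic_prod\<close>. The black vertices couple the white ones through
  \<open>k\<close> alone.\<close>

lemma beta_eq:
  assumes g: "multiplicative g"
  shows "beta g ls = (\<Sum>T\<in>bip_trees p. \<Sum>k\<in>PiE T (\<lambda>I. I \<rightarrow>\<^sub>E {1..n}).
    (\<Prod>I\<in>T. alpha g (map (k I) (sorted_list_of_set I))) *
    (\<Prod>i\<in>{1..p}. \<Sum>\<tau>\<in>geodesic (supp i) (perm_restrict \<gamma> (supp i)).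
      marked_weight (\<lambda>s. alpha g [s]) (marks T i) (\<lambda>I. k I i) (cycle_partition (supp i) \<tau>)))"
proof -
  let ?w = "\<lambda>s. alpha g [s]"
  let ?a = "\<lambda>T k. \<Prod>I\<in>T. alpha g (map (k I) (sorted_list_of_set I))"
  let ?m = "\<lambda>T k i \<tau>. marked_weight ?w (marks T i) (\<lambda>I. k I i) (cycle_partition (supp i) \<tau>)"
  let ?K = "\<lambda>T. PiE T (\<lambda>I. I \<rightarrow>\<^sub>E {1..n})"
  have pres: "preserves \<tau>" "\<tau> permutes {1..n}" if "\<tau> \<in> geodesic {1..n} \<gamma>" for \<tau>
    using geodesic_preserves[of \<gamma> \<tau>] gamma_permutes gamma_preserves that geodesic_permutes
    unfolding UN_supp by blast+
  have "beta g ls = (\<Sum>\<tau>\<in>NC ls. \<Sum>T\<in>bip_trees p. \<Sum>c\<in>PiE {1..p} (\<lambda>i. inj_choices (marks T i) (cycle_partition (supp i) \<tau>)).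
      (\<Prod>I\<in>T. alpha g (map (\<lambda>i. card (c i I)) (sorted_list_of_set I))) *
      (\<Prod>i\<in>{1..p}. \<Prod>e\<in>cycle_partition (supp i) \<tau> - c i ` marks T i. ?w (card e)))"
    unfolding beta_def Let_def by (rule sum.cong[OF refl]) (rule sum_coarsenings[OF g])
  also have "\<dots> = (\<Sum>\<tau>\<in>geodesic {1..n} \<gamma>. \<Sum>T\<in>bip_trees p. \<Sum>k\<in>?K T. ?a T k * (\<Prod>i\<in>{1..p}. ?m T k i \<tau>))"
    unfolding NC_eq_geodesic
    by (intro sum.cong refl sum_choices_by_size) (use pres in auto)
  also have "\<dots> = (\<Sum>T\<in>bip_trees p. \<Sum>k\<in>?K T. ?a T k * (\<Sum>\<tau>\<in>geodesic {1..n} \<gamma>. \<Prod>i\<in>{1..p}. ?m T k i \<tau>))"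
    by (subst sum.swap, intro sum.cong refl, subst sum.swap) (simp only: sum_distrib_left)
  also have "\<dots> = (\<Sum>T\<in>bip_trees p. \<Sum>k\<in>?K T. ?a T k *
      (\<Prod>i\<in>{1..p}. \<Sum>\<tau>\<in>geodesic (supp i) (perm_restrict \<gamma> (supp i)). ?m T k i \<tau>))"
  proof (intro sum.cong refl arg_cong2[where f = "(*)"])
    fix T k
    have "(\<Sum>\<tau>\<in>geodesic {1..n} \<gamma>. \<Prod>i\<in>{1..p}. ?m T k i \<tau>) =
        (\<Sum>\<tau>\<in>geodesic {1..n} \<gamma>. \<Prod>i\<in>{1..p}. ?m T k i (perm_restrict \<tau> (supp i)))"
      by (intro sum.cong prod.cong refl)
        (use pres preservesD in \<open>auto simp: cycle_partition_perm_restrict\<close>)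
    also have "\<dots> = (\<Prod>i\<in>{1..p}. \<Sum>\<tau>\<in>geodesic (supp i) (perm_restrict \<gamma> (supp i)). ?m T k i \<tau>)"
      using sum_geodesic_prod[of \<gamma> "?m T k"] gamma_permutes gamma_preserves unfolding UN_supp by blast
    finally show "(\<Sum>\<tau>\<in>geodesic {1..n} \<gamma>. \<Prod>i\<in>{1..p}. ?m T k i \<tau>) =
        (\<Prod>i\<in>{1..p}. \<Sum>\<tau>\<in>geodesic (supp i) (perm_restrict \<gamma> (supp i)). ?m T k i \<tau>)" .
  qed
  finally show ?thesis .
qed

end

context cycle_lengths
begin

text \<open>For \<open>p \<ge> 2\<close> every white vertex carries a mark, as
  \<open>sum_geodesic_marked\<close> requires.\<close>

lemma beta_tree_sum:
  assumes g: "multiplicative g" and p: "p \<ge> 2"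
  defines "b \<equiv> cycle_series (\<lambda>s. alpha g [s])"
  shows "beta g ls = (\<Sum>T\<in>bip_trees p. of_nat (\<Prod>i\<in>{1..p}. \<Prod>t<card (marks T i) - 1. ls ! (i - 1) - t) *
    (\<Sum>k\<in>PiE T (\<lambda>I. I \<rightarrow>\<^sub>E {1..n}). (\<Prod>I\<in>T. alpha g (map (k I) (sorted_list_of_set I))) *
      (\<Prod>i\<in>{1..p}. (fps_deriv (fps_X * b) * (fps_X * b) ^ (\<Sum>I\<in>marks T i. k I i)
        * inverse b ^ card (marks T i)) $ (ls ! (i - 1)))))"
  unfolding beta_eq[OF g] sum_distrib_left
proof (intro sum.cong refl)
  fix T k assume T: "T \<in> bip_trees p" and k: "k \<in> PiE T (\<lambda>I. I \<rightarrow>\<^sub>E {1..n})"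
  let ?w = "\<lambda>s. alpha g [s]"
  have "(\<Sum>\<tau>\<in>geodesic (supp i) (perm_restrict \<gamma> (supp i)).
      marked_weight ?w (marks T i) (\<lambda>I. k I i) (cycle_partition (supp i) \<tau>)) =
    of_nat (\<Prod>t<card (marks T i) - 1. ls ! (i - 1) - t) *
      (fps_deriv (fps_X * b) * (fps_X * b) ^ (\<Sum>I\<in>marks T i. k I i) * inverse b ^ card (marks T i)) $ (ls ! (i - 1))"
    if i: "i \<in> {1..p}" for i
    unfolding b_def card_supp[OF i, symmetric]
  proof (rule sum_geodesic_marked[OF finite_supp single_cycle_gamma[OF i]])
    show "finite (marks T i)" using bip_trees_finite[OF T] by simp
    show "marks T i \<noteq> {}" by (rule bip_trees_degree_pos[OF T p i])
    fix I assume "I \<in> marks T i"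
    then show "1 \<le> k I i" using PiE_mem[OF k, of I] PiE_mem[of "k I" I "\<lambda>_. {1..n}" i] by simp
  qed
  then show "(\<Prod>I\<in>T. alpha g (map (k I) (sorted_list_of_set I))) *
    (\<Prod>i\<in>{1..p}. \<Sum>\<tau>\<in>geodesic (supp i) (perm_restrict \<gamma> (supp i)).
      marked_weight ?w (marks T i) (\<lambda>I. k I i) (cycle_partition (supp i) \<tau>)) =
    of_nat (\<Prod>i\<in>{1..p}. \<Prod>t<card (marks T i) - 1. ls ! (i - 1) - t) *
      ((\<Prod>I\<in>T. alpha g (map (k I) (sorted_list_of_set I))) *
      (\<Prod>i\<in>{1..p}. (fps_deriv (fps_X * b) * (fps_X * b) ^ (\<Sum>I\<in>marks T i. k I i)
        * inverse b ^ card (marks T i)) $ (ls ! (i - 1))))"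
    by (simp add: prod.distrib mult_ac)
qed

end

text \<open>The only tree for \<open>p = 1\<close> has no black vertex, so no cycle is marked and
  \<open>sum_geodesic_rooted\<close> applies.\<close>

lemma beta_singleton:
  assumes g: "multiplicative g" and l: "l \<ge> 1"
  shows "beta g [l] = cycle_series (\<lambda>s. alpha g [s]) $ l"
proof -
  interpret cycle_lengths "[l]" using l by unfold_locales auto
  have one: "{1..length [l]} = {1}" "length [l] = 1" by auto
  have "(1::nat) \<in> {1..length [l]}" by simp
  note sc = sum_geodesic_rooted[OF finite_supp single_cycle_gamma[OF this]]
  have "beta g [l] = (\<Sum>\<tau>\<in>geodesic (supp 1) (perm_restrict (gamma_perm [l]) (supp 1)).
      cycle_weight (\<lambda>s. alpha g [s]) (supp 1) \<tau>)"
    unfolding beta_eq[OF g] one bip_trees_1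
    by (simp add: marked_weight_def marked_choices_empty cycle_weight_def)
  then show ?thesis using sc card_supp[of 1] by simp
qed

lemma B_series_1:
  assumes g: "multiplicative g"
  shows "B_series g 1 = mfps_of_fps 1 (cycle_series (\<lambda>s. alpha g [s]))"
proof (rule mfps_eqI)
  fix m :: "nat multiset"
  show "mfps_coeff (B_series g 1) m = mfps_coeff (mfps_of_fps 1 (cycle_series (\<lambda>s. alpha g [s]))) m"
  proof (cases "set_mset m = {1}")
    case True
    then have "1 \<in># m" by simp
    moreover from this have "m \<noteq> {#}" by auto
    ultimately have "count m 1 \<ge> 1" "m \<noteq> {#}" by (simp_all add: Suc_le_eq)
    then show ?thesis using True beta_singleton[OF g, of "count m 1"]
      by (simp add: B_series_def gen_series_def mfps_coeff_of_fps)
  next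
    case False
    then have "set_mset m \<subseteq> {1} \<longleftrightarrow> m = {#}" by (simp add: subset_singleton_iff)
    then show ?thesis using False by (simp add: B_series_def gen_series_def mfps_coeff_of_fps)
  qed
qed

lemma B1_at_eq:
  "multiplicative g \<Longrightarrow> B1_at g i = mfps_of_fps i (cycle_series (\<lambda>s. alpha g [s]))"
  unfolding B1_at_def by (simp only: B_series_1 mfps_subst_X)

lemma Y_series_eq:
  "multiplicative g \<Longrightarrow> Y_series g i = mfps_of_fps i (fps_X * cycle_series (\<lambda>s. alpha g [s]))"
  by (simp add: Y_series_def B1_at_eq mfps_of_fps_mult mfps_of_fps_X)

text \<open>All terms of \<open>Y_series g 1\<close> contain the variable, so integration undoes the
  derivative; dividing by the variable then leaves \<open>B_series g 1\<close>.\<close>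

lemma B_series_diff_op:
  assumes g: "multiplicative g"
  shows "diff_op 1 0 (mfps_deriv 1 (Y_series g 1)) = B_series g 1"
proof -
  have "diff_op 1 0 (mfps_deriv 1 (Y_series g 1)) = mfps_shift 1 (Y_series g 1)"
    by (simp add: diff_op_def mfps_integral_deriv_Y[unfolded One_nat_def])
  also have "\<dots> = mfps_of_fps 1 (cycle_series (\<lambda>s. alpha g [s]))"
    unfolding Y_series_eq[OF g] by (rule mfps_eqI) (simp add: mfps_shift_def mfps_coeff_of_fps)
  finally show ?thesis by (simp only: B_series_1[OF g])
qed

text \<open>The coefficients at one monomial \<open>m\<close> are compared. The operators produce
  the falling factorials of \<open>sum_geodesic_marked\<close>. If exactly the variables
  \<open>1..p\<close> occur in \<open>m\<close>, its size is the sum of the cycle lengths, so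
  truncating exponents at \<open>size m\<close> agrees with the bound on cycle lengths in
  \<open>beta_tree_sum\<close>.\<close>

lemma B_series_ge_2:
  assumes g: "multiplicative g" and p: "p \<ge> 2"
  shows "B_series g p =
    (\<Sum>T\<in>bip_trees p. diff_ops p (white_degree T)
       ((\<Prod>i\<in>{1..p}. mfps_deriv i (Y_series g i)) *
        (\<Prod>I\<in>T. H_at g I / (\<Prod>i\<in>I. B1_at g i))))"
proof (rule mfps_eqI)
  fix m :: "nat multiset"
  define b where "b = cycle_series (\<lambda>s. alpha g [s])"
  let ?y = "fps_X * b" and ?V = "{1..p}"
  let ?d = "\<lambda>T i. card {I \<in> T. i \<in> I}"
  let ?f = "\<lambda>T k i. fps_deriv ?y * ?y ^ (\<Sum>I | I \<in> T \<and> i \<in> I. k I i) * inverse b ^ ?d T i"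
  let ?K = "\<lambda>T. PiE T (\<lambda>I. I \<rightarrow>\<^sub>E {1..size m})"
  let ?a = "\<lambda>T k. \<Prod>I\<in>T. alpha g (map (k I) (sorted_list_of_set I))"
  have V: "finite ?V" by simp
  have b0: "b $ 0 = 1" by (simp add: b_def)
  have coeff: "mfps_coeff (diff_ops p (white_degree T) ((\<Prod>i\<in>?V. mfps_deriv i (Y_series g i)) *
        (\<Prod>I\<in>T. H_at g I / (\<Prod>i\<in>I. B1_at g i)))) m =
      of_nat (\<Prod>i\<in>?V. \<Prod>t<?d T i - 1. count m i - t) *
      (\<Sum>k\<in>?K T. ?a T k * (if set_mset m \<subseteq> ?V then \<Prod>i\<in>?V. ?f T k i $ count m i else 0))"
    if T: "T \<in> bip_trees p" for T
  proof -
    have finT: "finite T" by (rule bip_trees_finite[OF T])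
    have sub: "I \<subseteq> ?V" if "I \<in> T" for I using T that unfolding bip_trees_def by blast
    have deg: "1 \<le> white_degree T i" if "i \<in> ?V" for i
      using bip_trees_degree_pos[OF T p that] finT by (simp add: white_degree_def Suc_le_eq card_gt_0_iff)
    have H: "agree (size m) (H_at g I) (\<Sum>k\<in>I \<rightarrow>\<^sub>E {1..size m}.
        mfps_const (alpha g (map k (sorted_list_of_set I))) * (\<Prod>i\<in>I. mfps_of_fps i ?y ^ k i))" if I: "I \<in> T" for I
    proof -
      have "finite I" using sub[OF I] V by (rule finite_subset)
      moreover have "card I \<ge> 2" using T I unfolding bip_trees_def by blast
      then have "card I \<noteq> 1" by simp
      moreover have "mfps_coeff (mfps_of_fps i ?y) {#} = 0" for i :: nat by (simp add: mfps_coeff_of_fps)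
      ultimately show ?thesis
        unfolding H_at_def H_series_def Y_series_eq[OF g] b_def[symmetric]
        by (rule agree_subst_gen_series)
    qed
    have ops: "mfps_coeff (diff_ops p (white_degree T) F) m =
        of_nat (\<Prod>i\<in>?V. \<Prod>t<white_degree T i - 1. count m i - t) * mfps_coeff F m" for F
      using deg by (rule mfps_coeff_diff_ops)
    show ?thesis
      unfolding ops
      unfolding white_degree_def divide_mfps_def Y_series_eq[OF g] B1_at_eq[OF g] b_def[symmetric]
      by (subst mfps_coeff_tree_product[OF V finT sub _ H]) (simp_all add: b0)
  qed
  show "mfps_coeff (B_series g p) m = mfps_coeff (\<Sum>T\<in>bip_trees p. diff_ops p (white_degree T)
       ((\<Prod>i\<in>?V. mfps_deriv i (Y_series g i)) * (\<Prod>I\<in>T. H_at g I / (\<Prod>i\<in>I. B1_at g i)))) m"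
  proof (cases "set_mset m = ?V")
    case True
    define ls where "ls = map (count m) [1..<p + 1]"
    have len: "length ls = p" by (simp add: ls_def)
    have nth: "ls ! (i - 1) = count m i" if "i \<in> ?V" for i
      using that by (cases i) (simp_all add: ls_def del: upt_Suc)
    have sum: "sum_list ls = size m"
    proof -
      have "sum_list ls = (\<Sum>i\<in>set [1..<p + 1]. count m i)"
        unfolding ls_def by (rule sum_list_distinct_conv_sum_set) simp
      also have "set [1..<p + 1] = set_mset m" unfolding True by auto
      finally show ?thesis by (simp add: size_multiset_overloaded_eq)
    qed
    interpret cycle_lengths ls
    proof
      show "ls \<noteq> []" using len p by auto
      have "set ls = count m ` ?V"
        by (simp add: ls_def atLeastLessThanSuc_atLeastAtMost del: upt_Suc)
      moreover fix l assume "l \<in> set ls"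
      ultimately obtain i where "i \<in> ?V" "l = count m i" by blast
      then have "i \<in># m" using True by blast
      then show "1 \<le> l" using \<open>l = count m i\<close> by (simp add: Suc_le_eq)
    qed
    have "mfps_coeff (B_series g p) m = beta g ls"
      unfolding B_series_def using p True by (subst mfps_coeff_gen_series) (simp_all add: ls_def del: upt_Suc)
    also have "\<dots> = (\<Sum>T\<in>bip_trees p. of_nat (\<Prod>i\<in>?V. \<Prod>t<?d T i - 1. ls ! (i - 1) - t) *
        (\<Sum>k\<in>?K T. ?a T k * (\<Prod>i\<in>?V. ?f T k i $ (ls ! (i - 1)))))"
      using beta_tree_sum[OF g] p unfolding len sum b_def[symmetric] by blast
    also have "\<dots> = (\<Sum>T\<in>bip_trees p. of_nat (\<Prod>i\<in>?V. \<Prod>t<?d T i - 1. count m i - t) *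
        (\<Sum>k\<in>?K T. ?a T k * (\<Prod>i\<in>?V. ?f T k i $ count m i)))"
      by (intro sum.cong refl arg_cong2[where f = "(*)"] arg_cong[where f = of_nat] prod.cong)
        (simp_all only: nth)
    finally show ?thesis unfolding mfps_coeff_sum by (simp only: coeff True subset_refl if_True cong: sum.cong)
  next
    case False
    have lhs: "mfps_coeff (B_series g p) m = 0"
      unfolding B_series_def using p False by (subst mfps_coeff_gen_series) simp_all
    \<comment> \<open>If the variable \<open>i\<close> does not occur in \<open>m\<close>, the
      factor of the white vertex \<open>i\<close> contains a positive power of \<open>?y\<close>,
      which has no constant term.\<close>
    have zero: "?a T k * (if set_mset m \<subseteq> ?V then \<Prod>i\<in>?V. ?f T k i $ count m i else 0) = 0"
      if T: "T \<in> bip_trees p" and k: "k \<in> ?K T" for T k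
    proof (cases "set_mset m \<subseteq> ?V")
      case True
      then obtain i where i: "i \<in> ?V" "i \<notin># m" using False by blast
      obtain I where I: "I \<in> T" "i \<in> I" using bip_trees_degree_pos[OF T p i(1)] by blast
      have "k I i \<ge> 1" using PiE_mem[OF PiE_mem[OF k I(1)] I(2)] by simp
      then have "(\<Sum>I | I \<in> T \<and> i \<in> I. k I i) \<noteq> 0"
        using I bip_trees_finite[OF T] by auto
      then have "?f T k i $ count m i = 0" using i(2) by (simp add: not_in_iff fps_power_zeroth)
      then show ?thesis using i(1) V by (auto intro!: disjI2 bexI[of _ i])
    qed simp
    show ?thesis
      unfolding mfps_coeff_sum lhs
    proof (rule sum.neutral[symmetric], rule ballI)
      fix T assume T: "T \<in> bip_trees p"
      show "mfps_coeff (diff_ops p (white_degree T) ((\<Prod>i\<in>?V. mfps_deriv i (Y_series g i)) *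
          (\<Prod>I\<in>T. H_at g I / (\<Prod>i\<in>I. B1_at g i)))) m = 0"
        unfolding coeff[OF T] by (simp only: zero[OF T] sum.neutral_const mult_zero_right cong: sum.cong)
    qed
  qed
qed

theorem theorem4p1:
  fixes g :: "nat set set \<Rightarrow> (nat \<Rightarrow> nat) \<Rightarrow> complex" and p :: nat
  assumes "multiplicative g" and "p \<ge> 1"
  shows "B_series g p =
    (\<Sum>T\<in>bip_trees p. diff_ops p (white_degree T)
       ((\<Prod>i\<in>{1..p}. mfps_deriv i (Y_series g i)) *
        (\<Prod>I\<in>T. H_at g I / (\<Prod>i\<in>I. B1_at g i))))"
proof (cases "p = 1")
  case True
  then show ?thesis
    using B_series_diff_op[OF assms(1)] by (simp add: bip_trees_1[unfolded One_nat_def] diff_ops_def white_degree_def)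
next
  case False
  then show ?thesis using B_series_ge_2[OF assms(1)] assms(2) by simp
qed

end
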